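(* For every $0<s_0<1$ and every self-similar measure $\mu$ on the tree-like fractal $K$, there exists a unique regular Dirichlet form $(\mathcal{E},\mathcal{F})$ on $L^2(K,\mu)$ that is self-similar in the sense that $$\mathcal{E}(u)=\sum_{i=0}^3s_i^{-1}\mathcal{E}(u\circ F_i)\quad\text{for all }u\in\mathcal{F},$$ where $s_1=s_0$ and $s_2=s_3=1-s_0$, and that satisfies $R(q_1,q_2)=R(q_1,q_3)=1$, where $R$ is the effective resistance of $(\mathcal{E},\mathcal{F})$.
   Context: Fractal. Let $F_0,F_1,F_2,F_3:\mathbb{R}^2\to\mathbb{R}^2$ be $F_0(x,y)=\left(\frac29x+\frac{8}{9\sqrt3}y,\frac23y\right)$, $F_1(x,y)=\left(\frac29x-\frac{8}{9\sqrt3}y,\frac23y\right)$, $F_2(x,y)=\left(\frac13x-\frac23,\frac13y-\frac1{\sqrt3}\right)$, $F_3(x,y)=\left(\frac13x+\frac23,\frac13y-\frac1{\sqrt3}\right)$, and let $K$ be the unique non-empty compact set with $K=\bigcup_{i=0}^3F_i(K)$. Let $q_1=(0,0)$ (fixed by $F_0$ and $F_1$), $q_2=(-1,-\frac{\sqrt3}{2})$ (fixed by $F_2$), $q_3=(1,-\frac{\sqrt3}{2})$ (fixed by $F_3$). Self-similar measures. For $\mathbf w=(w_0,w_1,w_2,w_3)\in(0,1)^4$ with $\sum_iw_i=1$, the self-similar measure $\mu_{\mathbf w}$ is the unique Borel probability measure on $K$ with $\mu_{\mathbf w}(A)=\sum_{i=0}^3w_i\,\mu_{\mathbf w}(F_i^{-1}(A))$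 for all Borel $A\subset K$. Dirichlet forms. A Dirichlet form on $L^2(K,\mu)$ is a symmetric non-negative semi-definite bilinear form $\mathcal{E}$ on a dense linear subspace $\mathcal{F}\subset L^2(K,\mu)$ such that $\mathcal{F}$ is a Hilbert space under $\mathcal{E}(u,v)+(u,v)_{L^2(\mu)}$ and $\mathcal{E}((u\vee0)\wedge1)\le\mathcal{E}(u)$ for all $u\in\mathcal{F}$, where $\mathcal{E}(u):=\mathcal{E}(u,u)$ (and $\mathcal{E}(u):=\infty$ for $u\in L^2\setminus\mathcal{F}$). Regularity is the usual notion. The effective resistance is $R(x,y)=1/\inf\{\mathcal{E}(u):u(x)=0,\,u(y)=1\}$, the infimum being over $u\in\mathcal{F}$, with pointwise values understood for continuous functions.
   Formalization: The self-similarity identity is required for all u in F and also for all continuous u on K (with E = ∞ outside F), i.e. a continuous u with every u∘F_i in F must lie in F; with the identity on F alone, uniqueness fails. *)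

theory Defs
  imports "HOL-Probability.Probability"
begin

section \<open>The fractal\<close>

definition ifs :: "nat \<Rightarrow> real \<times> real \<Rightarrow> real \<times> real" where
  "ifs i = (\<lambda>(x, y).
     if i = 0 then (2/9 * x + 8 / (9 * sqrt 3) * y, 2/3 * y)
     else if i = 1 then (2/9 * x - 8 / (9 * sqrt 3) * y, 2/3 * y)
     else if i = 2 then (1/3 * x - 2/3, 1/3 * y - 1 / sqrt 3)
     else (1/3 * x + 2/3, 1/3 * y - 1 / sqrt 3))"

definition is_attractor :: "(real \<times> real) set \<Rightarrow> bool" where
  "is_attractor K \<longleftrightarrow> compact K \<and> K \<noteq> {} \<and> K = (\<Union>i<4. ifs i ` K)"

text \<open>Well-defined by \<open>ex1_attractor\<close> below.\<close>

definition fractal :: "(real \<times> real) set" where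
  "fractal = (THE K. is_attractor K)"

definition q1 :: "real \<times> real" where "q1 = (0, 0)"
definition q2 :: "real \<times> real" where "q2 = (-1, - (sqrt 3 / 2))"
definition q3 :: "real \<times> real" where "q3 = (1, - (sqrt 3 / 2))"

lemma ifs_fixed: "ifs 0 q1 = q1" "ifs 1 q1 = q1" "ifs 2 q2 = q2" "ifs 3 q3 = q3"
  by (auto simp: ifs_def q1_def q2_def q3_def field_simps)

lemma ifs_contraction: "dist (ifs i p) (ifs i q) \<le> 19/20 * dist p q"
proof -
  obtain a b c d where pq: "p = (a, b)" "q = (c, d)" by (metis surj_pair)
  have D: "dist (a1, b1) (c1, d1) \<le> 19/20 * dist (a, b) (c, d)"
    if "(a1 - c1)\<^sup>2 + (b1 - d1)\<^sup>2 \<le> 361/400 * ((a - c)\<^sup>2 + (b - d)\<^sup>2)" for a1 b1 c1 d1 :: real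
  proof -
    have "sqrt ((a1 - c1)\<^sup>2 + (b1 - d1)\<^sup>2) \<le> sqrt ((19/20)\<^sup>2 * ((a - c)\<^sup>2 + (b - d)\<^sup>2))"
      using that by (intro real_sqrt_le_mono) (simp add: power2_eq_square)
    also have "\<dots> = 19/20 * sqrt ((a - c)\<^sup>2 + (b - d)\<^sup>2)"
      by (subst real_sqrt_mult) simp
    finally show ?thesis by (simp add: dist_Pair_Pair dist_real_def)
  qed
  have key: "(2/9 * X + t * Y)\<^sup>2 + (2/3 * Y)\<^sup>2 \<le> 361/400 * (X\<^sup>2 + Y\<^sup>2)"
    if t: "t\<^sup>2 = 64/243" for X Y t :: real
  proof -
    have "(2/9 * X + t * Y)\<^sup>2 + (2/9 * Y - t * X)\<^sup>2 = (4/81 + t\<^sup>2) * (X\<^sup>2 + Y\<^sup>2)"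
      by (simp add: power2_eq_square algebra_simps)
    then have "(2/9 * X + t * Y)\<^sup>2 \<le> (4/81 + 64/243) * (X\<^sup>2 + Y\<^sup>2)"
      using t by (smt (verit) zero_le_power2)
    moreover have "(2/3 * Y)\<^sup>2 = 4/9 * Y\<^sup>2" by (simp add: power2_eq_square)
    moreover have "0 \<le> X\<^sup>2" "0 \<le> Y\<^sup>2" by auto
    moreover have "p + q \<le> 361/400 * (a + b)"
      if "p \<le> (4/81 + 64/243) * (a + b)" "q = 4/9 * b" "0 \<le> a" "0 \<le> b" for p q a b :: real
      using that by (simp add: field_simps)
    ultimately show ?thesis by blast
  qed
  have t: "(8 / (9 * sqrt 3))\<^sup>2 = (64/243 :: real)" by (simp add: power_divide power_mult_distrib)
  have t': "(- (8 / (9 * sqrt 3)))\<^sup>2 = (64/243 :: real)" using t by simp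
  have k: "(X / 3)\<^sup>2 + (Y / 3)\<^sup>2 \<le> 361/400 * (X\<^sup>2 + Y\<^sup>2)" for X Y :: real
  proof -
    have "0 \<le> X\<^sup>2" "0 \<le> Y\<^sup>2" by auto
    moreover have "(X / 3)\<^sup>2 = X\<^sup>2 / 9" "(Y / 3)\<^sup>2 = Y\<^sup>2 / 9" by (simp_all add: power_divide)
    ultimately show ?thesis unfolding distrib_left by linarith
  qed
  consider "i = 0" | "i = 1" | "i \<noteq> 0" "i \<noteq> 1" by blast
  then show ?thesis
  proof cases
    case 1
    have "ifs i (a, b) = (2/9 * a + 8 / (9 * sqrt 3) * b, 2/3 * b)" "ifs i (c, d) = (2/9 * c + 8 / (9 * sqrt 3) * d, 2/3 * d)"
      using 1 by (simp_all add: ifs_def)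
    moreover have "2/9 * a + 8 / (9 * sqrt 3) * b - (2/9 * c + 8 / (9 * sqrt 3) * d) = 2/9 * (a - c) + 8 / (9 * sqrt 3) * (b - d)"
      "2/3 * b - 2/3 * d = 2/3 * (b - d)" by (simp_all only: left_diff_distrib right_diff_distrib)
    ultimately show ?thesis
      unfolding pq using key[OF t, of "a - c" "b - d"] by (metis D)
  next
    case 2
    have "ifs i (a, b) = (2/9 * a + (- (8 / (9 * sqrt 3))) * b, 2/3 * b)" "ifs i (c, d) = (2/9 * c + (- (8 / (9 * sqrt 3))) * d, 2/3 * d)"
      using 2 by (simp_all add: ifs_def)
    moreover have "2/9 * a + (- (8 / (9 * sqrt 3))) * b - (2/9 * c + (- (8 / (9 * sqrt 3))) * d) = 2/9 * (a - c) + (- (8 / (9 * sqrt 3))) * (b - d)"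
      "2/3 * b - 2/3 * d = 2/3 * (b - d)" by (simp_all only: left_diff_distrib right_diff_distrib)
    ultimately show ?thesis
      unfolding pq using key[OF t', of "a - c" "b - d"] by (metis D)
  next
    case 3
    define e :: real where "e = (if i = 2 then - (2/3) else 2/3)"
    have "ifs i (a, b) = (a / 3 + e, b / 3 - 1 / sqrt 3)" "ifs i (c, d) = (c / 3 + e, d / 3 - 1 / sqrt 3)"
      using 3 by (simp_all add: ifs_def e_def)
    moreover have "a / 3 + e - (c / 3 + e) = (a - c) / 3"
      "b / 3 - 1 / sqrt 3 - (d / 3 - 1 / sqrt 3) = (b - d) / 3" by (simp_all add: diff_divide_distrib)
    ultimately show ?thesis
      unfolding pq using k[of "a - c" "b - d"] by (metis D)
  qed
qed

lemma continuous_on_ifs: "continuous_on S (ifs i)"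
  unfolding ifs_def case_prod_beta by (cases "i = 0"; cases "i = 1"; cases "i = 2") (auto intro!: continuous_intros)

lemma inj_ifs: "inj (ifs i)"
  by (auto simp: inj_def ifs_def split: if_splits)

theorem ex1_attractor: "\<exists>!K. is_attractor K"
proof -
  define \<Phi> where "\<Phi> = (\<lambda>A. \<Union>i<4. ifs i ` A)"
  define B where "B = cball (0 :: real \<times> real) 20"
  define C where "C = (\<lambda>n. (\<Phi> ^^ n) B)"
  define K where "K = (\<Inter>n. C n)"
  have mono: "\<Phi> A \<subseteq> \<Phi> A'" if "A \<subseteq> A'" for A A' using that unfolding \<Phi>_def by blast
  have Suc: "C (Suc n) = \<Phi> (C n)" for n by (simp add: C_def)
  have n0: "norm (ifs i 0) \<le> 1" for i
  proof -
    have "sqrt (4/9 + 1/3) \<le> (1::real)" by simp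
    then show ?thesis by (simp add: ifs_def zero_prod_def norm_Pair power_divide)
  qed
  have "ifs i p \<in> B" if "p \<in> B" for i p
  proof -
    have "norm (ifs i p) \<le> norm (ifs i 0) + dist (ifs i p) (ifs i 0)"
      by (simp add: dist_norm norm_triangle_sub)
    also have "\<dots> \<le> 1 + 19/20 * dist p 0" using n0 ifs_contraction by (intro add_mono)
    also have "\<dots> \<le> 20" using that by (simp add: B_def)
    finally show ?thesis by (simp add: B_def)
  qed
  then have B: "\<Phi> B \<subseteq> B" unfolding \<Phi>_def by blast
  have dec1: "C (Suc n) \<subseteq> C n" for n
    by (induction n) (use B mono Suc in \<open>auto simp: C_def\<close>)
  have dec: "C n \<subseteq> C m" if "m \<le> n" for m n
    using lift_Suc_antimono_le[of C, OF dec1 that] .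
  have comp: "compact (C n)" for n
  proof (induction n)
    case (Suc n)
    then show ?case unfolding \<open>C (Suc n) = \<Phi> (C n)\<close> \<Phi>_def
      by (intro compact_UN compact_continuous_image continuous_on_ifs) auto
  qed (simp add: C_def B_def)
  have "compact K" unfolding K_def using comp by (intro compact_Inter) auto
  moreover have "0 \<in> C n" for n
  proof (induction n)
    case (Suc n)
    have "ifs 0 0 = 0" by (simp add: ifs_def zero_prod_def)
    with Suc have "0 \<in> ifs 0 ` C n" by (metis image_eqI)
    then show ?case unfolding \<open>C (Suc n) = \<Phi> (C n)\<close> \<Phi>_def by (rule UN_I[rotated]) simp
  qed (simp add: C_def B_def)
  then have "K \<noteq> {}" unfolding K_def by blast
  moreover have "K \<subseteq> \<Phi> K"
  proof
    fix x assume x: "x \<in> K"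
    have "\<exists>i<4. \<forall>n. x \<in> ifs i ` C n"
    proof (rule ccontr)
      assume "\<not> ?thesis"
      then obtain f where f: "\<And>i. i < 4 \<Longrightarrow> x \<notin> ifs i ` C (f i)" by metis
      define N where "N = Max (f ` {..<4})"
      have "x \<in> \<Phi> (C N)" using x Suc unfolding K_def by blast
      then obtain i where "i < 4" "x \<in> ifs i ` C N" unfolding \<Phi>_def by auto
      moreover have "f i \<le> N" unfolding N_def using \<open>i < 4\<close> by (intro Max_ge) auto
      ultimately show False using f dec by blast
    qed
    then obtain i where i: "i < 4" "\<And>n. x \<in> ifs i ` C n" by blast
    then obtain y where y: "x = ifs i y" by blast
    have "y \<in> C n" for n using i(2)[of n] y inj_ifs by (auto dest: injD)
    then show "x \<in> \<Phi> K" using i(1) y unfolding K_def \<Phi>_def by blast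
  qed
  moreover have "\<Phi> K \<subseteq> K"
  proof -
    have "\<Phi> K \<subseteq> C n" for n
    proof -
      have "\<Phi> K \<subseteq> \<Phi> (C n)" by (intro mono) (auto simp: K_def)
      then show ?thesis using dec1 Suc by blast
    qed
    then show ?thesis unfolding K_def by blast
  qed
  ultimately have ex: "is_attractor K" unfolding is_attractor_def \<Phi>_def by blast
  have sub: "A \<subseteq> L" if A: "is_attractor A" and L: "is_attractor L" for A L
  proof
    have cA: "compact A" "A \<noteq> {}" and eA: "A = (\<Union>i<4. ifs i ` A)"
      and cL: "compact L" "L \<noteq> {}" and eL: "L = (\<Union>i<4. ifs i ` L)"
      using A L unfolding is_attractor_def by auto
    obtain x where x: "x \<in> A" "\<And>z. z \<in> A \<Longrightarrow> infdist z L \<le> infdist x L"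
      using continuous_attains_sup[OF cA continuous_on_infdist[OF continuous_on_id, of A L]]
      by auto
    obtain i y where iy: "i < 4" "y \<in> A" "x = ifs i y" using x(1) eA by blast
    obtain l where l: "l \<in> L" "infdist y L = dist y l"
      using infdist_attains_inf[of L y] cL compact_imp_closed by blast
    have "ifs i l \<in> L" using eL l(1) iy(1) by blast
    then have "infdist x L \<le> dist x (ifs i l)" by (rule infdist_le)
    also have "\<dots> \<le> 19/20 * infdist y L" using ifs_contraction iy l by simp
    also have "\<dots> \<le> 19/20 * infdist x L" using x(2) iy by simp
    finally have "infdist x L \<le> 0" by simp
    then have "infdist z L = 0" if "z \<in> A" for z
      using x(2)[OF that] infdist_nonneg[of z L] by linarith
    moreover fix z assume "z \<in> A"
    ultimately show "z \<in> L"
      using in_closed_iff_infdist_zero[of L z] cL compact_imp_closed by blast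
  qed
  show ?thesis using ex sub by (metis subset_antisym)
qed

text \<open>A Borel measure on the fractal: its space is \<open>fractal\<close> itself and the preimages are taken there.\<close>

definition self_similar_measure :: "(nat \<Rightarrow> real) \<Rightarrow> (real \<times> real) measure \<Rightarrow> bool" where
  "self_similar_measure w \<mu> \<longleftrightarrow>
     sets \<mu> = sets (restrict_space borel fractal) \<and> prob_space \<mu> \<and>
     (\<forall>A\<in>sets \<mu>. emeasure \<mu> A = (\<Sum>i<4. ennreal (w i) * emeasure \<mu> (ifs i -` A \<inter> space \<mu>)))"


section \<open>Dirichlet forms\<close>

text \<open>
  Elements of \<open>L\<^sup>2(\<mu>)\<close> are represented by square-integrable functions (their values
  outside \<open>space \<mu>\<close> are irrelevant).  A form domain is a set of such functions that is
  closed under almost-everywhere equality, and the form depends only on the classes.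
\<close>

definition L2 :: "'a measure \<Rightarrow> ('a \<Rightarrow> real) set" where
  "L2 \<mu> = {u \<in> borel_measurable \<mu>. integrable \<mu> (\<lambda>x. (u x)\<^sup>2)}"

definition form_norm_sq ::
  "'a measure \<Rightarrow> (('a \<Rightarrow> real) \<Rightarrow> ('a \<Rightarrow> real) \<Rightarrow> real) \<Rightarrow> ('a \<Rightarrow> real) \<Rightarrow> real" where
  "form_norm_sq \<mu> \<E> u = \<E> u u + (LINT x|\<mu>. (u x)\<^sup>2)"

definition symmetric_form ::
  "'a measure \<Rightarrow> (('a \<Rightarrow> real) \<Rightarrow> ('a \<Rightarrow> real) \<Rightarrow> real) \<Rightarrow> ('a \<Rightarrow> real) set \<Rightarrow> bool" where
  "symmetric_form \<mu> \<E> F \<longleftrightarrow>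
     F \<subseteq> L2 \<mu> \<and>
     (\<forall>u\<in>F. \<forall>v\<in>borel_measurable \<mu>. (AE x in \<mu>. u x = v x) \<longrightarrow> v \<in> F \<and> (\<forall>f\<in>F. \<E> u f = \<E> v f)) \<and>
     (\<lambda>x. 0) \<in> F \<and>
     (\<forall>u\<in>F. \<forall>v\<in>F. (\<lambda>x. u x + v x) \<in> F) \<and>
     (\<forall>u\<in>F. \<forall>c. (\<lambda>x. c * u x) \<in> F) \<and>
     (\<forall>u\<in>F. \<forall>v\<in>F. \<forall>f\<in>F. \<E> (\<lambda>x. u x + v x) f = \<E> u f + \<E> v f) \<and>
     (\<forall>u\<in>F. \<forall>f\<in>F. \<forall>c. \<E> (\<lambda>x. c * u x) f = c * \<E> u f) \<and>
     (\<forall>u\<in>F. \<forall>v\<in>F. \<E> u v = \<E> v u) \<and>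
     (\<forall>u\<in>F. 0 \<le> \<E> u u)"

definition dirichlet_form ::
  "'a measure \<Rightarrow> (('a \<Rightarrow> real) \<Rightarrow> ('a \<Rightarrow> real) \<Rightarrow> real) \<Rightarrow> ('a \<Rightarrow> real) set \<Rightarrow> bool" where
  "dirichlet_form \<mu> \<E> F \<longleftrightarrow>
     symmetric_form \<mu> \<E> F \<and>
     \<comment> \<open>density in \<open>L\<^sup>2\<close>\<close>
     (\<forall>f\<in>L2 \<mu>. \<forall>\<epsilon>>0. \<exists>u\<in>F. (LINT x|\<mu>. (f x - u x)\<^sup>2) < \<epsilon>) \<and>
     \<comment> \<open>completeness\<close>
     (\<forall>u. (\<forall>n::nat. u n \<in> F) \<longrightarrow>
        (\<forall>\<epsilon>>0. \<exists>N. \<forall>m\<ge>N. \<forall>n\<ge>N. form_norm_sq \<mu> \<E> (\<lambda>x. u m x - u n x) < \<epsilon>) \<longrightarrow>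
        (\<exists>v\<in>F. (\<lambda>n. form_norm_sq \<mu> \<E> (\<lambda>x. u n x - v x)) \<longlonglongrightarrow> 0)) \<and>
     \<comment> \<open>Markov property\<close>
     (\<forall>u\<in>F. (\<lambda>x. min (max (u x) 0) 1) \<in> F \<and>
        \<E> (\<lambda>x. min (max (u x) 0) 1) (\<lambda>x. min (max (u x) 0) 1) \<le> \<E> u u)"

text \<open>
  Regularity for a compact underlying space, where \<open>C\<^sub>c = C\<close>: the continuous functions in the
  domain are a core, i.e. dense in the domain and uniformly dense in the continuous functions.
\<close>

definition regular_form ::
  "'a::topological_space measure \<Rightarrow> (('a \<Rightarrow> real) \<Rightarrow> ('a \<Rightarrow> real) \<Rightarrow> real) \<Rightarrow> ('a \<Rightarrow> real) set \<Rightarrow> bool" where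
  "regular_form \<mu> \<E> F \<longleftrightarrow>
     (\<forall>u\<in>F. \<forall>\<epsilon>>0. \<exists>v\<in>F. continuous_on (space \<mu>) v \<and> form_norm_sq \<mu> \<E> (\<lambda>x. u x - v x) < \<epsilon>) \<and>
     (\<forall>f. continuous_on (space \<mu>) f \<longrightarrow>
        (\<forall>\<epsilon>>0. \<exists>v\<in>F. continuous_on (space \<mu>) v \<and> (\<forall>x\<in>space \<mu>. \<bar>f x - v x\<bar> < \<epsilon>)))"

definition energy ::
  "(('a \<Rightarrow> real) \<Rightarrow> ('a \<Rightarrow> real) \<Rightarrow> real) \<Rightarrow> ('a \<Rightarrow> real) set \<Rightarrow> ('a \<Rightarrow> real) \<Rightarrow> ennreal" where
  "energy \<E> F u = (if u \<in> F then ennreal (\<E> u u) else \<infinity>)"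

text \<open>
  The test functions are the continuous elements of the domain; in \<open>ennreal\<close>,
  \<open>1 / 0 = \<infinity>\<close> and \<open>1 / \<infinity> = 0\<close>.
\<close>

definition effective_resistance ::
  "'a::topological_space measure \<Rightarrow> (('a \<Rightarrow> real) \<Rightarrow> ('a \<Rightarrow> real) \<Rightarrow> real) \<Rightarrow> ('a \<Rightarrow> real) set \<Rightarrow>
    'a \<Rightarrow> 'a \<Rightarrow> ennreal" where
  "effective_resistance \<mu> \<E> F x y =
     1 / (INF u\<in>{u \<in> F. continuous_on (space \<mu>) u \<and> u x = 0 \<and> u y = 1}. energy \<E> F u)"

text \<open>
  The identity is an identity in \<open>[0, \<infinity>]\<close> and is required on the domain and also for all
  continuous functions.  On a continuous function outside the domain both sides have to be
  infinite, so the second requirement says that a continuous \<open>u\<close> with \<open>u \<circ> ifs i \<in> F\<close> for all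
  \<open>i < 4\<close> lies in \<open>F\<close>: this is the domain part
  \<open>F \<inter> C(K) = {u \<in> C(K). \<forall>i. u \<circ> F\<^sub>i \<in> F}\<close> of the usual notion of a self-similar Dirichlet
  form.  It cannot be dropped.  Without it, forcing \<open>u\<close> to be locally constant on images of a
  fat Cantor set in the side branches of the tree gives a proper regular Dirichlet subspace with
  the same resistances for which the identity on the domain still holds.
\<close>

definition self_similar_form ::
  "(nat \<Rightarrow> real) \<Rightarrow> (real \<times> real) measure \<Rightarrow>
    ((real \<times> real \<Rightarrow> real) \<Rightarrow> (real \<times> real \<Rightarrow> real) \<Rightarrow> real) \<Rightarrow> (real \<times> real \<Rightarrow> real) set \<Rightarrow> bool" where
  "self_similar_form s \<mu> \<E> F \<longleftrightarrow>
     (\<forall>u\<in>F. energy \<E> F u = (\<Sum>i<4. ennreal (1 / s i) * energy \<E> F (u \<circ> ifs i))) \<and>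
     (\<forall>u. continuous_on (space \<mu>) u \<longrightarrow>
        energy \<E> F u = (\<Sum>i<4. ennreal (1 / s i) * energy \<E> F (u \<circ> ifs i)))"

end

theory Submission
  imports Defs
begin

text \<open>
  The fractal is a tree in which four copies of the whole are joined: the two upper copies share
  their apex \<open>q1\<close>, and each lower copy hangs with its apex from one lower vertex of the upper copy
  above it.  Hence \<open>q1\<close> is connected to \<open>q2\<close> by an upper and a lower copy in series, and likewise to
  \<open>q3\<close>, and these two arms have only \<open>q1\<close> in common.  As \<open>s 0 + (1 - s 0) = 1\<close>, unit resistances
  from \<open>q1\<close> to \<open>q2\<close> and from \<open>q1\<close> to \<open>q3\<close>, without a direct connection of \<open>q2\<close> and \<open>q3\<close>, are
  reproduced by the subdivision.  So the energies \<open>level_energy n u u\<close> of the corresponding networks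
  on the vertices of level \<open>n\<close> increase with \<open>n\<close> (\<open>level_energy_Suc_mono\<close>), and the form must be
  their supremum.

  Existence.  Let \<open>finite_energy\<close> be the set of the continuous functions for which the supremum is
  finite.  The square root of the resistance between the apex and any other point is bounded by a
  geometric series (\<open>apex_oscillation\<close>), so the form norm controls the supremum norm; this gives completeness
  (\<open>finite_energy_complete\<close>), and it lets a form on almost-everywhere classes be defined through the
  continuous versions, which are unique because the measure charges every cell.  The resistances
  are attained by solutions of a de Rham functional equation (\<open>arm_function_exists\<close>).  Density
  follows from piecewise interpolation (\<open>interpolation\<close>).

  Uniqueness.  Let \<open>\<E>\<close> be any form as in the theorem.  On each cell the resistance condition bounds
  the energy from below by the squared difference along either arm, and the series law turns
  this into \<open>level_energy n u u \<le> \<E> u u\<close> for all continuous \<open>u\<close> in the domain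
  (\<open>level_energy_le_form\<close>).  In the other direction, functions that nearly attain the resistances can
  be glued along the cells, because continuous functions belonging to the domain on every cell
  belong to the domain; so every continuous \<open>f\<close> has approximations that agree with it at level \<open>n\<close>
  and have energy close to \<open>level_energy n f f\<close> (\<open>interpolation\<close>).  For \<open>f\<close> of finite energy they form
  a Cauchy sequence by the parallelogram law (\<open>finite_energy_in_domain\<close>).  Hence the continuous part of
  the domain is \<open>finite_energy\<close> and the form is determined there; regularity and completeness do the rest
  (\<open>tree_form_unique\<close>).
\<close>

section \<open>Geometry of the fractal\<close>

lemma sum_lessThan_4: "(\<Sum>i<(4::nat). f i) = f 0 + f 1 + f 2 + f 3"
  for f :: "nat \<Rightarrow> 'a::comm_monoid_add"
  by (simp add: eval_nat_numeral add.assoc)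

lemma less_4_cases: "i < 4 \<Longrightarrow> i = 0 \<or> i = 1 \<or> i = 2 \<or> i = (3::nat)"
  by auto

text \<open>
  Measuring the distance below the apex in units of the height of the triangle removes the
  square roots from the four maps, so that all incidence questions become linear arithmetic
  with rational coefficients.
\<close>

definition depth :: "real \<times> real \<Rightarrow> real" where
  "depth p = - (2 / sqrt 3) * snd p"

lemma depth_ifs: "depth (ifs i p) = (if i < 2 then 2/3 * depth p else depth p / 3 + 2/3)"
  by (cases p) (auto simp: depth_def ifs_def field_simps)

lemma fst_ifs:
  "fst (ifs i p) = (if i = 0 then 2/9 * fst p - 4/9 * depth p
     else if i = 1 then 2/9 * fst p + 4/9 * depth p
     else if i = 2 then fst p / 3 - 2/3 else fst p / 3 + 2/3)"
  by (cases p) (auto simp: depth_def ifs_def field_simps)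

lemma eq_iff_fst_depth: "p = p' \<longleftrightarrow> fst p = fst p' \<and> depth p = depth p'"
  by (auto simp: depth_def prod_eq_iff)

lemma fst_depth_vertices [simp]:
  "fst q1 = 0" "depth q1 = 0" "fst q2 = -1" "depth q2 = 1" "fst q3 = 1" "depth q3 = 1"
  by (auto simp: depth_def q1_def q2_def q3_def)

lemma ifs_junction: "ifs 2 q1 = ifs 0 q2" "ifs 3 q1 = ifs (Suc 0) q3"
  by (auto simp: eq_iff_fst_depth depth_ifs fst_ifs)

lemma is_attractor_fractal: "is_attractor fractal"
  unfolding fractal_def by (rule theI'[OF ex1_attractor])

lemma compact_fractal: "compact fractal"
  and fractal_nonempty: "fractal \<noteq> {}"
  and fractal_eq: "fractal = (\<Union>i<4. ifs i ` fractal)"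
  using is_attractor_fractal unfolding is_attractor_def by auto

lemma ifs_in_fractal: "i < 4 \<Longrightarrow> p \<in> fractal \<Longrightarrow> ifs i p \<in> fractal"
  using fractal_eq by blast

lemma fractal_cases:
  assumes "x \<in> fractal"
  obtains i y where "i < 4" "y \<in> fractal" "x = ifs i y"
  using assms fractal_eq by blast

text \<open>
  The map would otherwise move the point of the fractal nearest to the fixed point closer to it.
\<close>

lemma ifs_fixed_point_in_fractal:
  assumes "i < 4" "ifs i q = q"
  shows "q \<in> fractal"
proof -
  have cl: "closed fractal" using compact_fractal by (rule compact_imp_closed)
  obtain l where l: "l \<in> fractal" "infdist q fractal = dist q l"
    using infdist_attains_inf[OF cl fractal_nonempty] by blast
  have "infdist q fractal \<le> dist q (ifs i l)"
    using l(1) assms(1) by (intro infdist_le ifs_in_fractal)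
  also have "\<dots> \<le> 19/20 * dist q l" using ifs_contraction[of i q l] assms(2) by simp
  finally have "infdist q fractal = 0" using l(2) by (simp add: infdist_nonneg)
  then show ?thesis using in_closed_iff_infdist_zero[OF cl fractal_nonempty] by simp
qed

lemma vertices_in_fractal [simp]: "q1 \<in> fractal" "q2 \<in> fractal" "q3 \<in> fractal"
  by (rule ifs_fixed_point_in_fractal[OF _ ifs_fixed(1)], simp)
     (rule ifs_fixed_point_in_fractal[OF _ ifs_fixed(3)], simp,
      rule ifs_fixed_point_in_fractal[OF _ ifs_fixed(4)], simp)

text \<open>
  The contractions send the triangle with corners \<open>q1, q2, q3\<close> into itself, so a point of the
  fractal at maximal distance from the triangle, being the image of another point of the fractal,
  has at most \<open>19/20\<close> of that distance.  Hence the distance is \<open>0\<close>.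
\<close>

lemma fractal_in_triangle:
  assumes "p \<in> fractal"
  shows "\<bar>fst p\<bar> \<le> depth p" "depth p \<le> 1"
proof -
  define T where "T = {p. \<bar>fst p\<bar> \<le> depth p \<and> depth p \<le> 1}"
  have "continuous_on UNIV depth" unfolding depth_def by (intro continuous_intros)
  then have clT: "closed T" unfolding T_def
    by (intro closed_Collect_conj closed_Collect_le continuous_intros) 
  have q1T: "q1 \<in> T" by (simp add: T_def)
  have T: "ifs i p \<in> T" if "p \<in> T" for i p
    using that unfolding T_def by (auto simp: depth_ifs fst_ifs split: if_splits)
  obtain x where x: "x \<in> fractal" "\<And>z. z \<in> fractal \<Longrightarrow> infdist z T \<le> infdist x T"
    using continuous_attains_sup[OF compact_fractal fractal_nonempty
        continuous_on_infdist[OF continuous_on_id, of fractal T]] by auto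
  obtain i y where iy: "i < 4" "y \<in> fractal" "x = ifs i y" using x(1) by (rule fractal_cases)
  obtain l where l: "l \<in> T" "infdist y T = dist y l"
    using infdist_attains_inf[OF clT] q1T by blast
  have "infdist x T \<le> dist x (ifs i l)" using T[OF l(1)] by (rule infdist_le)
  also have "\<dots> \<le> 19/20 * infdist y T" using ifs_contraction iy l by simp
  also have "\<dots> \<le> 19/20 * infdist x T" using x(2) iy by simp
  finally have "infdist x T \<le> 0" by simp
  then have "infdist p T = 0" using x(2)[OF assms] infdist_nonneg[of p T] by linarith
  then have "p \<in> T" using in_closed_iff_infdist_zero[OF clT] q1T by blast
  then show "\<bar>fst p\<bar> \<le> depth p" "depth p \<le> 1" by (auto simp: T_def)
qed

text \<open>
  Cells touch only at apexes and lower vertices, without forming a cycle.  Therefore a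
  continuous function can be prescribed on the four cells independently, subject to just three
  matching conditions.
\<close>

lemma cells_overlap:
  assumes "i < j" "j < 4" "p \<in> fractal" "p' \<in> fractal" "ifs i p = ifs j p'"
  shows "(i = 0 \<and> j = 1 \<and> p = q1 \<and> p' = q1) \<or> (i = 0 \<and> j = 2 \<and> p = q2 \<and> p' = q1) \<or>
         (i = 1 \<and> j = 3 \<and> p = q3 \<and> p' = q1)"
proof -
  note T = fractal_in_triangle[OF assms(3)] fractal_in_triangle[OF assms(4)]
  have eq: "fst (ifs i p) = fst (ifs j p')" "depth (ifs i p) = depth (ifs j p')"
    using assms(5) by simp_all
  have "(i = 0 \<and> j = 1) \<or> (i = 0 \<and> j = 2) \<or> (i = 1 \<and> j = 3) \<or>
        (i = 0 \<and> j = 3) \<or> (i = 1 \<and> j = 2) \<or> (i = 2 \<and> j = 3)"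
    using assms(1,2) by arith
  then show ?thesis
    using T eq unfolding eq_iff_fst_depth
    by (elim disjE conjE; simp add: depth_ifs fst_ifs; linarith)
qed

definition glue :: "(nat \<Rightarrow> real \<times> real \<Rightarrow> real) \<Rightarrow> real \<times> real \<Rightarrow> real" where
  "glue g x = (THE y. \<exists>i<4. \<exists>p\<in>fractal. x = ifs i p \<and> y = g i p)"

definition compatible :: "(nat \<Rightarrow> real \<times> real \<Rightarrow> real) \<Rightarrow> bool" where
  "compatible g \<longleftrightarrow> g 0 q1 = g 1 q1 \<and> g 0 q2 = g 2 q1 \<and> g 1 q3 = g 3 q1"

lemma glue_ifs:
  assumes "compatible g" "i < 4" "p \<in> fractal"
  shows "glue g (ifs i p) = g i p"
  unfolding glue_def
proof (rule the_equality)
  show "\<exists>j<4. \<exists>p'\<in>fractal. ifs i p = ifs j p' \<and> g i p = g j p'" using assms by blast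
next
  fix y assume "\<exists>j<4. \<exists>p'\<in>fractal. ifs i p = ifs j p' \<and> y = g j p'"
  then obtain j p' where j: "j < 4" "p' \<in> fractal" "ifs i p = ifs j p'" "y = g j p'" by blast
  consider "i = j" | "i < j" | "j < i" by linarith
  then show "y = g i p"
  proof cases
    case 1
    then show ?thesis using j inj_ifs by (auto dest: injD)
  next
    case 2
    from cells_overlap[OF 2 j(1) assms(3) j(2) j(3)] show ?thesis
      using assms(1) j(4) by (auto simp: compatible_def)
  next
    case 3
    from cells_overlap[OF 3 assms(2) j(2) assms(3) j(3)[symmetric]] show ?thesis
      using assms(1) j(4) by (auto simp: compatible_def)
  qed
qed

lemma continuous_on_glue:
  assumes "compatible g" "\<And>i. i < 4 \<Longrightarrow> continuous_on fractal (g i)"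
  shows "continuous_on fractal (glue g)"
proof -
  have "continuous_on (\<Union>i<4. ifs i ` fractal) (glue g)"
  proof (rule continuous_on_closed_Union)
    fix i :: nat assume "i \<in> {..<4}"
    then have i: "i < 4" by simp
    show "closed (ifs i ` fractal)"
      by (intro compact_imp_closed compact_continuous_image continuous_on_ifs compact_fractal)
    have "continuous_on (ifs i ` fractal) (inv (ifs i))"
      by (intro continuous_on_inv continuous_on_ifs compact_fractal) (simp add: inj_ifs)
    then have "continuous_on (ifs i ` fractal) (\<lambda>x. g i (inv (ifs i) x))"
      by (rule continuous_on_compose2[OF assms(2)[OF i]]) (auto simp: inj_ifs)
    then show "continuous_on (ifs i ` fractal) (glue g)"
      by (rule continuous_on_eq) (auto simp: glue_ifs[OF assms(1) i] inj_ifs)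
  qed simp
  then show ?thesis using fractal_eq by simp
qed

lemma glue_vertices:
  assumes "compatible g"
  shows "glue g q1 = g 0 q1" "glue g q2 = g 2 q2" "glue g q3 = g 3 q3"
  using glue_ifs[OF assms, of 0 q1] glue_ifs[OF assms, of 2 q2] glue_ifs[OF assms, of 3 q3]
  by (simp_all add: ifs_fixed)

lemma continuous_on_comp_ifs:
  assumes "continuous_on fractal u" "i < 4"
  shows "continuous_on fractal (u \<circ> ifs i)"
  using assms by (intro continuous_on_compose continuous_on_ifs)
    (auto intro: continuous_on_subset ifs_in_fractal)

section \<open>Discrete energies on the graph approximations\<close>

text \<open>
  Everything at level \<open>n\<close> is defined by recursion through the compositions with the four maps.  This
  avoids words over the index set, and inductions on \<open>n\<close> then follow the self-similarity.
\<close>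

primrec vertices :: "nat \<Rightarrow> (real \<times> real) set" where
  "vertices 0 = {q1, q2, q3}"
| "vertices (Suc n) = (\<Union>i<4. ifs i ` vertices n)"

lemma vertices_subset_fractal: "vertices n \<subseteq> fractal"
proof (induction n)
  case (Suc n)
  then show ?case by (simp only: vertices.simps) (blast intro: ifs_in_fractal)
qed simp

lemma ifs_in_vertices_Suc: "i < 4 \<Longrightarrow> x \<in> vertices n \<Longrightarrow> ifs i x \<in> vertices (Suc n)"
  by (simp only: vertices.simps) blast

lemma vertices_mono: "m \<le> n \<Longrightarrow> vertices m \<subseteq> vertices n"
proof (rule lift_Suc_mono_le[of vertices])
  show "vertices n \<subseteq> vertices (Suc n)" for n
  proof (induction n)
    case 0
    have "ifs 0 q1 \<in> vertices (Suc 0)" "ifs 2 q2 \<in> vertices (Suc 0)" "ifs 3 q3 \<in> vertices (Suc 0)"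
      by (rule ifs_in_vertices_Suc; simp)+
    then show ?case by (simp only: ifs_fixed vertices.simps(1) insert_subset empty_subsetI simp_thms)
  next
    case (Suc n)
    then show ?case
      unfolding vertices.simps(2)[of "Suc n"] by (subst vertices.simps(2)) (intro UN_mono image_mono; simp)
  qed
qed

lemma corners_in_vertices: "q1 \<in> vertices n" "q2 \<in> vertices n" "q3 \<in> vertices n"
  using vertices_mono[of 0 n] by auto

primrec cell_osc_le :: "nat \<Rightarrow> real \<Rightarrow> (real \<times> real \<Rightarrow> real) \<Rightarrow> bool" where
  "cell_osc_le 0 \<delta> f \<longleftrightarrow> (\<forall>x\<in>fractal. \<forall>y\<in>fractal. \<bar>f x - f y\<bar> \<le> \<delta>)"
| "cell_osc_le (Suc n) \<delta> f \<longleftrightarrow> (\<forall>i<4. cell_osc_le n \<delta> (\<lambda>x. f (ifs i x)))"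

lemma cell_osc_le_of_modulus:
  assumes "\<And>x y. x \<in> fractal \<Longrightarrow> y \<in> fractal \<Longrightarrow> dist x y \<le> (19/20)^n * diameter fractal \<Longrightarrow>
             \<bar>f x - f y\<bar> \<le> \<delta>"
  shows "cell_osc_le n \<delta> f"
  using assms
proof (induction n arbitrary: f)
  case 0
  then show ?case
    using diameter_bounded_bound[OF compact_imp_bounded[OF compact_fractal]] by simp
next
  case (Suc n)
  have "cell_osc_le n \<delta> (\<lambda>x. f (ifs i x))" if i: "i < 4" for i
  proof (rule Suc.IH)
    fix x y assume xy: "x \<in> fractal" "y \<in> fractal" "dist x y \<le> (19/20)^n * diameter fractal"
    have "dist (ifs i x) (ifs i y) \<le> (19/20)^Suc n * diameter fractal"
      using ifs_contraction[of i x y] xy(3) by simp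
    then show "\<bar>f (ifs i x) - f (ifs i y)\<bar> \<le> \<delta>"
      using xy i by (intro Suc.prems ifs_in_fractal)
  qed
  then show ?case by simp
qed

lemma eventually_cell_osc_le:
  assumes "continuous_on fractal f" "0 < \<delta>"
  shows "\<forall>\<^sub>F n in sequentially. cell_osc_le n \<delta> f"
proof -
  have "uniformly_continuous_on fractal f"
    using assms(1) compact_fractal by (rule compact_uniformly_continuous)
  then obtain d where d: "d > 0"
    "\<And>x y. x \<in> fractal \<Longrightarrow> y \<in> fractal \<Longrightarrow> dist x y < d \<Longrightarrow> dist (f x) (f y) < \<delta>"
    using assms(2) unfolding uniformly_continuous_on_def by (metis dist_commute)
  have "(\<lambda>n. (19/20)^n * diameter fractal) \<longlonglongrightarrow> 0"
    by (intro tendsto_mult_left_zero LIMSEQ_power_zero) simp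
  then have "\<forall>\<^sub>F n in sequentially. (19/20)^n * diameter fractal < d"
    using d(1) by (rule order_tendstoD)
  then show ?thesis
  proof (rule eventually_mono)
    fix n assume n: "(19/20)^n * diameter fractal < d"
    show "cell_osc_le n \<delta> f"
    proof (rule cell_osc_le_of_modulus)
      fix x y assume "x \<in> fractal" "y \<in> fractal" "dist x y \<le> (19/20)^n * diameter fractal"
      then show "\<bar>f x - f y\<bar> \<le> \<delta>" using d(2)[of x y] n by (simp add: dist_real_def)
    qed
  qed
qed

text \<open>
  The energy dissipated in two resistors \<open>t\<close> and \<open>1 - t\<close> in series is at least that in the unit
  resistor that they form; the excess comes from the deviation of the middle voltage from the one
  that divides the total drop in the ratio \<open>t : (1 - t)\<close>.
\<close>

lemma series_law_le:
  fixes x y t :: real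
  assumes "0 < t" "t < 1"
  shows "(x + y)\<^sup>2 \<le> 1/t * x\<^sup>2 + 1/(1-t) * y\<^sup>2"
proof -
  have "1/t * x\<^sup>2 + 1/(1-t) * y\<^sup>2 - (x + y)\<^sup>2 = ((1-t) * x - t * y)\<^sup>2 / (t * (1-t))"
    using assms by (simp add: field_simps power2_eq_square) 
  also have "\<dots> \<ge> 0" using assms by simp
  finally show ?thesis by simp
qed

locale resistance_ratios =
  fixes s :: "nat \<Rightarrow> real"
  assumes s_0_pos: "0 < s 0" and s_0_less_1: "s 0 < 1"
    and s_1: "s 1 = s 0" and s_2: "s 2 = 1 - s 0" and s_3: "s 3 = 1 - s 0"
begin

lemma s_Suc_0 [simp]: "s (Suc 0) = s 0"
  using s_1 by simp

lemma s_pos: "i < 4 \<Longrightarrow> 0 < s i" and s_less_1: "i < 4 \<Longrightarrow> s i < 1"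
  using s_0_pos s_0_less_1 s_2 s_3 by (auto dest!: less_4_cases)

text \<open>
  Each cell of level \<open>n\<close> carries two resistors, joining its apex to its two lower vertices, whose value
  is the product of the ratios on the way down to the cell.  The two lower vertices are not connected
  directly.
\<close>

primrec level_energy ::
  "nat \<Rightarrow> (real \<times> real \<Rightarrow> real) \<Rightarrow> (real \<times> real \<Rightarrow> real) \<Rightarrow> real" where
  "level_energy 0 u v = (u q1 - u q2) * (v q1 - v q2) + (u q1 - u q3) * (v q1 - v q3)"
| "level_energy (Suc n) u v =
     (\<Sum>i<4. 1 / s i * level_energy n (\<lambda>x. u (ifs i x)) (\<lambda>x. v (ifs i x)))"

lemma level_energy_cong:
  assumes "\<And>x. x \<in> vertices n \<Longrightarrow> u x = u' x" "\<And>x. x \<in> vertices n \<Longrightarrow> v x = v' x"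
  shows "level_energy n u v = level_energy n u' v'"
  using assms
proof (induction n arbitrary: u u' v v')
  case (Suc n)
  have "level_energy n (\<lambda>x. u (ifs i x)) (\<lambda>x. v (ifs i x)) =
        level_energy n (\<lambda>x. u' (ifs i x)) (\<lambda>x. v' (ifs i x))" if "i < 4" for i
    using that Suc.prems ifs_in_vertices_Suc by (intro Suc.IH) blast+
  then show ?case by simp
qed simp

lemma level_energy_cong_fractal:
  assumes "\<And>x. x \<in> fractal \<Longrightarrow> u x = u' x" "\<And>x. x \<in> fractal \<Longrightarrow> v x = v' x"
  shows "level_energy n u v = level_energy n u' v'"
  using assms vertices_subset_fractal by (intro level_energy_cong) blast+

lemma level_energy_commute: "level_energy n u v = level_energy n v u"
proof (induction n arbitrary: u v)
  case (Suc n)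
  show ?case unfolding level_energy.simps
    by (intro sum.cong refl arg_cong2[where f = "(*)"] Suc)
qed (simp add: mult.commute)

lemma level_energy_add_left:
  "level_energy n (\<lambda>x. u x + v x) f = level_energy n u f + level_energy n v f"
  by (induction n arbitrary: u v f)
     (simp_all add: algebra_simps sum.distrib)

lemma level_energy_scale_left: "level_energy n (\<lambda>x. c * u x) f = c * level_energy n u f"
  by (induction n arbitrary: u f) (simp_all add: algebra_simps sum_distrib_left)

lemma level_energy_const_left [simp]: "level_energy n (\<lambda>x. c) f = 0"
  by (induction n arbitrary: f) simp_all

lemma level_energy_nonneg: "0 \<le> level_energy n u u"
proof (induction n arbitrary: u)
  case (Suc n)
  show ?case unfolding level_energy.simps
    by (intro sum_nonneg mult_nonneg_nonneg Suc) (use s_pos in \<open>auto intro: less_imp_le\<close>)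
qed simp

lemma level_energy_add_right:
  "level_energy n f (\<lambda>x. u x + v x) = level_energy n f u + level_energy n f v"
  unfolding level_energy_commute[of n f] by (rule level_energy_add_left)

lemma level_energy_scale_right: "level_energy n f (\<lambda>x. c * u x) = c * level_energy n f u"
  unfolding level_energy_commute[of n f] by (rule level_energy_scale_left)

lemma level_energy_const_right [simp]: "level_energy n f (\<lambda>x. c) = 0"
  unfolding level_energy_commute[of n f] by (rule level_energy_const_left)

lemma level_energy_affine:
  "level_energy n (\<lambda>x. a + b * u x) (\<lambda>x. a + b * u x) = b\<^sup>2 * level_energy n u u"
  by (simp add: level_energy_add_left level_energy_add_right level_energy_scale_left
      level_energy_scale_right power2_eq_square)

lemma level_energy_parallelogram:
  "level_energy n (\<lambda>x. u x + v x) (\<lambda>x. u x + v x) + level_energy n (\<lambda>x. u x - v x) (\<lambda>x. u x - v x)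
     = 2 * level_energy n u u + 2 * level_energy n v v"
  using level_energy_scale_left[of n "-1" v] level_energy_scale_right[of n _ "-1" v]
    level_energy_add_left[of n u "\<lambda>x. - v x"] level_energy_add_right[of n _ u "\<lambda>x. - v x"]
  by (simp add: level_energy_add_left level_energy_add_right)

text \<open>
  Passing to the next level replaces the resistor from the apex to a lower vertex by two resistors
  in series whose resistances add up to the same value, and adds dangling resistors.
\<close>

lemma level_energy_Suc_mono: "level_energy n u u \<le> level_energy (Suc n) u u"
proof (induction n arbitrary: u)
  case 0
  let ?a = "u q1" and ?b = "u q2" and ?c = "u q3" and ?m = "u (ifs 0 q2)" and ?m' = "u (ifs 1 q3)"
  have "(?a - ?b)\<^sup>2 \<le> 1 / s 0 * (?a - ?m)\<^sup>2 + 1 / s 2 * (?m - ?b)\<^sup>2"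
    using series_law_le[OF s_0_pos s_0_less_1, of "?a - ?m" "?m - ?b"] s_2 by simp
  moreover have "(?a - ?c)\<^sup>2 \<le> 1 / s 0 * (?a - ?m')\<^sup>2 + 1 / s 3 * (?m' - ?c)\<^sup>2"
    using series_law_le[OF s_0_pos s_0_less_1, of "?a - ?m'" "?m' - ?c"] s_3 by simp
  moreover have "0 \<le> 1 / s i * (u (ifs i q1) - u (ifs i q))\<^sup>2" if "i < 4" for i q
    using s_pos[OF that] by simp
  note this[of 0 q3] this[of 1 q2] this[of 2 q3] this[of 3 q2]
  ultimately show ?case
    using ifs_fixed ifs_junction
    by (simp add: sum_lessThan_4 power2_eq_square[symmetric] distrib_left)
next
  case (Suc n)
  show ?case
    unfolding level_energy.simps(2)[of "Suc n"] level_energy.simps(2)[of n]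
    by (intro sum_mono mult_left_mono Suc[unfolded level_energy.simps(2)])
       (use s_pos in \<open>auto intro: less_imp_le\<close>)
qed

lemma level_energy_comp_ifs_le:
  assumes "i < 4" "level_energy (Suc n) u u \<le> M"
  shows "level_energy n (\<lambda>x. u (ifs i x)) (\<lambda>x. u (ifs i x)) \<le> s i * M"
proof -
  have nn: "0 \<le> 1 / s j * level_energy n (\<lambda>x. u (ifs j x)) (\<lambda>x. u (ifs j x))" if "j < 4" for j
    using s_pos[OF that] level_energy_nonneg by simp
  have "1 / s i * level_energy n (\<lambda>x. u (ifs i x)) (\<lambda>x. u (ifs i x)) \<le> level_energy (Suc n) u u"
    unfolding level_energy.simps using nn assms(1) by (intro member_le_sum[of i "{..<4}"]) auto
  then have "1 / s i * level_energy n (\<lambda>x. u (ifs i x)) (\<lambda>x. u (ifs i x)) \<le> M"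
    using assms(2) by (rule order_trans)
  then show ?thesis using s_pos[OF assms(1)] by (simp add: field_simps)
qed

lemma level_energy_mono: "m \<le> n \<Longrightarrow> level_energy m u u \<le> level_energy n u u"
  by (rule lift_Suc_mono_le[of "\<lambda>n. level_energy n u u"]) (rule level_energy_Suc_mono)

text \<open>This is the source of the Markov property.\<close>

lemma level_energy_contraction:
  assumes "\<And>x y. x \<in> fractal \<Longrightarrow> y \<in> fractal \<Longrightarrow> \<bar>v x - v y\<bar> \<le> \<bar>u x - u y\<bar>"
  shows "level_energy n v v \<le> level_energy n u u"
  using assms
proof (induction n arbitrary: u v)
  case 0
  have "(v q1 - v q2)\<^sup>2 \<le> (u q1 - u q2)\<^sup>2" "(v q1 - v q3)\<^sup>2 \<le> (u q1 - u q3)\<^sup>2"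
    by (simp_all only: abs_le_square_iff[symmetric]) (simp_all add: 0)
  then show ?case by (simp add: power2_eq_square)
next
  case (Suc n)
  show ?case unfolding level_energy.simps
  proof (intro sum_mono mult_left_mono Suc.IH)
    fix i :: nat and x y :: "real \<times> real"
    assume "i \<in> {..<4}" "x \<in> fractal" "y \<in> fractal"
    then show "\<bar>v (ifs i x) - v (ifs i y)\<bar> \<le> \<bar>u (ifs i x) - u (ifs i y)\<bar>"
      by (intro Suc.prems ifs_in_fractal) auto
  qed (use s_pos in \<open>auto intro: less_imp_le\<close>)
qed

text \<open>
  Each discrete energy depends on finitely many values only; this makes their supremum lower
  semicontinuous.
\<close>

lemma tendsto_level_energy:
  assumes "\<And>x. x \<in> fractal \<Longrightarrow> (\<lambda>k. u k x) \<longlonglongrightarrow> u' x" "\<And>x. x \<in> fractal \<Longrightarrow> (\<lambda>k. v k x) \<longlonglongrightarrow> v' x"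
  shows "(\<lambda>k. level_energy n (u k) (v k)) \<longlonglongrightarrow> level_energy n u' v'"
  using assms
proof (induction n arbitrary: u u' v v')
  case 0
  then show ?case unfolding level_energy.simps by (intro tendsto_intros) auto
next
  case (Suc n)
  show ?case unfolding level_energy.simps
    by (intro tendsto_intros Suc.IH Suc.prems ifs_in_fractal) auto
qed

section \<open>Continuous functions of finite energy\<close>

definition finite_energy :: "(real \<times> real \<Rightarrow> real) set" where
  "finite_energy = {u. continuous_on fractal u \<and> bdd_above (range (\<lambda>n. level_energy n u u))}"

definition limit_energy :: "(real \<times> real \<Rightarrow> real) \<Rightarrow> (real \<times> real \<Rightarrow> real) \<Rightarrow> real" where
  "limit_energy u v = lim (\<lambda>n. level_energy n u v)"

lemma finite_energyI:
  assumes "continuous_on fractal u" "\<And>n. level_energy n u u \<le> M"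
  shows "u \<in> finite_energy"
  using assms unfolding finite_energy_def by (auto intro!: bdd_aboveI2)

lemma finite_energy_continuous: "u \<in> finite_energy \<Longrightarrow> continuous_on fractal u"
  by (simp add: finite_energy_def)

lemma level_energy_tendsto_limit_diag:
  assumes "u \<in> finite_energy"
  shows "(\<lambda>n. level_energy n u u) \<longlonglongrightarrow> limit_energy u u"
proof -
  have "incseq (\<lambda>n. level_energy n u u)" using level_energy_mono by (auto simp: incseq_def)
  moreover have "bdd_above (range (\<lambda>n. level_energy n u u))"
    using assms by (simp add: finite_energy_def)
  ultimately have "convergent (\<lambda>n. level_energy n u u)"
    using LIMSEQ_incseq_SUP convergentI by blast
  then show ?thesis unfolding limit_energy_def by (rule convergent_LIMSEQ_iff[THEN iffD1])
qed

lemma level_energy_le_limit: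
  assumes "u \<in> finite_energy"
  shows "level_energy n u u \<le> limit_energy u u"
proof (rule incseq_le)
  show "incseq (\<lambda>n. level_energy n u u)" using level_energy_mono by (auto simp: incseq_def)
qed (rule level_energy_tendsto_limit_diag[OF assms])

lemma limit_energy_le:
  assumes "u \<in> finite_energy" "\<And>n. level_energy n u u \<le> M"
  shows "limit_energy u u \<le> M"
  using level_energy_tendsto_limit_diag[OF assms(1)] assms(2) by (intro LIMSEQ_le_const2) auto

lemma finite_energy_add:
  assumes "u \<in> finite_energy" "v \<in> finite_energy"
  shows "(\<lambda>x. u x + v x) \<in> finite_energy"
proof (rule finite_energyI)
  show "continuous_on fractal (\<lambda>x. u x + v x)"
    using assms by (intro continuous_intros finite_energy_continuous)
  show "level_energy n (\<lambda>x. u x + v x) (\<lambda>x. u x + v x)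
          \<le> 2 * limit_energy u u + 2 * limit_energy v v" for n
    using level_energy_parallelogram[of n u v] level_energy_nonneg[of n "\<lambda>x. u x - v x"]
      level_energy_le_limit[OF assms(1), of n] level_energy_le_limit[OF assms(2), of n] by linarith
qed

lemma finite_energy_scale:
  assumes "u \<in> finite_energy"
  shows "(\<lambda>x. c * u x) \<in> finite_energy"
proof (rule finite_energyI)
  show "continuous_on fractal (\<lambda>x. c * u x)"
    using assms by (intro continuous_intros finite_energy_continuous)
  show "level_energy n (\<lambda>x. c * u x) (\<lambda>x. c * u x) \<le> c\<^sup>2 * limit_energy u u" for n
    using level_energy_affine[of n 0 c u] level_energy_le_limit[OF assms, of n]
    by (simp add: mult_left_mono)
qed

lemma finite_energy_const: "(\<lambda>x. c) \<in> finite_energy"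
  by (rule finite_energyI[of _ 0]) auto

lemma finite_energy_diff:
  assumes "u \<in> finite_energy" "v \<in> finite_energy"
  shows "(\<lambda>x. u x - v x) \<in> finite_energy"
  using finite_energy_add[OF assms(1) finite_energy_scale[OF assms(2), of "-1"]] by simp

lemma finite_energy_cong:
  assumes "u \<in> finite_energy" "\<And>x. x \<in> fractal \<Longrightarrow> u x = v x"
  shows "v \<in> finite_energy"
proof (rule finite_energyI)
  show "continuous_on fractal v"
    using finite_energy_continuous[OF assms(1)] assms(2) by (rule continuous_on_eq)
  show "level_energy n v v \<le> limit_energy u u" for n
    using level_energy_cong_fractal[of u v u v n] assms level_energy_le_limit[of u n] by simp
qed

lemma limit_energy_cong:
  assumes "\<And>x. x \<in> fractal \<Longrightarrow> u x = u' x" "\<And>x. x \<in> fractal \<Longrightarrow> v x = v' x"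
  shows "limit_energy u v = limit_energy u' v'"
  unfolding limit_energy_def using level_energy_cong_fractal[of u u' v v'] assms by simp

text \<open>Off the diagonal there is no monotonicity, and convergence follows by polarisation.\<close>

lemma level_energy_tendsto_limit:
  assumes "u \<in> finite_energy" "v \<in> finite_energy"
  shows "(\<lambda>n. level_energy n u v) \<longlonglongrightarrow> limit_energy u v"
proof -
  have eq: "level_energy n u v =
    (level_energy n (\<lambda>x. u x + v x) (\<lambda>x. u x + v x) - level_energy n u u - level_energy n v v) / 2" for n
    by (simp add: level_energy_add_left level_energy_add_right level_energy_commute[of n v u])
  have "(\<lambda>n. level_energy n u v) \<longlonglongrightarrow>
    (limit_energy (\<lambda>x. u x + v x) (\<lambda>x. u x + v x) - limit_energy u u - limit_energy v v) / 2"
    unfolding eq by (intro tendsto_intros level_energy_tendsto_limit_diag finite_energy_add assms) simp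
  then have "convergent (\<lambda>n. level_energy n u v)" by (rule convergentI)
  then show ?thesis unfolding limit_energy_def by (rule convergent_LIMSEQ_iff[THEN iffD1])
qed

lemma limit_energy_commute: "limit_energy u v = limit_energy v u"
  unfolding limit_energy_def by (subst level_energy_commute) simp

lemma limit_energy_add_left:
  assumes "u \<in> finite_energy" "v \<in> finite_energy" "f \<in> finite_energy"
  shows "limit_energy (\<lambda>x. u x + v x) f = limit_energy u f + limit_energy v f"
proof (rule LIMSEQ_unique)
  show "(\<lambda>n. level_energy n (\<lambda>x. u x + v x) f) \<longlonglongrightarrow> limit_energy (\<lambda>x. u x + v x) f"
    by (intro level_energy_tendsto_limit finite_energy_add assms)
  show "(\<lambda>n. level_energy n (\<lambda>x. u x + v x) f) \<longlonglongrightarrow> limit_energy u f + limit_energy v f"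
    unfolding level_energy_add_left by (intro tendsto_add level_energy_tendsto_limit assms)
qed

lemma limit_energy_scale_left:
  assumes "u \<in> finite_energy" "f \<in> finite_energy"
  shows "limit_energy (\<lambda>x. c * u x) f = c * limit_energy u f"
proof (rule LIMSEQ_unique)
  show "(\<lambda>n. level_energy n (\<lambda>x. c * u x) f) \<longlonglongrightarrow> limit_energy (\<lambda>x. c * u x) f"
    by (intro level_energy_tendsto_limit finite_energy_scale assms)
  show "(\<lambda>n. level_energy n (\<lambda>x. c * u x) f) \<longlonglongrightarrow> c * limit_energy u f"
    unfolding level_energy_scale_left by (intro tendsto_intros level_energy_tendsto_limit assms)
qed

lemma limit_energy_nonneg: "u \<in> finite_energy \<Longrightarrow> 0 \<le> limit_energy u u"
  using level_energy_le_limit[of u 0] level_energy_nonneg[of 0 u] by linarith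

lemma limit_energy_contraction:
  assumes "u \<in> finite_energy" "continuous_on fractal v"
    and "\<And>x y. x \<in> fractal \<Longrightarrow> y \<in> fractal \<Longrightarrow> \<bar>v x - v y\<bar> \<le> \<bar>u x - u y\<bar>"
  shows "v \<in> finite_energy" "limit_energy v v \<le> limit_energy u u"
proof -
  have le: "level_energy n v v \<le> limit_energy u u" for n
    using level_energy_contraction[OF assms(3)] level_energy_le_limit[OF assms(1)]
    by (rule order_trans)
  show "v \<in> finite_energy" using assms(2) le by (rule finite_energyI)
  then show "limit_energy v v \<le> limit_energy u u" using le by (rule limit_energy_le)
qed

lemma finite_energy_comp_ifs:
  assumes "u \<in> finite_energy" "i < 4"
  shows "(\<lambda>x. u (ifs i x)) \<in> finite_energy"
proof (rule finite_energyI)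
  show "continuous_on fractal (\<lambda>x. u (ifs i x))"
    using continuous_on_comp_ifs[OF finite_energy_continuous[OF assms(1)] assms(2)]
    by (simp add: comp_def)
  show "level_energy n (\<lambda>x. u (ifs i x)) (\<lambda>x. u (ifs i x)) \<le> s i * limit_energy u u" for n
    using level_energy_le_limit[OF assms(1)] by (rule level_energy_comp_ifs_le[OF assms(2)])
qed

lemma limit_energy_self_similar:
  assumes "u \<in> finite_energy" "v \<in> finite_energy"
  shows "limit_energy u v = (\<Sum>i<4. 1 / s i * limit_energy (\<lambda>x. u (ifs i x)) (\<lambda>x. v (ifs i x)))"
proof (rule LIMSEQ_unique)
  show "(\<lambda>n. level_energy (Suc n) u v) \<longlonglongrightarrow> limit_energy u v"
    using level_energy_tendsto_limit[OF assms] by (rule LIMSEQ_Suc)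
  show "(\<lambda>n. level_energy (Suc n) u v) \<longlonglongrightarrow>
        (\<Sum>i<4. 1 / s i * limit_energy (\<lambda>x. u (ifs i x)) (\<lambda>x. v (ifs i x)))"
    unfolding level_energy.simps
    by (intro tendsto_intros level_energy_tendsto_limit finite_energy_comp_ifs assms) auto
qed

text \<open>
  Because of this converse the identity of self-similarity also holds, with both sides infinite,
  for the continuous functions outside the domain.
\<close>

lemma finite_energy_if_comp_ifs:
  assumes "continuous_on fractal u" "\<And>i. i < 4 \<Longrightarrow> (\<lambda>x. u (ifs i x)) \<in> finite_energy"
  shows "u \<in> finite_energy"
proof (rule finite_energyI[OF assms(1)])
  fix n
  have "level_energy n u u \<le> level_energy (Suc n) u u" by (rule level_energy_Suc_mono)
  also have "\<dots> \<le> (\<Sum>i<4. 1 / s i * limit_energy (\<lambda>x. u (ifs i x)) (\<lambda>x. u (ifs i x)))"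
    unfolding level_energy.simps
    by (intro sum_mono mult_left_mono level_energy_le_limit assms(2))
       (use s_pos in \<open>auto intro: less_imp_le\<close>)
  finally show "level_energy n u u \<le> \<dots>" .
qed

text \<open>
  The geometric series of the square roots of the resistance ratios bounds the square root of the
  resistance between the apex and any other point.
\<close>

definition osc_const :: real where
  "osc_const = 1 / (1 - sqrt (max (s 0) (1 - s 0)))"

lemma osc_const_pos: "0 < osc_const"
  and osc_const_eq: "osc_const * sqrt (max (s 0) (1 - s 0)) + 1 = osc_const"
proof -
  have "sqrt (max (s 0) (1 - s 0)) < 1" using s_0_pos s_0_less_1 by simp
  then have "0 < 1 - sqrt (max (s 0) (1 - s 0))" by linarith
  moreover have "1 / d * a + 1 = 1 / d" if "0 < d" "d = 1 - a" for a d :: real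
    using that by (simp add: field_simps)
  ultimately show "0 < osc_const" "osc_const * sqrt (max (s 0) (1 - s 0)) + 1 = osc_const"
    unfolding osc_const_def by (auto simp only: zero_less_divide_1_iff)
qed

text \<open>
  Descending \<open>n\<close> levels costs the first \<open>n\<close> terms of the series; what remains is the oscillation in a
  cell of level \<open>n\<close>, which will be made to vanish by continuity.
\<close>

lemma apex_oscillation_aux:
  assumes "\<And>k. level_energy k u u \<le> M" "cell_osc_le n \<delta> u" "x \<in> fractal"
  shows "\<bar>u x - u q1\<bar> \<le> osc_const * sqrt M + \<delta>"
  using assms
proof (induction n arbitrary: u x M)
  case 0
  have "0 \<le> M" using level_energy_nonneg 0(1) by (rule order_trans)
  then have "0 \<le> osc_const * sqrt M" using osc_const_pos by simp
  moreover have "\<bar>u x - u q1\<bar> \<le> \<delta>" using 0(2,3) by simp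
  ultimately show ?case by linarith
next
  case (Suc n)
  let ?r = "max (s 0) (1 - s 0)"
  have M: "0 \<le> M" using level_energy_nonneg Suc.prems(1) by (rule order_trans)
  obtain i y where iy: "i < 4" "y \<in> fractal" "x = ifs i y" using Suc.prems(3) by (rule fractal_cases)
  have s_le: "s i \<le> ?r" using iy(1) s_2 s_3 by (auto dest!: less_4_cases)
  have cell: "level_energy k (\<lambda>x. u (ifs j x)) (\<lambda>x. u (ifs j x)) \<le> s j * M" if "j < 4" for j k
    using that Suc.prems(1) by (rule level_energy_comp_ifs_le)
  have "level_energy k (\<lambda>x. u (ifs i x)) (\<lambda>x. u (ifs i x)) \<le> ?r * M" for k
    using cell[OF iy(1), of k] mult_right_mono[OF s_le M] by linarith
  moreover have "cell_osc_le n \<delta> (\<lambda>x. u (ifs i x))" using Suc.prems(2) iy(1) by simp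
  ultimately have "\<bar>u (ifs i y) - u (ifs i q1)\<bar> \<le> osc_const * sqrt (?r * M) + \<delta>"
    using iy(2) by (intro Suc.IH)
  \<comment> \<open>The apex of a lower cell is the lower vertex of an upper cell, whose resistance is \<open>s 0 \<le> 1\<close>.\<close>
  moreover have "\<bar>u (ifs i q1) - u q1\<bar> \<le> sqrt M"
  proof -
    have M': "s 0 * M \<le> M" using M s_0_less_1 by (simp add: mult_left_le_one_le s_0_pos less_imp_le)
    have "(u (ifs 0 q1) - u (ifs 0 q2))\<^sup>2 \<le> M"
      using cell[of 0 0] M' by (simp add: power2_eq_square) (smt (verit) zero_le_square)
    moreover have "(u (ifs 1 q1) - u (ifs 1 q3))\<^sup>2 \<le> M"
      using cell[of 1 0] M' by (simp add: power2_eq_square) (smt (verit) zero_le_square)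
    ultimately have "(u (ifs i q1) - u q1)\<^sup>2 \<le> M"
      using less_4_cases[OF iy(1)] M ifs_fixed(1,2) ifs_junction
      by (auto simp: power2_commute)
    then show ?thesis using real_sqrt_le_mono real_sqrt_abs by metis
  qed
  ultimately have "\<bar>u x - u q1\<bar> \<le> osc_const * (sqrt ?r * sqrt M) + \<delta> + sqrt M"
    using iy(3) by (simp add: real_sqrt_mult)
  also have "\<dots> = (osc_const * sqrt ?r + 1) * sqrt M + \<delta>" by (simp add: algebra_simps)
  finally show ?case by (simp only: osc_const_eq)
qed

lemma apex_oscillation:
  assumes "u \<in> finite_energy" "x \<in> fractal"
  shows "\<bar>u x - u q1\<bar> \<le> osc_const * sqrt (limit_energy u u)"
proof (rule field_le_epsilon)
  fix \<delta> :: real assume "0 < \<delta>"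
  then obtain n where "cell_osc_le n \<delta> u"
    using eventually_cell_osc_le[OF finite_energy_continuous[OF assms(1)]]
    by (auto simp: eventually_sequentially)
  then show "\<bar>u x - u q1\<bar> \<le> osc_const * sqrt (limit_energy u u) + \<delta>"
    using level_energy_le_limit[OF assms(1)] assms(2) by (intro apex_oscillation_aux)
qed

section \<open>The functions measuring the progress along an arm\<close>

text \<open>
  Arm \<open>k\<close> runs through the upper cell \<open>k\<close> and then the lower cell \<open>k + 2\<close>.
\<close>

definition arm_tip :: "nat \<Rightarrow> real \<times> real" where
  "arm_tip k = (if k = 0 then q2 else q3)"

definition arm_op :: "nat \<Rightarrow> (real \<times> real \<Rightarrow> real) \<Rightarrow> real \<times> real \<Rightarrow> real" where
  "arm_op k u = glue (\<lambda>i x. if i = k then s 0 * u x else if i = k + 2 then s 0 + (1 - s 0) * u x else 0)"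

lemma arm_op:
  assumes "k < 2" "continuous_on fractal u" "u q1 = 0" "u (arm_tip k) = 1"
  shows "continuous_on fractal (arm_op k u)" "arm_op k u q1 = 0" "arm_op k u (arm_tip k) = 1"
    and "\<And>i x. i < 4 \<Longrightarrow> x \<in> fractal \<Longrightarrow> arm_op k u (ifs i x) =
           (if i = k then s 0 * u x else if i = k + 2 then s 0 + (1 - s 0) * u x else 0)"
proof -
  let ?g = "\<lambda>i x. if i = k then s 0 * u x else if i = k + 2 then s 0 + (1 - s 0) * u x else 0"
  have k: "k = 0 \<or> k = 1" using assms(1) by auto
  have c: "compatible ?g" using assms(3,4) k by (auto simp: compatible_def arm_tip_def)
  show "continuous_on fractal (arm_op k u)" unfolding arm_op_def
  proof (rule continuous_on_glue[OF c])
    show "continuous_on fractal (?g i)" for i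
      by (cases "i = k"; cases "i = k + 2") (auto intro!: continuous_intros assms(2))
  qed
  show "arm_op k u q1 = 0" "arm_op k u (arm_tip k) = 1"
    using k glue_vertices[OF c] assms(3,4) by (auto simp: arm_op_def arm_tip_def)
  show "arm_op k u (ifs i x) = ?g i x" if "i < 4" "x \<in> fractal" for i x
    unfolding arm_op_def by (rule glue_ifs[OF c that])
qed

text \<open>
  Along the arm from the apex to a lower vertex \<open>q\<close> the resistance is the unique continuous
  solution of a de Rham functional equation; on the branches off the arm it is constant.  The
  equation scales the solution by \<open>s 0\<close> and \<open>1 - s 0\<close> on the two cells of the arm, so that these
  contribute to the energy at level \<open>n + 1\<close> the fractions \<open>s 0\<close> and \<open>1 - s 0\<close> of the energy at
  level \<open>n\<close>.
\<close>

lemma arm_function_exists: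
  assumes k: "k < 2"
  obtains h where "continuous_on fractal h" "h q1 = 0" "h (arm_tip k) = 1"
    "\<And>n. level_energy n h h = 1"
proof -
  define r where "r = max (s 0) (1 - s 0)"
  have r: "0 < r" "r < 1" "s 0 \<le> r" "1 - s 0 \<le> r" using s_0_pos s_0_less_1 by (auto simp: r_def)
  \<comment> \<open>The depth has the correct values at the apex and at both lower vertices.\<close>
  define u where "u n = (arm_op k ^^ n) depth" for n
  have u0: "u 0 = depth" and uS: "u (Suc n) = arm_op k (u n)" for n by (simp_all add: u_def)
  have u: "continuous_on fractal (u n) \<and> u n q1 = 0 \<and> u n (arm_tip k) = 1" for n
  proof (induction n)
    case 0
    have "continuous_on fractal depth" unfolding depth_def by (intro continuous_intros)
    then show ?case by (simp add: u0 arm_tip_def)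
  next
    case (Suc n)
    then show ?case unfolding uS using arm_op[OF k] by blast
  qed
  have u_ifs: "u (Suc n) (ifs i x) =
      (if i = k then s 0 * u n x else if i = k + 2 then s 0 + (1 - s 0) * u n x else 0)"
    if "i < 4" "x \<in> fractal" for n i x
    unfolding uS using arm_op(4)[OF k] u that by blast
  define d where "d n x = u (Suc n) x - u n x" for n x
  have d_ifs: "d (Suc n) (ifs i x) =
      (if i = k then s 0 * d n x else if i = k + 2 then (1 - s 0) * d n x else 0)"
    if "i < 4" "x \<in> fractal" for n i x
    unfolding d_def u_ifs[OF that] by (simp add: algebra_simps)
  obtain M where M: "\<And>x. x \<in> fractal \<Longrightarrow> \<bar>d 0 x\<bar> \<le> M"
  proof -
    have "continuous_on fractal (d 0)" unfolding d_def using u by (intro continuous_intros) auto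
    then have "bounded (d 0 ` fractal)"
      by (intro compact_imp_bounded compact_continuous_image compact_fractal)
    then show ?thesis using that by (auto simp: bounded_iff)
  qed
  have M0: "0 \<le> M" using M[of q1] by simp
  have d_le: "\<bar>d n x\<bar> \<le> M * r ^ n" if "x \<in> fractal" for n x
    using that
  proof (induction n arbitrary: x)
    case (Suc n)
    obtain i y where iy: "i < 4" "y \<in> fractal" "x = ifs i y" using Suc.prems by (rule fractal_cases)
    have "\<bar>c * d n y\<bar> \<le> r * (M * r ^ n)" if "0 \<le> c" "c \<le> r" for c
      unfolding abs_mult using that Suc.IH[OF iy(2)] by (intro mult_mono) auto
    note this[of "s 0"] this[of "1 - s 0"] this[of 0]
    then show ?case using r M0 s_0_pos s_0_less_1 unfolding iy(3) d_ifs[OF iy(1,2)]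
      by (auto simp: algebra_simps)
  qed (use M in simp)
  define h where "h x = depth x + (\<Sum>n. d n x)" for x
  have "uniform_limit fractal (\<lambda>n x. \<Sum>i<n. d i x) (\<lambda>x. \<Sum>i. d i x) sequentially"
    using d_le r by (intro Weierstrass_m_test[where M = "\<lambda>n. M * r ^ n"]) auto
  then have "uniform_limit fractal (\<lambda>n x. depth x + (\<Sum>i<n. d i x)) h sequentially"
    unfolding h_def by (intro uniform_limit_intros)
  moreover have "depth x + (\<Sum>i<n. d i x) = u n x" for n x
    unfolding d_def by (simp add: sum_lessThan_telescope[of "\<lambda>n. u n x"] u0)
  ultimately have ul: "uniform_limit fractal u h sequentially" by simp
  have lim: "(\<lambda>n. u n x) \<longlonglongrightarrow> h x" if "x \<in> fractal" for x
    using ul that by (rule tendsto_uniform_limitI)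
  have cont: "continuous_on fractal h"
    by (rule uniform_limit_theorem[OF _ ul]) (use u in auto)
  have h1: "h q1 = 0" using lim[of q1] u by (simp add: LIMSEQ_const_iff)
  have h2: "h (arm_tip k) = 1"
    using lim[of "arm_tip k"] u by (auto simp: LIMSEQ_const_iff arm_tip_def split: if_splits)
  have h_ifs: "h (ifs i x) = (if i = k then s 0 * h x else if i = k + 2 then s 0 + (1 - s 0) * h x else 0)"
    (is "_ = ?g")
    if "i < 4" "x \<in> fractal" for i x
  proof (rule LIMSEQ_unique)
    show "(\<lambda>n. u (Suc n) (ifs i x)) \<longlonglongrightarrow> h (ifs i x)"
      using lim ifs_in_fractal[OF that] by (intro LIMSEQ_Suc)
    show "(\<lambda>n. u (Suc n) (ifs i x)) \<longlonglongrightarrow> ?g"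
      unfolding u_ifs[OF that] by (auto intro!: tendsto_intros lim that)
  qed
  have k': "k = 0 \<or> k = 1" using k by auto
  have "level_energy n h h = 1" for n
  proof (induction n)
    case 0
    have "h q3 = 0" if "k = 0" using h_ifs[of 3 q3] that by (simp add: ifs_fixed)
    moreover have "h q2 = 0" if "k = 1" using h_ifs[of 2 q2] that by (simp add: ifs_fixed)
    ultimately show ?case using k' h1 h2 by (auto simp: arm_tip_def)
  next
    case (Suc n)
    have cell: "level_energy n (\<lambda>x. h (ifs i x)) (\<lambda>x. h (ifs i x)) =
        (if i = k then (s 0)\<^sup>2 else if i = k + 2 then (1 - s 0)\<^sup>2 else 0)" if i: "i < 4" for i
    proof -
      have "level_energy n (\<lambda>x. h (ifs i x)) (\<lambda>x. h (ifs i x)) =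
        level_energy n (\<lambda>x. (if i = k + 2 then s 0 else 0) +
            (if i = k then s 0 else if i = k + 2 then 1 - s 0 else 0) * h x)
          (\<lambda>x. (if i = k + 2 then s 0 else 0) +
            (if i = k then s 0 else if i = k + 2 then 1 - s 0 else 0) * h x)"
        using h_ifs[OF i] by (intro level_energy_cong_fractal) auto
      then show ?thesis unfolding level_energy_affine Suc by simp
    qed
    have "1 / s 0 * (s 0)\<^sup>2 + 1 / (1 - s 0) * (1 - s 0)\<^sup>2 = 1"
      using s_0_pos s_0_less_1 by (simp add: power2_eq_square)
    then show ?case unfolding level_energy.simps
      using k' s_2 s_3 by (auto simp: sum_lessThan_4 cell)
  qed
  with cont h1 h2 show thesis using that by blast
qed

end

section \<open>Self-similar measures on the fractal\<close>

locale tree_measure = resistance_ratios +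
  fixes w :: "nat \<Rightarrow> real" and \<mu> :: "(real \<times> real) measure"
  assumes weights_pos: "\<And>i. i < 4 \<Longrightarrow> 0 < w i"
    and self_similar: "self_similar_measure w \<mu>"
begin

sublocale prob_space \<mu>
  using self_similar by (simp add: self_similar_measure_def)

lemma sets_eq: "sets \<mu> = sets (restrict_space borel fractal)"
  using self_similar by (simp add: self_similar_measure_def)

lemma space_eq [simp]: "space \<mu> = fractal"
  using sets_eq_imp_space_eq[OF sets_eq] by (simp add: space_restrict_space)

lemma prob_fractal [simp]: "prob fractal = 1"
  using prob_space by simp

lemma measurable_of_continuous: "continuous_on fractal u \<Longrightarrow> u \<in> borel_measurable \<mu>"
  for u :: "real \<times> real \<Rightarrow> real"
  using borel_measurable_continuous_on_restrict measurable_cong_sets[OF sets_eq refl] by blast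

lemma measurable_ifs: 
  assumes "i < 4"
  shows "ifs i \<in> measurable \<mu> \<mu>"
proof -
  have "ifs i \<in> measurable (restrict_space borel fractal) (restrict_space borel fractal)"
    using assms
    by (intro measurable_restrict_space2 borel_measurable_continuous_on_restrict continuous_on_ifs)
       (auto simp: space_restrict_space ifs_in_fractal)
  then show ?thesis using measurable_cong_sets[OF sets_eq sets_eq] by blast
qed

lemma measurable_comp_ifs:
  assumes "u \<in> borel_measurable \<mu>" "i < 4"
  shows "(\<lambda>x. u (ifs i x)) \<in> borel_measurable \<mu>"
  using measurable_compose[OF measurable_ifs[OF assms(2)] assms(1)] .

text \<open>
  By self-similarity a set is null exactly if its preimages under all four maps are, because the
  weights are positive.
\<close>

lemma AE_eq_iff_comp_ifs:
  fixes u v :: "real \<times> real \<Rightarrow> real"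
  assumes "u \<in> borel_measurable \<mu>" "v \<in> borel_measurable \<mu>"
  shows "(AE x in \<mu>. u x = v x) \<longleftrightarrow> (\<forall>i<4. AE x in \<mu>. u (ifs i x) = v (ifs i x))"
proof -
  let ?N = "{x \<in> space \<mu>. u x \<noteq> v x}"
  have N: "?N \<in> sets \<mu>" using assms by measurable
  have Ni: "{x \<in> space \<mu>. u (ifs i x) \<noteq> v (ifs i x)} \<in> sets \<mu>" if "i < 4" for i
    using measurable_comp_ifs[OF assms(1) that] measurable_comp_ifs[OF assms(2) that] by measurable
  have pre: "ifs i -` ?N \<inter> space \<mu> = {x \<in> space \<mu>. u (ifs i x) \<noteq> v (ifs i x)}" if "i < 4" for i
    using ifs_in_fractal[OF that] by auto
  have w_nonzero: "ennreal (w i) \<noteq> 0" if "i < 4" for i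
    using weights_pos[OF that] by (simp add: ennreal_eq_0_iff)
  have "emeasure \<mu> ?N = (\<Sum>i<4. ennreal (w i) * emeasure \<mu> (ifs i -` ?N \<inter> space \<mu>))"
    using self_similar N unfolding self_similar_measure_def by blast
  also have "\<dots> = (\<Sum>i<4. ennreal (w i) * emeasure \<mu> {x \<in> space \<mu>. u (ifs i x) \<noteq> v (ifs i x)})"
    using pre by (intro sum.cong) auto
  finally have "emeasure \<mu> ?N = 0 \<longleftrightarrow>
      (\<forall>i<4. emeasure \<mu> {x \<in> space \<mu>. u (ifs i x) \<noteq> v (ifs i x)} = 0)"
    using w_nonzero by (auto simp: sum_eq_0_iff)
  then show ?thesis
    using AE_iff_measurable[OF N refl] AE_iff_measurable[OF Ni refl] by simp
qed

lemma AE_eq_comp_ifs: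
  fixes u v :: "real \<times> real \<Rightarrow> real"
  assumes "u \<in> borel_measurable \<mu>" "v \<in> borel_measurable \<mu>" "AE x in \<mu>. u x = v x" "i < 4"
  shows "AE x in \<mu>. u (ifs i x) = v (ifs i x)"
  using assms AE_eq_iff_comp_ifs by blast

text \<open>Every cell of every level carries mass, so a set of full measure is dense.\<close>

lemma continuous_eq_if_AE_eq:
  fixes u v :: "real \<times> real \<Rightarrow> real"
  assumes "continuous_on fractal u" "continuous_on fractal v" "AE x in \<mu>. u x = v x" "x \<in> fractal"
  shows "u x = v x"
proof -
  have aux: "\<forall>x\<in>fractal. \<bar>g x\<bar> \<le> \<delta>"
    if "g \<in> borel_measurable \<mu>" "AE x in \<mu>. g x = 0" "cell_osc_le n \<delta> g" for n \<delta> and g :: "real \<times> real \<Rightarrow> real"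
    using that
  proof (induction n arbitrary: g)
    case 0
    have "\<exists>y\<in>space \<mu>. g y = 0"
    proof (rule ccontr)
      assume "\<not> ?thesis"
      then have "AE x in \<mu>. g x \<noteq> 0" by (intro AE_I2) auto
      with 0(2) have "AE x in \<mu>. False" by eventually_elim simp
      then show False by simp
    qed
    then obtain y where "y \<in> fractal" "g y = 0" by auto
    with 0(3) show ?case by fastforce
  next
    case (Suc n)
    show ?case
    proof
      fix x assume "x \<in> fractal"
      then obtain i y where iy: "i < 4" "y \<in> fractal" "x = ifs i y" by (rule fractal_cases)
      have "\<forall>x\<in>fractal. \<bar>g (ifs i x)\<bar> \<le> \<delta>"
        using Suc.prems iy(1) AE_eq_comp_ifs[of g "\<lambda>_. 0" i]
        by (intro Suc.IH measurable_comp_ifs) auto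
      then show "\<bar>g x\<bar> \<le> \<delta>" using iy by simp
    qed
  qed
  have c: "continuous_on fractal (\<lambda>x. u x - v x)" using assms by (intro continuous_intros)
  have "\<bar>u x - v x\<bar> \<le> 0"
  proof (rule field_le_epsilon)
    fix \<delta> :: real assume "0 < \<delta>"
    then obtain n where "cell_osc_le n \<delta> (\<lambda>x. u x - v x)"
      using eventually_cell_osc_le[OF c] by (auto simp: eventually_sequentially)
    then show "\<bar>u x - v x\<bar> \<le> 0 + \<delta>"
      using aux[OF measurable_of_continuous[OF c]] assms(3,4) by auto
  qed
  then show ?thesis by simp
qed

lemma bounded_of_continuous:
  fixes u :: "real \<times> real \<Rightarrow> real"
  assumes "continuous_on fractal u"
  obtains B where "0 \<le> B" "\<And>x. x \<in> fractal \<Longrightarrow> \<bar>u x\<bar> \<le> B"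
proof -
  have "bounded (u ` fractal)"
    using assms compact_fractal by (intro compact_imp_bounded compact_continuous_image)
  then obtain B where "\<And>x. x \<in> fractal \<Longrightarrow> \<bar>u x\<bar> \<le> B" by (auto simp: bounded_iff)
  moreover from this[of q1] have "0 \<le> B" by simp
  ultimately show thesis using that by blast
qed

lemma integrable_of_continuous:
  fixes u :: "real \<times> real \<Rightarrow> real"
  assumes "continuous_on fractal u"
  shows "integrable \<mu> u"
proof -
  obtain B where "0 \<le> B" "\<And>x. x \<in> fractal \<Longrightarrow> \<bar>u x\<bar> \<le> B"
    using bounded_of_continuous[OF assms] by blast
  then show ?thesis
    by (intro integrable_const_bound[of u B] measurable_of_continuous assms AE_I2) simp
qed

lemma L2_of_continuous: "continuous_on fractal u \<Longrightarrow> u \<in> L2 \<mu>"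
  unfolding L2_def
  by (auto intro!: measurable_of_continuous integrable_of_continuous continuous_intros)

lemma L2_AE_eq:
  assumes "u \<in> L2 \<mu>" "v \<in> borel_measurable \<mu>" "AE x in \<mu>. u x = v x"
  shows "v \<in> L2 \<mu>"
proof -
  have "integrable \<mu> (\<lambda>x. (v x)\<^sup>2) \<longleftrightarrow> integrable \<mu> (\<lambda>x. (u x)\<^sup>2)"
    using assms by (intro integrable_cong_AE) (auto simp: L2_def)
  then show ?thesis using assms by (simp add: L2_def)
qed

lemma L2_diff:
  assumes "u \<in> L2 \<mu>" "v \<in> L2 \<mu>"
  shows "(\<lambda>x. u x - v x) \<in> L2 \<mu>"
proof -
  have [measurable]: "u \<in> borel_measurable \<mu>" "v \<in> borel_measurable \<mu>" using assms by (auto simp: L2_def)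
  have "integrable \<mu> (\<lambda>x. 2 * (u x)\<^sup>2 + 2 * (v x)\<^sup>2)" using assms by (auto simp: L2_def)
  then have "integrable \<mu> (\<lambda>x. (u x - v x)\<^sup>2)"
  proof (rule Bochner_Integration.integrable_bound)
    have "norm ((a - b)\<^sup>2) \<le> norm (2 * a\<^sup>2 + 2 * b\<^sup>2)" for a b :: real
    proof -
      have "(a - b)\<^sup>2 \<le> 2 * a\<^sup>2 + 2 * b\<^sup>2"
        using zero_le_power2[of "a + b"] by (simp add: power2_eq_square algebra_simps)
      then show ?thesis by simp
    qed
    then show "AE x in \<mu>. norm ((u x - v x)\<^sup>2) \<le> norm (2 * (u x)\<^sup>2 + 2 * (v x)\<^sup>2)" by simp
  qed measurable
  then show ?thesis by (simp add: L2_def)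
qed

lemma integral_sq_add_le:
  assumes "u \<in> L2 \<mu>" "v \<in> L2 \<mu>" "f \<in> L2 \<mu>"
  shows "(LINT x|\<mu>. (u x - f x)\<^sup>2) \<le> 2 * (LINT x|\<mu>. (u x - v x)\<^sup>2) + 2 * (LINT x|\<mu>. (v x - f x)\<^sup>2)"
proof -
  have i: "integrable \<mu> (\<lambda>x. (u x - f x)\<^sup>2)" "integrable \<mu> (\<lambda>x. (u x - v x)\<^sup>2)"
    "integrable \<mu> (\<lambda>x. (v x - f x)\<^sup>2)"
    using L2_diff assms by (auto simp: L2_def)
  have ineq: "(a - c)\<^sup>2 \<le> 2 * (a - b)\<^sup>2 + 2 * (b - c)\<^sup>2" for a b c :: real
    using zero_le_power2[of "a - b - (b - c)"] by (simp add: power2_eq_square algebra_simps)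
  have "(LINT x|\<mu>. (u x - f x)\<^sup>2) \<le> (LINT x|\<mu>. 2 * (u x - v x)\<^sup>2 + 2 * (v x - f x)\<^sup>2)"
    using i ineq by (intro integral_mono) auto
  then show ?thesis using i by simp
qed

lemma integral_sq_nonneg: "0 \<le> (LINT x|\<mu>. (u x)\<^sup>2)" for u :: "real \<times> real \<Rightarrow> real"
  by (rule integral_nonneg_AE) simp

lemma AE_eq_if_integral_sq_eq_0:
  assumes "u \<in> L2 \<mu>" "v \<in> L2 \<mu>" "(LINT x|\<mu>. (u x - v x)\<^sup>2) = 0"
  shows "AE x in \<mu>. u x = v x"
  using integral_nonneg_eq_0_iff_AE[of \<mu> "\<lambda>x. (u x - v x)\<^sup>2"] L2_diff[OF assms(1,2)] assms(3)
  by (auto simp: L2_def)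

lemma integral_sq_le:
  fixes u :: "real \<times> real \<Rightarrow> real"
  assumes "\<And>x. x \<in> fractal \<Longrightarrow> \<bar>u x\<bar> \<le> c" 
  shows "(LINT x|\<mu>. (u x)\<^sup>2) \<le> c\<^sup>2"
proof (cases "integrable \<mu> (\<lambda>x. (u x)\<^sup>2)")
  case True
  have "(LINT x|\<mu>. (u x)\<^sup>2) \<le> (LINT x|\<mu>. c\<^sup>2)"
    using True assms
    by (intro integral_mono) (auto simp: abs_le_square_iff[symmetric] intro: order_trans[OF _ abs_ge_self])
  then show ?thesis by (simp add: prob_space)
qed (simp add: not_integrable_integral_eq)

end

section \<open>Normalised self-similar forms\<close>

lemma ennreal_1_divide_eq_1D:
  fixes x :: ennreal
  assumes "1 / x = 1"
  shows "x = 1"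
proof (cases x)
  case (real r)
  show ?thesis
  proof (cases "r = 0")
    case False
    then have "ennreal (1 / r) = ennreal 1"
      using assms real divide_ennreal[of 1 r] by simp
    then show ?thesis using real False by (simp add: field_simps)
  qed (use assms real in \<open>simp add: ennreal_divide_zero\<close>)
qed (use assms in simp)

text \<open>
  This covers forms that are not yet known to have a dense domain, so that the interpolation lemma
  below can serve to establish the density for the standard form.
\<close>

locale self_similar_markov_form = tree_measure +
  fixes \<E> :: "(real \<times> real \<Rightarrow> real) \<Rightarrow> (real \<times> real \<Rightarrow> real) \<Rightarrow> real"
    and F :: "(real \<times> real \<Rightarrow> real) set"
  assumes symmetric_form: "symmetric_form \<mu> \<E> F"
    and markov: "\<And>u. u \<in> F \<Longrightarrow> (\<lambda>x. min (max (u x) 0) 1) \<in> F \<and>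
          \<E> (\<lambda>x. min (max (u x) 0) 1) (\<lambda>x. min (max (u x) 0) 1) \<le> \<E> u u"
    and self_similar_form: "self_similar_form s \<mu> \<E> F"
    and one_in_domain: "(\<lambda>x. 1) \<in> F"
    and resistance_arm: "\<And>k. k < 2 \<Longrightarrow> effective_resistance \<mu> \<E> F q1 (arm_tip k) = 1"
begin

lemma domain_L2: "u \<in> F \<Longrightarrow> u \<in> L2 \<mu>"
  and domain_AE: "u \<in> F \<Longrightarrow> v \<in> borel_measurable \<mu> \<Longrightarrow> AE x in \<mu>. u x = v x \<Longrightarrow> v \<in> F"
  and form_AE_left: "u \<in> F \<Longrightarrow> v \<in> borel_measurable \<mu> \<Longrightarrow> AE x in \<mu>. u x = v x \<Longrightarrow> f \<in> F \<Longrightarrow> \<E> u f = \<E> v f"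
  and domain_add: "u \<in> F \<Longrightarrow> v \<in> F \<Longrightarrow> (\<lambda>x. u x + v x) \<in> F"
  and domain_scale: "u \<in> F \<Longrightarrow> (\<lambda>x. c * u x) \<in> F"
  and form_add_left: "u \<in> F \<Longrightarrow> v \<in> F \<Longrightarrow> f \<in> F \<Longrightarrow> \<E> (\<lambda>x. u x + v x) f = \<E> u f + \<E> v f"
  and form_scale_left: "u \<in> F \<Longrightarrow> f \<in> F \<Longrightarrow> \<E> (\<lambda>x. c * u x) f = c * \<E> u f"
  and form_commute: "u \<in> F \<Longrightarrow> v \<in> F \<Longrightarrow> \<E> u v = \<E> v u"
  and form_nonneg: "u \<in> F \<Longrightarrow> 0 \<le> \<E> u u"
  using symmetric_form unfolding symmetric_form_def by blast+

lemma domain_measurable: "u \<in> F \<Longrightarrow> u \<in> borel_measurable \<mu>"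
  using domain_L2 by (auto simp: L2_def)

lemma form_add_right: "u \<in> F \<Longrightarrow> v \<in> F \<Longrightarrow> f \<in> F \<Longrightarrow> \<E> f (\<lambda>x. u x + v x) = \<E> f u + \<E> f v"
  using form_commute form_add_left domain_add by metis

lemma form_scale_right: "u \<in> F \<Longrightarrow> f \<in> F \<Longrightarrow> \<E> f (\<lambda>x. c * u x) = c * \<E> f u"
  using form_commute form_scale_left domain_scale by metis

lemma domain_diff: "u \<in> F \<Longrightarrow> v \<in> F \<Longrightarrow> (\<lambda>x. u x - v x) \<in> F"
  using domain_add[of u "\<lambda>x. -1 * v x"] domain_scale[of v "-1"] by simp

lemma form_diag_add:
  assumes "u \<in> F" "v \<in> F"
  shows "\<E> (\<lambda>x. u x + v x) (\<lambda>x. u x + v x) = \<E> u u + 2 * \<E> u v + \<E> v v"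
  using assms form_commute[of v u] by (simp add: form_add_left form_add_right domain_add)

lemma form_diag_scale: "u \<in> F \<Longrightarrow> \<E> (\<lambda>x. c * u x) (\<lambda>x. c * u x) = c\<^sup>2 * \<E> u u"
  by (simp add: form_scale_left form_scale_right domain_scale power2_eq_square)

lemma form_diag_diff:
  assumes "u \<in> F" "v \<in> F"
  shows "\<E> (\<lambda>x. u x - v x) (\<lambda>x. u x - v x) = \<E> u u - 2 * \<E> u v + \<E> v v"
  using form_diag_add[OF assms(1) domain_scale[OF assms(2), of "-1"]]
    form_diag_scale[OF assms(2), of "-1"] form_scale_right[OF assms(2,1), of "-1"] by simp

lemma form_diag_AE:
  assumes "u \<in> F" "v \<in> borel_measurable \<mu>" "AE x in \<mu>. u x = v x"
  shows "v \<in> F" "\<E> v v = \<E> u u"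
proof -
  show v: "v \<in> F" using assms by (rule domain_AE)
  show "\<E> v v = \<E> u u"
    using form_AE_left[OF assms] v assms(1) form_commute[OF assms(1) v] by metis
qed

lemma form_diag_cong:
  assumes "u \<in> F" "continuous_on fractal u" "\<And>x. x \<in> fractal \<Longrightarrow> u x = v x"
  shows "v \<in> F" "\<E> v v = \<E> u u"
proof -
  have "continuous_on fractal v" using assms(2,3) by (rule continuous_on_eq)
  then have "v \<in> borel_measurable \<mu>" by (rule measurable_of_continuous)
  moreover have "AE x in \<mu>. u x = v x" using assms(3) by (intro AE_I2) simp
  ultimately show "v \<in> F" "\<E> v v = \<E> u u" using form_diag_AE[OF assms(1)] by auto
qed

text \<open>
  Since the factors \<open>1 / s i\<close> are positive, the right-hand side is finite only if all its terms are.
\<close>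

lemma energy_eq_sum_cells_iff:
  assumes "energy \<E> F u = (\<Sum>i<4. ennreal (1 / s i) * energy \<E> F (u \<circ> ifs i))"
  shows "u \<in> F \<longleftrightarrow> (\<forall>i<4. (\<lambda>x. u (ifs i x)) \<in> F)"
    and "u \<in> F \<Longrightarrow> \<E> u u = (\<Sum>i<4. 1 / s i * \<E> (\<lambda>x. u (ifs i x)) (\<lambda>x. u (ifs i x)))"
proof -
  have nz: "ennreal (1 / s i) \<noteq> 0" if "i < 4" for i
    using s_pos[OF that] by (simp add: ennreal_eq_0_iff)
  have fin: "energy \<E> F v \<noteq> \<infinity> \<longleftrightarrow> v \<in> F" for v by (simp add: energy_def)
  have "energy \<E> F u \<noteq> \<infinity> \<longleftrightarrow> (\<forall>i<4. energy \<E> F (u \<circ> ifs i) \<noteq> \<infinity>)"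
    unfolding assms using nz by (auto simp: ennreal_mult_eq_top_iff)
  then show iff: "u \<in> F \<longleftrightarrow> (\<forall>i<4. (\<lambda>x. u (ifs i x)) \<in> F)" unfolding fin by (simp add: comp_def)
  assume u: "u \<in> F"
  have "ennreal (\<E> u u) =
      (\<Sum>i<4. ennreal (1 / s i) * ennreal (\<E> (\<lambda>x. u (ifs i x)) (\<lambda>x. u (ifs i x))))"
    using assms u iff by (simp add: energy_def comp_def)
  also have "\<dots> = (\<Sum>i<4. ennreal (1 / s i * \<E> (\<lambda>x. u (ifs i x)) (\<lambda>x. u (ifs i x))))"
    using iff u s_pos form_nonneg
    by (intro sum.cong refl ennreal_mult[symmetric]) (auto intro: less_imp_le)
  also have "\<dots> = ennreal (\<Sum>i<4. 1 / s i * \<E> (\<lambda>x. u (ifs i x)) (\<lambda>x. u (ifs i x)))"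
    using iff u s_pos form_nonneg by (intro sum_ennreal) (simp add: less_imp_le)
  finally show "\<E> u u = (\<Sum>i<4. 1 / s i * \<E> (\<lambda>x. u (ifs i x)) (\<lambda>x. u (ifs i x)))"
    using iff u s_pos form_nonneg
    by (subst (asm) ennreal_inj) (auto intro!: sum_nonneg simp: less_imp_le)
qed

lemma form_sum_cells:
  assumes "u \<in> F"
  shows "\<And>i. i < 4 \<Longrightarrow> (\<lambda>x. u (ifs i x)) \<in> F"
    and "\<E> u u = (\<Sum>i<4. 1 / s i * \<E> (\<lambda>x. u (ifs i x)) (\<lambda>x. u (ifs i x)))"
  using energy_eq_sum_cells_iff[of u] assms self_similar_form unfolding self_similar_form_def by auto

lemma domain_if_cells:
  assumes "continuous_on fractal u" "\<And>i. i < 4 \<Longrightarrow> (\<lambda>x. u (ifs i x)) \<in> F"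
  shows "u \<in> F"
  using energy_eq_sum_cells_iff(1)[of u] assms self_similar_form unfolding self_similar_form_def by auto

text \<open>
  Self-similarity makes the form vanish on constants: the factors \<open>1 / s i\<close> are all larger than
  \<open>1\<close>, so that the energy of \<open>1\<close> would otherwise exceed itself.  Its mixed terms vanish with it, as in
  the Cauchy-Schwarz inequality.
\<close>

lemma form_one_left:
  assumes "f \<in> F"
  shows "\<E> (\<lambda>x. 1) f = 0"
proof -
  let ?e = "\<E> (\<lambda>x. 1) (\<lambda>x. 1)"
  have e0: "0 \<le> ?e" using one_in_domain by (rule form_nonneg)
  have gt: "?e \<le> 1 / s i * ?e" if "i < 4" for i
    using mult_right_mono[of 1 "1 / s i" ?e] e0 s_pos[OF that] s_less_1[OF that] by simp
  have "?e = (\<Sum>i<4. 1 / s i * ?e)" using form_sum_cells(2)[OF one_in_domain] by simp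
  also have "\<dots> \<ge> (\<Sum>i<(4::nat). ?e)" using gt by (intro sum_mono) simp
  finally have e: "?e = 0" using e0 by simp
  show ?thesis
  proof (rule ccontr)
    assume ne: "\<E> (\<lambda>x. 1) f \<noteq> 0"
    \<comment> \<open>For this \<open>t\<close> the energy of \<open>t + f\<close>, which is affine in \<open>t\<close>, equals \<open>-1\<close>.\<close>
    define t where "t = - (\<E> f f + 1) / (2 * \<E> (\<lambda>x. 1) f)"
    then have t: "t * \<E> (\<lambda>x. 1) f = - (\<E> f f + 1) / 2" using ne by simp
    have "0 \<le> \<E> (\<lambda>x. t * 1 + f x) (\<lambda>x. t * 1 + f x)"
      using domain_scale[OF one_in_domain, of t] assms by (intro form_nonneg domain_add)
    also have "\<dots> = t\<^sup>2 * ?e + 2 * (t * \<E> (\<lambda>x. 1) f) + \<E> f f"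
      using form_diag_add[OF domain_scale[OF one_in_domain, of t] assms]
        form_diag_scale[OF one_in_domain, of t] form_scale_left[OF one_in_domain assms, of t] by simp
    also have "\<dots> = - 1" unfolding t e by (simp add: field_simps)
    finally show False by simp
  qed
qed

lemma domain_affine: "u \<in> F \<Longrightarrow> (\<lambda>x. a + b * u x) \<in> F"
  using domain_add[OF domain_scale[OF one_in_domain, of a] domain_scale[of u b]] by simp

lemma form_affine:
  assumes "u \<in> F"
  shows "\<E> (\<lambda>x. a + b * u x) (\<lambda>x. a + b * u x) = b\<^sup>2 * \<E> u u"
proof -
  have bu: "(\<lambda>x. b * u x) \<in> F" using assms by (rule domain_scale)
  have "\<E> (\<lambda>x. a * 1) (\<lambda>x. a * 1) = 0"
    using form_diag_scale[OF one_in_domain, of a] form_one_left[OF one_in_domain] by simp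
  moreover have "\<E> (\<lambda>x. a * 1) (\<lambda>x. b * u x) = 0"
    using form_scale_left[OF one_in_domain bu, of a] form_one_left[OF bu] by simp
  ultimately show ?thesis
    using form_diag_add[OF domain_scale[OF one_in_domain, of a] bu] form_diag_scale[OF assms, of b]
    by simp
qed

lemma arm_drop_le_form:
  assumes "u \<in> F" "continuous_on fractal u" "k < 2"
  shows "(u q1 - u (arm_tip k))\<^sup>2 \<le> \<E> u u"
proof (cases "u q1 = u (arm_tip k)")
  case False
  define b where "b = 1 / (u (arm_tip k) - u q1)"
  define v where "v x = - b * u q1 + b * u x" for x
  have v: "v \<in> F" "\<E> v v = b\<^sup>2 * \<E> u u"
    unfolding v_def by (rule domain_affine[OF assms(1)], rule form_affine[OF assms(1)])
  have b: "b * (u (arm_tip k) - u q1) = 1" using False by (simp add: b_def)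
  have v': "continuous_on (space \<mu>) v" "v q1 = 0"
    using assms(2) by (simp_all add: v_def continuous_intros)
  have "v (arm_tip k) = 1" using b by (simp add: v_def algebra_simps)
  note v' = v' this
  have "(INF u\<in>{u \<in> F. continuous_on (space \<mu>) u \<and> u q1 = 0 \<and> u (arm_tip k) = 1}. energy \<E> F u) = 1"
    using resistance_arm[OF assms(3)] unfolding effective_resistance_def by (rule ennreal_1_divide_eq_1D)
  moreover have "(INF u\<in>{u \<in> F. continuous_on (space \<mu>) u \<and> u q1 = 0 \<and> u (arm_tip k) = 1}. energy \<E> F u)
      \<le> energy \<E> F v"
    using v v' by (intro INF_lower) auto
  ultimately have "ennreal 1 \<le> ennreal (\<E> v v)" using v(1) by (simp add: energy_def)
  then have "1 \<le> b\<^sup>2 * \<E> u u" using form_nonneg[OF v(1)] v(2) by (simp del: ennreal_1)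
  then have "(u (arm_tip k) - u q1)\<^sup>2 * 1 \<le> (u (arm_tip k) - u q1)\<^sup>2 * (b\<^sup>2 * \<E> u u)"
    by (intro mult_left_mono) auto
  also have "\<dots> = (b * (u (arm_tip k) - u q1))\<^sup>2 * \<E> u u" by (simp add: power_mult_distrib)
  finally show ?thesis unfolding b by (simp add: power2_commute)
qed (use form_nonneg[OF assms(1)] in simp)

lemma arm_function_near_optimal:
  assumes "k < 2" "0 < \<epsilon>"
  obtains f where "f \<in> F" "continuous_on fractal f" "f q1 = 0" "f (arm_tip k) = 1"
    "\<And>x. 0 \<le> f x" "\<And>x. f x \<le> 1" "\<E> f f \<le> 1 + \<epsilon>"
proof -
  let ?A = "{u \<in> F. continuous_on (space \<mu>) u \<and> u q1 = 0 \<and> u (arm_tip k) = 1}"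
  have "(INF u\<in>?A. energy \<E> F u) = 1"
    using resistance_arm[OF assms(1)] unfolding effective_resistance_def by (rule ennreal_1_divide_eq_1D)
  also have "\<dots> < ennreal (1 + \<epsilon>)" using assms(2) by (simp flip: ennreal_1)
  finally obtain u where u: "u \<in> F" "continuous_on fractal u" "u q1 = 0" "u (arm_tip k) = 1"
    "energy \<E> F u < ennreal (1 + \<epsilon>)" unfolding INF_less_iff by auto
  have e: "\<E> u u < 1 + \<epsilon>"
    using u(1,5) form_nonneg[OF u(1)] by (simp add: energy_def ennreal_less_iff)
  show thesis
  proof (rule that[of "\<lambda>x. min (max (u x) 0) 1"])
    show "continuous_on fractal (\<lambda>x. min (max (u x) 0) 1)" by (intro continuous_intros u)
  qed (use markov[OF u(1)] e u in auto)
qed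

text \<open>
  In a self-similar form the two arms consist of cells in series and have no cell in common, so
  the three corners are connected only through \<open>q1\<close>.
\<close>

lemma level_energy_le_form:
  assumes "u \<in> F" "continuous_on fractal u"
  shows "level_energy n u u \<le> \<E> u u"
  using assms
proof (induction n arbitrary: u)
  case 0
  let ?a = "u q1" and ?b = "u q2" and ?c = "u q3" and ?m = "u (ifs 0 q2)" and ?m' = "u (ifs 1 q3)"
  have drop: "1 / s i * (u (ifs i q1) - u (ifs i (arm_tip k)))\<^sup>2 \<le>
      1 / s i * \<E> (\<lambda>x. u (ifs i x)) (\<lambda>x. u (ifs i x))" if "i < 4" "k < 2" for i k
    using arm_drop_le_form[OF form_sum_cells(1)[OF 0(1) that(1)] _ that(2)]
      continuous_on_comp_ifs[OF 0(2) that(1)] s_pos[OF that(1)]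
    by (intro mult_left_mono) (auto simp: comp_def)
  have "(?a - ?b)\<^sup>2 \<le> 1 / s 0 * (?a - ?m)\<^sup>2 + 1 / s 2 * (?m - ?b)\<^sup>2"
    using series_law_le[OF s_0_pos s_0_less_1, of "?a - ?m" "?m - ?b"] s_2 by simp
  moreover have "(?a - ?c)\<^sup>2 \<le> 1 / s 0 * (?a - ?m')\<^sup>2 + 1 / s 3 * (?m' - ?c)\<^sup>2"
    using series_law_le[OF s_0_pos s_0_less_1, of "?a - ?m'" "?m' - ?c"] s_3 by simp
  moreover note drop[of 0 0] drop[of 1 1] drop[of 2 0] drop[of 3 1]
  ultimately show ?case
    using form_sum_cells(2)[OF 0(1)] ifs_fixed ifs_junction
    by (simp add: sum_lessThan_4 power2_eq_square[symmetric] arm_tip_def)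
next
  case (Suc n)
  have "level_energy (Suc n) u u \<le> (\<Sum>i<4. 1 / s i * \<E> (\<lambda>x. u (ifs i x)) (\<lambda>x. u (ifs i x)))"
    unfolding level_energy.simps
  proof (intro sum_mono mult_left_mono Suc.IH)
    fix i :: nat assume i: "i \<in> {..<4}"
    show "(\<lambda>x. u (ifs i x)) \<in> F" using form_sum_cells(1)[OF Suc.prems(1)] i by simp
    show "continuous_on fractal (\<lambda>x. u (ifs i x))"
      using continuous_on_comp_ifs[OF Suc.prems(2)] i by (simp add: comp_def)
  qed (use s_pos in \<open>auto intro: less_imp_le\<close>)
  then show ?case using form_sum_cells(2)[OF Suc.prems(1)] by simp
qed

lemma finite_energy_of_domain: "u \<in> F \<Longrightarrow> continuous_on fractal u \<Longrightarrow> u \<in> finite_energy"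
  using level_energy_le_form by (intro finite_energyI)

lemma glue_in_domain:
  assumes "compatible g" "\<And>i. i < 4 \<Longrightarrow> continuous_on fractal (g i)" "\<And>i. i < 4 \<Longrightarrow> g i \<in> F"
  shows "glue g \<in> F" "\<E> (glue g) (glue g) = (\<Sum>i<4. 1 / s i * \<E> (g i) (g i))"
proof -
  have c: "continuous_on fractal (glue g)" by (rule continuous_on_glue[OF assms(1,2)])
  have cell: "(\<lambda>x. glue g (ifs i x)) \<in> F"
    "\<E> (\<lambda>x. glue g (ifs i x)) (\<lambda>x. glue g (ifs i x)) = \<E> (g i) (g i)" if "i < 4" for i
    using form_diag_cong[OF assms(3,2), of i "\<lambda>x. glue g (ifs i x)"] glue_ifs[OF assms(1)] that by auto
  show g: "glue g \<in> F" using c cell(1) by (rule domain_if_cells)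
  show "\<E> (glue g) (glue g) = (\<Sum>i<4. 1 / s i * \<E> (g i) (g i))"
    using form_sum_cells(2)[OF g] cell(2) by simp
qed

text \<open>
  Conversely the energy at level \<open>0\<close> is the infimum of the energies of all continuous functions
  with the given corner values: nearly optimal functions for the two arms, glued according to
  the voltage division in a series connection, come arbitrarily close.
\<close>

lemma corner_interpolation:
  assumes "0 < \<epsilon>"
  shows "\<exists>u\<in>F. continuous_on fractal u \<and> u q1 = a \<and> u q2 = b \<and> u q3 = c \<and>
    \<E> u u \<le> (a - b)\<^sup>2 + (a - c)\<^sup>2 + \<epsilon> \<and>
    (\<forall>x\<in>fractal. \<exists>t\<in>{0..1}. u x = (1 - t) * a + t * b \<or> u x = (1 - t) * a + t * c)"
proof -
  define \<eta> where "\<eta> = \<epsilon> / ((b - a)\<^sup>2 + (c - a)\<^sup>2 + 1)"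
  have pos: "0 < (b - a)\<^sup>2 + (c - a)\<^sup>2 + 1" by (simp add: add_nonneg_pos)
  then have \<eta>: "0 < \<eta>" using assms by (simp add: \<eta>_def)
  obtain f0 where f0: "f0 \<in> F" "continuous_on fractal f0" "f0 q1 = 0" "f0 (arm_tip 0) = 1"
    "\<And>x. 0 \<le> f0 x" "\<And>x. f0 x \<le> 1" "\<E> f0 f0 \<le> 1 + \<eta>"
    using arm_function_near_optimal[of 0 \<eta>] \<eta> by auto
  obtain f1 where f1: "f1 \<in> F" "continuous_on fractal f1" "f1 q1 = 0" "f1 (arm_tip 1) = 1"
    "\<And>x. 0 \<le> f1 x" "\<And>x. f1 x \<le> 1" "\<E> f1 f1 \<le> 1 + \<eta>"
    using arm_function_near_optimal[of 1 \<eta>] \<eta> by auto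
  have tips: "f0 q2 = 1" "f1 q3 = 1" using f0(4) f1(4) by (auto simp: arm_tip_def)
  \<comment> \<open>The even cells \<open>0, 2\<close> form the arm to \<open>q2\<close>, the odd cells \<open>1, 3\<close> the arm to \<open>q3\<close>; \<open>d i\<close> is the
    total rise along the arm, of which the fraction \<open>s i\<close> occurs in cell \<open>i\<close>.\<close>
  define f where "f i = (if even i then f0 else f1)" for i :: nat
  define d where "d i = (if even i then b - a else c - a)" for i :: nat
  define \<alpha> where "\<alpha> i = (if i < 2 then a else a + s 0 * d i)" for i :: nat
  define g where "g i x = \<alpha> i + s i * d i * f i x" for i x
  have f: "f i \<in> F" "continuous_on fractal (f i)" "\<And>x. 0 \<le> f i x" "\<And>x. f i x \<le> 1" "f i q1 = 0"
    "\<E> (f i) (f i) \<le> 1 + \<eta>" for i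
    using f0 f1 by (auto simp: f_def)
  have g: "continuous_on fractal (g i)" "g i \<in> F" "\<E> (g i) (g i) = (s i * d i)\<^sup>2 * \<E> (f i) (f i)" for i
    unfolding g_def using f by (auto intro!: continuous_intros domain_affine form_affine)
  have comp: "compatible g"
    unfolding compatible_def g_def using tips f0(3) f1(3) by (simp add: f_def d_def \<alpha>_def f0(3) f1(3))
  define u where "u = glue g"
  have "\<E> u u = (\<Sum>i<4. s i * (d i)\<^sup>2 * \<E> (f i) (f i))"
    unfolding u_def glue_in_domain(2)[OF comp g(1,2)] g(3)
    using s_pos by (intro sum.cong) (auto simp: power2_eq_square dest: less_imp_neq)
  also have "\<dots> \<le> (\<Sum>i<4. s i * (d i)\<^sup>2 * (1 + \<eta>))"
    using f(6) s_pos
    by (intro sum_mono mult_left_mono mult_nonneg_nonneg) (auto intro: less_imp_le)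
  also have "\<dots> = ((b - a)\<^sup>2 + (c - a)\<^sup>2) * (1 + \<eta>)"
    unfolding sum_lessThan_4 d_def s_1 s_2 s_3 by (simp add: algebra_simps)
  also have "\<dots> \<le> (b - a)\<^sup>2 + (c - a)\<^sup>2 + \<epsilon>"
    using pos assms by (simp add: \<eta>_def field_simps)
  finally have e: "\<E> u u \<le> (a - b)\<^sup>2 + (a - c)\<^sup>2 + \<epsilon>" by (simp add: power2_commute)
  have "\<exists>t\<in>{0..1}. u x = (1 - t) * a + t * b \<or> u x = (1 - t) * a + t * c" if "x \<in> fractal" for x
  proof -
    obtain i y where iy: "i < 4" "y \<in> fractal" "x = ifs i y" using \<open>x \<in> fractal\<close> by (rule fractal_cases)
    define t where "t = (if i < 2 then 0 else s 0) + s i * f i y"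
    have u: "u x = a + t * d i"
      unfolding iy(3) u_def glue_ifs[OF comp iy(1,2)] g_def by (simp add: \<alpha>_def t_def algebra_simps)
    have "0 \<le> s i * f i y" "s i * f i y \<le> s i"
      using f s_pos[OF iy(1)] by (auto simp: mult_left_le)
    moreover have "(if i < 2 then 0 else s 0) + s i \<le> 1"
      using s_0_less_1 s_2 s_3 less_4_cases[OF iy(1)] by auto
    ultimately have "t \<in> {0..1}" using s_0_pos by (auto simp: t_def)
    then show ?thesis using u by (intro bexI[of _ t]) (auto simp: d_def algebra_simps)
  qed
  moreover have "u q1 = a" "u q2 = b" "u q3 = c"
    unfolding u_def glue_vertices[OF comp] g_def \<alpha>_def using tips f0(3) f1(3)
    by (simp_all add: f_def d_def s_2 s_3 algebra_simps)
  moreover have "u \<in> F" "continuous_on fractal u"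
    unfolding u_def using glue_in_domain(1)[OF comp g(1,2)] continuous_on_glue[OF comp g(1)] by auto
  ultimately show ?thesis using e by blast
qed

text \<open>
  At level \<open>n\<close> the interpolants on the cells agree with \<open>f\<close> at the junctions and hence can be glued.
  The values on a cell lie between those of \<open>f\<close> at its corners, so the uniform error is at most the
  oscillation of \<open>f\<close> on the cells.
\<close>

lemma interpolation:
  assumes "continuous_on fractal f" "0 < \<epsilon>" "cell_osc_le n \<delta> f"
  shows "\<exists>u\<in>F. continuous_on fractal u \<and> (\<forall>x\<in>vertices n. u x = f x) \<and>
    \<E> u u \<le> level_energy n f f + \<epsilon> \<and> (\<forall>x\<in>fractal. \<bar>u x - f x\<bar> \<le> \<delta>)"
  using assms
proof (induction n arbitrary: f \<epsilon>)
  case 0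
  obtain u where u: "u \<in> F" "continuous_on fractal u" "u q1 = f q1" "u q2 = f q2" "u q3 = f q3"
    "\<E> u u \<le> (f q1 - f q2)\<^sup>2 + (f q1 - f q3)\<^sup>2 + \<epsilon>"
    "\<And>x. x \<in> fractal \<Longrightarrow> \<exists>t\<in>{0..1}. u x = (1 - t) * f q1 + t * f q2 \<or> u x = (1 - t) * f q1 + t * f q3"
    using corner_interpolation[OF 0(2), of "f q1" "f q2" "f q3"] by blast
  have "\<bar>u x - f x\<bar> \<le> \<delta>" if x: "x \<in> fractal" for x
  proof -
    have conv: "\<bar>((1 - t) * a + t * b) - y\<bar> \<le> \<delta>"
      if "t \<in> {0..1}" "\<bar>a - y\<bar> \<le> \<delta>" "\<bar>b - y\<bar> \<le> \<delta>" for t a b y :: real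
    proof -
      have "\<bar>((1 - t) * a + t * b) - y\<bar> = \<bar>(1 - t) * (a - y) + t * (b - y)\<bar>" by (simp add: algebra_simps)
      also have "\<dots> \<le> (1 - t) * \<bar>a - y\<bar> + t * \<bar>b - y\<bar>"
        using that(1) abs_triangle_ineq[of "(1 - t) * (a - y)" "t * (b - y)"] by (simp add: abs_mult)
      also have "\<dots> \<le> (1 - t) * \<delta> + t * \<delta>"
        using that by (intro add_mono mult_left_mono) auto
      finally show ?thesis by (simp add: algebra_simps)
    qed
    have "\<bar>f q1 - f x\<bar> \<le> \<delta>" "\<bar>f q2 - f x\<bar> \<le> \<delta>" "\<bar>f q3 - f x\<bar> \<le> \<delta>" using 0(3) x by auto
    then show ?thesis using u(7)[OF x] conv by (metis (no_types))
  qed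
  then show ?case using u by (intro bexI[of _ u]) (auto simp: power2_eq_square)
next
  case (Suc n)
  have "\<exists>u\<in>F. continuous_on fractal u \<and> (\<forall>x\<in>vertices n. u x = f (ifs i x)) \<and>
      \<E> u u \<le> level_energy n (\<lambda>x. f (ifs i x)) (\<lambda>x. f (ifs i x)) + s i * \<epsilon> / 4 \<and>
      (\<forall>x\<in>fractal. \<bar>u x - f (ifs i x)\<bar> \<le> \<delta>)" if i: "i < 4" for i
    using continuous_on_comp_ifs[OF Suc.prems(1) i] s_pos[OF i] Suc.prems(2,3) i
    by (intro Suc.IH) (auto simp: comp_def)
  then have "\<forall>i\<in>{..<4}. \<exists>u. u \<in> F \<and> continuous_on fractal u \<and> (\<forall>x\<in>vertices n. u x = f (ifs i x)) \<and>
      \<E> u u \<le> level_energy n (\<lambda>x. f (ifs i x)) (\<lambda>x. f (ifs i x)) + s i * \<epsilon> / 4 \<and>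
      (\<forall>x\<in>fractal. \<bar>u x - f (ifs i x)\<bar> \<le> \<delta>)" by (simp add: Bex_def)
  from bchoice[OF this] obtain g where
    G: "\<forall>i\<in>{..<4}. g i \<in> F \<and> continuous_on fractal (g i) \<and> (\<forall>x\<in>vertices n. g i x = f (ifs i x)) \<and>
      \<E> (g i) (g i) \<le> level_energy n (\<lambda>x. f (ifs i x)) (\<lambda>x. f (ifs i x)) + s i * \<epsilon> / 4 \<and>
      (\<forall>x\<in>fractal. \<bar>g i x - f (ifs i x)\<bar> \<le> \<delta>)" ..
  have g: "g i \<in> F" "continuous_on fractal (g i)" "\<And>x. x \<in> vertices n \<Longrightarrow> g i x = f (ifs i x)"
    "\<E> (g i) (g i) \<le> level_energy n (\<lambda>x. f (ifs i x)) (\<lambda>x. f (ifs i x)) + s i * \<epsilon> / 4"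
    "\<And>x. x \<in> fractal \<Longrightarrow> \<bar>g i x - f (ifs i x)\<bar> \<le> \<delta>" if "i < 4" for i
    using G that by auto
  have comp: "compatible g"
    unfolding compatible_def
    using g(3)[of 0 q1] g(3)[of 1 q1] g(3)[of 0 q2] g(3)[of 2 q1] g(3)[of 1 q3] g(3)[of 3 q1]
    by (simp add: corners_in_vertices ifs_fixed(1,2)[simplified] ifs_junction)
  have "glue g x = f x" if "x \<in> vertices (Suc n)" for x
  proof -
    obtain i y where iy: "i < 4" "y \<in> vertices n" "x = ifs i y"
      using \<open>x \<in> vertices (Suc n)\<close> unfolding vertices.simps by blast
    have "y \<in> fractal" using iy(2) vertices_subset_fractal by blast
    then show ?thesis using glue_ifs[OF comp iy(1)] g(3)[OF iy(1,2)] iy(3) by simp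
  qed
  moreover have "\<bar>glue g x - f x\<bar> \<le> \<delta>" if "x \<in> fractal" for x
  proof -
    obtain i y where iy: "i < 4" "y \<in> fractal" "x = ifs i y" using \<open>x \<in> fractal\<close> by (rule fractal_cases)
    then show ?thesis using glue_ifs[OF comp iy(1,2)] g(5) by simp
  qed
  moreover have "\<E> (glue g) (glue g) \<le> level_energy (Suc n) f f + \<epsilon>"
  proof -
    have "\<E> (glue g) (glue g) = (\<Sum>i<4. 1 / s i * \<E> (g i) (g i))"
      by (rule glue_in_domain(2)[OF comp g(2,1)])
    also have "\<dots> \<le> (\<Sum>i<4. 1 / s i *
        (level_energy n (\<lambda>x. f (ifs i x)) (\<lambda>x. f (ifs i x)) + s i * \<epsilon> / 4))"
      using g(4) s_pos by (intro sum_mono mult_left_mono) (auto intro: less_imp_le)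
    also have "\<dots> = (\<Sum>i<4. 1 / s i * level_energy n (\<lambda>x. f (ifs i x)) (\<lambda>x. f (ifs i x)) + \<epsilon> / 4)"
    proof (intro sum.cong refl)
      have "1 / c * (y + c * \<epsilon> / 4) = 1 / c * y + \<epsilon> / 4" if "0 < c" for c y :: real
        using that by (simp add: field_simps)
      then show "1 / s i * (level_energy n (\<lambda>x. f (ifs i x)) (\<lambda>x. f (ifs i x)) + s i * \<epsilon> / 4) =
          1 / s i * level_energy n (\<lambda>x. f (ifs i x)) (\<lambda>x. f (ifs i x)) + \<epsilon> / 4"
        if "i \<in> {..<4}" for i using s_pos that by simp
    qed
    also have "\<dots> = level_energy (Suc n) f f + \<epsilon>" by (simp add: sum.distrib)
    finally show ?thesis .
  qed
  ultimately show ?case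
    using glue_in_domain(1)[OF comp g(2,1)] continuous_on_glue[OF comp g(2)] by blast
qed

text \<open>
  The interpolants \<open>u n\<close> of a function \<open>f\<close> of finite energy are Cauchy by the parallelogram law:
  since \<open>(u m + u n) / 2\<close> agrees with \<open>f\<close> on the vertices of level \<open>min m n\<close>, its energy is
  bounded below by that of \<open>f\<close> at this level, which is close to the energies of \<open>u m\<close> and \<open>u n\<close>.
\<close>

lemma finite_energy_in_domain:
  assumes complete: "\<And>u. (\<And>n::nat. u n \<in> F) \<Longrightarrow>
      (\<And>\<epsilon>. \<epsilon> > 0 \<Longrightarrow> \<exists>N. \<forall>m\<ge>N. \<forall>n\<ge>N. form_norm_sq \<mu> \<E> (\<lambda>x. u m x - u n x) < \<epsilon>) \<Longrightarrow>
      \<exists>v\<in>F. (\<lambda>n. form_norm_sq \<mu> \<E> (\<lambda>x. u n x - v x)) \<longlonglongrightarrow> 0"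
    and f: "f \<in> finite_energy"
  shows "f \<in> F" "\<E> f f = limit_energy f f"
proof -
  have cf: "continuous_on fractal f" using f by (rule finite_energy_continuous)
  let ?L = "limit_energy f f"
  have "\<exists>u. u \<in> F \<and> continuous_on fractal u \<and> (\<forall>x\<in>vertices k. u x = f x) \<and>
      \<E> u u \<le> ?L + 1 / Suc k \<and> (\<forall>x\<in>fractal. \<bar>u x - f x\<bar> \<le> 1 / Suc k)" for k :: nat
  proof -
    have "\<forall>\<^sub>F n in sequentially. cell_osc_le n (1 / Suc k) f" using cf by (rule eventually_cell_osc_le) simp
    then obtain N where "\<And>n. n \<ge> N \<Longrightarrow> cell_osc_le n (1 / Suc k) f"
      by (auto simp: eventually_sequentially)
    then have "cell_osc_le (max N k) (1 / Suc k) f" by simp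
    from interpolation[OF cf _ this, of "1 / Suc k"] obtain u where u: "u \<in> F" "continuous_on fractal u"
      "\<forall>x\<in>vertices (max N k). u x = f x" "\<E> u u \<le> level_energy (max N k) f f + 1 / Suc k"
      "\<forall>x\<in>fractal. \<bar>u x - f x\<bar> \<le> 1 / Suc k" by auto
    moreover have "\<forall>x\<in>vertices k. u x = f x" using u(3) vertices_mono[of k "max N k"] by auto
    moreover have "\<E> u u \<le> ?L + 1 / Suc k" using u(4) level_energy_le_limit[OF f, of "max N k"] by simp
    ultimately show ?thesis by blast
  qed
  then obtain u where u: "\<And>k. u k \<in> F" "\<And>k. continuous_on fractal (u k)"
    "\<And>k x. x \<in> vertices k \<Longrightarrow> u k x = f x" "\<And>k. \<E> (u k) (u k) \<le> ?L + 1 / Suc k"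
    "\<And>k x. x \<in> fractal \<Longrightarrow> \<bar>u k x - f x\<bar> \<le> 1 / Suc k" by metis
  have fL2: "f \<in> L2 \<mu>" using cf by (rule L2_of_continuous)
  have uL2: "u k \<in> L2 \<mu>" for k using u(1) by (rule domain_L2)
  define b where "b N = 4 * ?L - 4 * level_energy N f f + 4 * (1 / Suc N) + (2 * (1 / Suc N))\<^sup>2" for N
  have bound: "form_norm_sq \<mu> \<E> (\<lambda>x. u m x - u n x) \<le> b N" if "N \<le> m" "N \<le> n" for m n N
  proof -
    have inv: "1 / Suc m \<le> 1 / Suc N" "1 / Suc n \<le> 1 / Suc N" using that by (auto simp: field_simps)
    have "level_energy N (\<lambda>x. u m x + u n x) (\<lambda>x. u m x + u n x) =
        level_energy N (\<lambda>x. 0 + 2 * f x) (\<lambda>x. 0 + 2 * f x)"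
      using u(3)[OF subsetD[OF vertices_mono[OF that(1)]]] u(3)[OF subsetD[OF vertices_mono[OF that(2)]]]
      by (intro level_energy_cong) simp_all
    then have "4 * level_energy N f f \<le> \<E> (\<lambda>x. u m x + u n x) (\<lambda>x. u m x + u n x)"
      using level_energy_le_form[of "\<lambda>x. u m x + u n x" N] u(1,2)
      unfolding level_energy_affine by (simp add: domain_add continuous_intros)
    moreover have "\<E> (\<lambda>x. u m x - u n x) (\<lambda>x. u m x - u n x) =
        2 * \<E> (u m) (u m) + 2 * \<E> (u n) (u n) - \<E> (\<lambda>x. u m x + u n x) (\<lambda>x. u m x + u n x)"
      using form_diag_add[OF u(1) u(1), of m n] form_diag_diff[OF u(1) u(1), of m n] by simp
    moreover have "\<E> (u m) (u m) \<le> ?L + 1 / Suc N" "\<E> (u n) (u n) \<le> ?L + 1 / Suc N"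
      using u(4)[of m] u(4)[of n] inv by linarith+
    moreover have "(LINT x|\<mu>. (u m x - u n x)\<^sup>2) \<le> (2 * (1 / Suc N))\<^sup>2"
    proof (rule integral_sq_le)
      fix x assume "x \<in> fractal"
      from u(5)[OF this, of m] u(5)[OF this, of n] inv
      show "\<bar>u m x - u n x\<bar> \<le> 2 * (1 / Suc N)" by linarith
    qed
    ultimately show ?thesis unfolding form_norm_sq_def b_def by linarith
  qed
  have inv0: "(\<lambda>N. 1 / real (Suc N)) \<longlonglongrightarrow> 0" by (rule LIMSEQ_Suc[OF lim_1_over_n])
  have "b \<longlonglongrightarrow> 4 * ?L - 4 * ?L + 4 * 0 + (2 * 0)\<^sup>2"
    unfolding b_def by (intro tendsto_intros level_energy_tendsto_limit_diag f inv0)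
  then have b0: "b \<longlonglongrightarrow> 0" by simp
  have "\<exists>N. \<forall>m\<ge>N. \<forall>n\<ge>N. form_norm_sq \<mu> \<E> (\<lambda>x. u m x - u n x) < \<epsilon>" if "\<epsilon> > 0" for \<epsilon>
  proof -
    obtain N where "b N < \<epsilon>"
      using order_tendstoD(2)[OF b0 \<open>\<epsilon> > 0\<close>] by (auto simp: eventually_sequentially)
    then show ?thesis using bound by (meson le_less_trans)
  qed
  from complete[of u, OF u(1) this] obtain v where v: "v \<in> F"
    "(\<lambda>n. form_norm_sq \<mu> \<E> (\<lambda>x. u n x - v x)) \<longlonglongrightarrow> 0" by blast
  define c where "c n = form_norm_sq \<mu> \<E> (\<lambda>x. u n x - v x)" for n
  have c0: "c \<longlonglongrightarrow> 0" using v(2) by (simp add: c_def[abs_def])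
  have c: "\<E> (\<lambda>x. u n x - v x) (\<lambda>x. u n x - v x) \<le> c n" "(LINT x|\<mu>. (u n x - v x)\<^sup>2) \<le> c n" for n
    using form_nonneg[OF domain_diff[OF u(1)[of n] v(1)]] integral_sq_nonneg[of "\<lambda>x. u n x - v x"]
    unfolding c_def form_norm_sq_def by linarith+
  have vL2: "v \<in> L2 \<mu>" using v(1) by (rule domain_L2)
  have "(LINT x|\<mu>. (f x - v x)\<^sup>2) \<le> 2 * (1 / Suc n)\<^sup>2 + 2 * c n" for n
  proof -
    have "(LINT x|\<mu>. (f x - u n x)\<^sup>2) \<le> (1 / Suc n)\<^sup>2"
      using u(5) by (intro integral_sq_le) (simp add: abs_minus_commute)
    then show ?thesis using integral_sq_add_le[OF fL2 uL2 vL2, of n] c(2)[of n] by linarith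
  qed
  moreover have "(\<lambda>n. 2 * (1 / real (Suc n))\<^sup>2 + 2 * c n) \<longlonglongrightarrow> 2 * 0\<^sup>2 + 2 * 0"
    by (intro tendsto_intros inv0 c0)
  ultimately have "(LINT x|\<mu>. (f x - v x)\<^sup>2) \<le> 2 * 0\<^sup>2 + 2 * 0"
    by (intro LIMSEQ_le_const[of "\<lambda>n. 2 * (1 / real (Suc n))\<^sup>2 + 2 * c n"]) auto
  then have "(LINT x|\<mu>. (f x - v x)\<^sup>2) = 0" using integral_sq_nonneg[of "\<lambda>x. f x - v x"] by simp
  then have "AE x in \<mu>. f x = v x" by (rule AE_eq_if_integral_sq_eq_0[OF fL2 vL2])
  then have AE: "AE x in \<mu>. v x = f x" by eventually_elim simp
  have fF: "f \<in> F" and fv: "\<E> f f = \<E> v v"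
    using form_diag_AE[OF v(1) measurable_of_continuous[OF cf] AE] by auto
  then show "f \<in> F" by simp
  \<comment> \<open>Weighting the mixed term by \<open>t\<close> makes the coefficient of the energy of \<open>u n\<close> as close to \<open>1\<close> as
    desired, at the expense of that of the vanishing energy of \<open>u n - v\<close>.\<close>
  have "\<E> v v \<le> (1 + t) * ?L" if t: "t > 0" for t :: real
  proof -
    have "\<E> v v \<le> (1 + t) * (?L + 1 / Suc n) + (1 + 1 / t) * c n" for n
    proof -
      define d where "d x = u n x - v x" for x
      have d: "d \<in> F" "\<E> d d \<le> c n"
        unfolding d_def[abs_def] using c(1) domain_diff[OF u(1) v(1)] by auto
      have "0 \<le> \<E> (\<lambda>x. t * u n x + d x) (\<lambda>x. t * u n x + d x)"
        by (intro form_nonneg domain_add domain_scale u d)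
      also have "\<dots> = t\<^sup>2 * \<E> (u n) (u n) + 2 * t * \<E> (u n) d + \<E> d d"
        using form_diag_add[OF domain_scale[OF u(1)] d(1)] form_diag_scale[OF u(1)]
          form_scale_left[OF u(1) d(1)] by simp
      finally have "0 \<le> (t\<^sup>2 * \<E> (u n) (u n) + 2 * t * \<E> (u n) d + \<E> d d) / t" using t by simp
      also have "\<dots> = t * \<E> (u n) (u n) + 2 * \<E> (u n) d + 1 / t * \<E> d d"
        using t by (simp add: field_simps power2_eq_square)
      finally have cross: "- 2 * \<E> (u n) d \<le> t * \<E> (u n) (u n) + 1 / t * \<E> d d" by simp
      have "v = (\<lambda>x. u n x - d x)" by (simp add: d_def)
      then have "\<E> v v = \<E> (u n) (u n) - 2 * \<E> (u n) d + \<E> d d"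
        using form_diag_diff[OF u(1) d(1), of n] by simp
      also have "\<dots> \<le> (1 + t) * \<E> (u n) (u n) + (1 + 1 / t) * \<E> d d"
        using cross by (simp add: distrib_right)
      also have "\<dots> \<le> (1 + t) * (?L + 1 / Suc n) + (1 + 1 / t) * c n"
        using u(4) d(2) t by (intro add_mono mult_left_mono) auto
      finally show ?thesis .
    qed
    moreover have "(\<lambda>n. (1 + t) * (?L + 1 / real (Suc n)) + (1 + 1 / t) * c n)
        \<longlonglongrightarrow> (1 + t) * (?L + 0) + (1 + 1 / t) * 0"
      by (intro tendsto_intros inv0 c0)
    ultimately have "\<E> v v \<le> (1 + t) * (?L + 0) + (1 + 1 / t) * 0"
      by (intro LIMSEQ_le_const[of "\<lambda>n. (1 + t) * (?L + 1 / real (Suc n)) + (1 + 1 / t) * c n"]) auto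
    then show ?thesis by simp
  qed
  then have "\<E> v v \<le> (1 + 1 / Suc n) * ?L" for n by simp
  moreover have "(\<lambda>n. (1 + 1 / real (Suc n)) * ?L) \<longlonglongrightarrow> (1 + 0) * ?L"
    by (intro tendsto_intros inv0)
  ultimately have "\<E> v v \<le> (1 + 0) * ?L"
    by (intro LIMSEQ_le_const[of "\<lambda>n. (1 + 1 / real (Suc n)) * ?L"]) auto
  moreover have "?L \<le> \<E> f f" using limit_energy_le[OF f level_energy_le_form[OF fF cf]] .
  ultimately show "\<E> f f = ?L" using fv by simp
qed

lemma form_norm_sq_diff_le:
  assumes "u \<in> F" "v \<in> F" "f \<in> F"
  shows "form_norm_sq \<mu> \<E> (\<lambda>x. u x - f x) \<le>
    2 * form_norm_sq \<mu> \<E> (\<lambda>x. v x - u x) + 2 * form_norm_sq \<mu> \<E> (\<lambda>x. v x - f x)"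
proof -
  define p where "p x = v x - f x" for x
  define q where "q x = v x - u x" for x
  have pq: "p \<in> F" "q \<in> F" unfolding p_def[abs_def] q_def[abs_def] by (intro domain_diff assms)+
  have "\<E> (\<lambda>x. p x - q x) (\<lambda>x. p x - q x) \<le> 2 * \<E> q q + 2 * \<E> p p"
    using form_diag_add[OF pq] form_diag_diff[OF pq] form_nonneg[OF domain_add[OF pq]] by simp
  moreover have "(\<lambda>x. p x - q x) = (\<lambda>x. u x - f x)" by (simp add: p_def q_def)
  moreover have "(LINT x|\<mu>. (u x - f x)\<^sup>2) \<le> 2 * (LINT x|\<mu>. (q x)\<^sup>2) + 2 * (LINT x|\<mu>. (p x)\<^sup>2)"
    using integral_sq_add_le[OF assms(1,2,3)[THEN domain_L2]]
    by (simp add: p_def q_def power2_commute[of "u _"])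
  ultimately show ?thesis by (simp add: form_norm_sq_def p_def[abs_def] q_def[abs_def])
qed

end

section \<open>Density of the continuous functions in the square-integrable functions\<close>

context tree_measure
begin

text \<open>
  By regularity of finite Borel measures a Borel set lies between a compact and an open set of almost
  the same measure, and a Urysohn function for this pair is the desired approximation.
\<close>

lemma indicator_approx_continuous:
  fixes \<epsilon> :: real
  assumes A: "A \<in> sets \<mu>" and "0 < \<epsilon>"
  shows "\<exists>g. continuous_on fractal g \<and> (LINT x|\<mu>. \<bar>indicator A x - g x\<bar>) < \<epsilon>"
proof -
  \<comment> \<open>Regularity is stated for measures on a whole space, so the measure is extended to the plane.\<close>
  define \<nu> where "\<nu> = distr \<mu> borel (\<lambda>x. x)"
  have cl: "closed fractal" using compact_fractal by (rule compact_imp_closed)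
  have bor: "A \<in> sets borel" if "A \<in> sets \<mu>" for A
    using that cl unfolding sets_eq by (auto simp: sets_restrict_space)
  have meas: "(\<lambda>x. x) \<in> measurable \<mu> borel"
    unfolding measurable_cong_sets[OF sets_eq refl] by (rule measurable_restrict_space1) simp
  have \<nu>: "emeasure \<nu> B = emeasure \<mu> (B \<inter> fractal)" if "B \<in> sets borel" for B
    unfolding \<nu>_def using that meas by (simp add: emeasure_distr)
  have s\<nu>: "sets \<nu> = sets borel" and f\<nu>: "emeasure \<nu> (space \<nu>) \<noteq> \<infinity>"
    using meas by (auto simp: \<nu>_def emeasure_distr emeasure_space_1)
  interpret \<nu>: finite_measure \<nu> using f\<nu> by (intro finite_measureI) simp
  have "\<exists>C\<in>{C. C \<subseteq> A \<and> compact C}. emeasure \<nu> A < emeasure \<nu> C + ennreal (\<epsilon> / 2)"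
    using assms(2) by (intro SUP_approx_ennreal inner_regular[OF s\<nu> f\<nu> bor[OF A]]) (auto simp: \<nu>.emeasure_eq_measure)
  then obtain C where C: "C \<subseteq> A" "compact C" "emeasure \<nu> A < emeasure \<nu> C + ennreal (\<epsilon> / 2)" by blast
  have "\<exists>U\<in>{U. A \<subseteq> U \<and> open U}. emeasure \<nu> U < emeasure \<nu> A + ennreal (\<epsilon> / 2)"
    using assms(2) by (intro INF_approx_ennreal outer_regular[OF s\<nu> f\<nu> bor[OF A]]) (auto simp: \<nu>.emeasure_eq_measure)
  then obtain U where U: "A \<subseteq> U" "open U" "emeasure \<nu> U < emeasure \<nu> A + ennreal (\<epsilon> / 2)" by blast
  have sCU: "C \<in> sets borel" "U \<in> sets borel" using C(2) U(2) by (auto intro: borel_compact)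
  have "measure \<nu> (U - C) = measure \<nu> U - measure \<nu> C"
    using C(1) U(1) sCU s\<nu> by (intro \<nu>.finite_measure_Diff) auto
  also have "\<dots> < \<epsilon>"
    using C(3) U(3) assms(2) unfolding \<nu>.emeasure_eq_measure
    by (simp add: ennreal_less_iff flip: ennreal_plus)
  finally have lt: "measure \<nu> (U - C) < \<epsilon>" .
  have UC: "(U - C) \<inter> fractal \<in> sets \<mu>"
    using sCU unfolding sets_eq by (auto simp: sets_restrict_space)
  have "measure \<nu> (U - C) = measure \<mu> ((U - C) \<inter> fractal)"
    using \<nu>[of "U - C"] sCU by (simp add: measure_def)
  with lt have lt: "measure \<mu> ((U - C) \<inter> fractal) < \<epsilon>" by simp
  have cCU: "closed C" "closed (- U)" "C \<inter> - U = {}" using C U compact_imp_closed by auto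
  obtain g :: "real \<times> real \<Rightarrow> real" where g: "continuous_on UNIV g" "\<And>x. g x \<in> closed_segment 1 0"
    "\<And>x. x \<in> C \<Longrightarrow> g x = 1" "\<And>x. x \<in> - U \<Longrightarrow> g x = 0"
    using Urysohn[OF cCU, of 1 0] by blast
  have g01: "0 \<le> g x" "g x \<le> 1" for x using g(2)[of x] by (auto simp: closed_segment_eq_real_ivl)
  have gc: "continuous_on fractal g" using g(1) continuous_on_subset by blast
  have "(LINT x|\<mu>. \<bar>indicator A x - g x\<bar>) \<le> (LINT x|\<mu>. indicator ((U - C) \<inter> fractal) x)"
  proof (rule integral_mono)
    show "integrable \<mu> (\<lambda>x. \<bar>indicator A x - g x\<bar>)"
      using A integrable_of_continuous[OF gc] by (auto simp: emeasure_eq_measure)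
    show "integrable \<mu> (indicator ((U - C) \<inter> fractal) :: _ \<Rightarrow> real)"
      using UC by (auto simp: emeasure_eq_measure)
    show "\<bar>indicator A x - g x\<bar> \<le> indicator ((U - C) \<inter> fractal) x" if "x \<in> space \<mu>" for x
      using that g01[of x] g(3)[of x] g(4)[of x] C(1) U(1)
      by (cases "x \<in> C"; cases "x \<in> U"; cases "x \<in> A") auto
  qed
  also have "\<dots> = measure \<mu> ((U - C) \<inter> fractal)" using UC by simp
  finally show ?thesis using lt gc by auto
qed

lemma integrable_approx_continuous:
  fixes f :: "real \<times> real \<Rightarrow> real"
  assumes "integrable \<mu> f" "0 < \<epsilon>"
  shows "\<exists>g. continuous_on fractal g \<and> (LINT x|\<mu>. \<bar>f x - g x\<bar>) < \<epsilon>"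
proof -
  have tri: "(LINT x|\<mu>. \<bar>f x - h x\<bar>) \<le> (LINT x|\<mu>. \<bar>f x - g x\<bar>) + (LINT x|\<mu>. \<bar>g x - h x\<bar>)"
    if "integrable \<mu> f" "integrable \<mu> g" "integrable \<mu> h" for f g h :: "real \<times> real \<Rightarrow> real"
  proof -
    have "(LINT x|\<mu>. \<bar>f x - h x\<bar>) \<le> (LINT x|\<mu>. \<bar>f x - g x\<bar> + \<bar>g x - h x\<bar>)"
      using that by (intro integral_mono) auto
    then show ?thesis using that by simp
  qed
  show ?thesis using assms
  proof (induction arbitrary: \<epsilon> rule: integrable_induct)
    case (base A c)
    have "0 < \<epsilon> / (\<bar>c\<bar> + 1)" using base(3) by (simp add: add_nonneg_pos)
    then obtain g where g: "continuous_on fractal g" "(LINT x|\<mu>. \<bar>indicator A x - g x\<bar>) < \<epsilon> / (\<bar>c\<bar> + 1)"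
      using indicator_approx_continuous[OF base(1)] by blast
    have "(LINT x|\<mu>. \<bar>indicator A x *\<^sub>R c - c * g x\<bar>) = (LINT x|\<mu>. \<bar>c\<bar> * \<bar>indicator A x - g x\<bar>)"
      by (intro Bochner_Integration.integral_cong) (auto simp: abs_mult[symmetric] algebra_simps)
    also have "\<dots> \<le> (\<bar>c\<bar> + 1) * (LINT x|\<mu>. \<bar>indicator A x - g x\<bar>)"
      by (simp add: mult_right_mono)
    also have "\<dots> < \<epsilon>" using g(2) by (simp add: pos_less_divide_eq mult.commute add_nonneg_pos)
    finally show ?case using g(1) by (intro exI[of _ "\<lambda>x. c * g x"]) (auto intro!: continuous_intros)
  next
    case (add f f')
    obtain g where g: "continuous_on fractal g" "(LINT x|\<mu>. \<bar>f x - g x\<bar>) < \<epsilon> / 2"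
      using add.IH(1)[of "\<epsilon> / 2"] add.prems by auto
    obtain g' where g': "continuous_on fractal g'" "(LINT x|\<mu>. \<bar>f' x - g' x\<bar>) < \<epsilon> / 2"
      using add.IH(2)[of "\<epsilon> / 2"] add.prems by auto
    note i = add.hyps integrable_of_continuous[OF g(1)] integrable_of_continuous[OF g'(1)]
    have "(LINT x|\<mu>. \<bar>f x + f' x - (g x + g' x)\<bar>) \<le> (LINT x|\<mu>. \<bar>f x - g x\<bar> + \<bar>f' x - g' x\<bar>)"
      using i by (intro integral_mono) auto
    also have "\<dots> < \<epsilon>" using i g(2) g'(2) by simp
    finally show ?case using g(1) g'(1)
      by (intro exI[of _ "\<lambda>x. g x + g' x"]) (auto intro!: continuous_intros)
  next
    case (lim f s)
    have "(\<lambda>i. LINT x|\<mu>. \<bar>f x - s i x\<bar>) \<longlonglongrightarrow> (LINT x|\<mu>. 0)"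
    proof (rule integral_dominated_convergence[where w = "\<lambda>x. 3 * \<bar>f x\<bar>"])
      show "AE x in \<mu>. (\<lambda>i. \<bar>f x - s i x\<bar>) \<longlonglongrightarrow> 0"
      proof (rule AE_I2)
        fix x assume "x \<in> space \<mu>"
        from tendsto_rabs[OF tendsto_diff[OF tendsto_const lim.hyps(2)[OF this], of "f x"]]
        show "(\<lambda>i. \<bar>f x - s i x\<bar>) \<longlonglongrightarrow> 0" by simp
      qed
      show "AE x in \<mu>. norm \<bar>f x - s i x\<bar> \<le> 3 * \<bar>f x\<bar>" for i
      proof (rule AE_I2)
        fix x assume "x \<in> space \<mu>"
        from lim.hyps(3)[OF this, of i] show "norm \<bar>f x - s i x\<bar> \<le> 3 * \<bar>f x\<bar>" by simp
      qed
    qed (use lim.hyps in auto)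
    then have "\<forall>\<^sub>F i in sequentially. (LINT x|\<mu>. \<bar>f x - s i x\<bar>) < \<epsilon> / 2"
      using lim.prems by (intro order_tendstoD(2)) auto
    then obtain i where i: "(LINT x|\<mu>. \<bar>f x - s i x\<bar>) < \<epsilon> / 2" by (auto simp: eventually_sequentially)
    obtain g where g: "continuous_on fractal g" "(LINT x|\<mu>. \<bar>s i x - g x\<bar>) < \<epsilon> / 2"
      using lim.IH[of "\<epsilon> / 2" i] lim.prems by auto
    then show ?case
      using tri[OF lim.hyps(4) lim.hyps(1)[of i] integrable_of_continuous[OF g(1)]] i
      by (intro exI[of _ g]) auto
  qed
qed

text \<open>
  Truncation at height \<open>n\<close> reduces this to approximation in the mean, because for functions bounded
  by \<open>n\<close> the squared distance is at most \<open>2 n\<close> times the distance.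
\<close>

lemma L2_approx_continuous:
  assumes f: "f \<in> L2 \<mu>" and \<epsilon>: "0 < \<epsilon>"
  shows "\<exists>g. continuous_on fractal g \<and> (LINT x|\<mu>. (f x - g x)\<^sup>2) < \<epsilon>"
proof -
  have [measurable]: "f \<in> borel_measurable \<mu>" using f by (simp add: L2_def)
  define T where "T n y = max (- real n) (min y (real n))" for n :: nat and y :: real
  have T: "\<bar>T n y\<bar> \<le> real n" "\<bar>y - T n y\<bar> \<le> \<bar>y\<bar>" "\<bar>T n y - T n z\<bar> \<le> \<bar>y - z\<bar>" for n y z
    by (auto simp: T_def)
  have T_lim: "(\<lambda>n. (y - T n y)\<^sup>2) \<longlonglongrightarrow> 0" for y
  proof (rule tendsto_eventually)
    obtain N :: nat where "\<bar>y\<bar> \<le> real N" using real_arch_simple by blast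
    then have "(y - T n y)\<^sup>2 = 0" if "n \<ge> N" for n using that by (auto simp: T_def)
    then show "\<forall>\<^sub>F n in sequentially. (y - T n y)\<^sup>2 = 0" by (auto simp: eventually_sequentially)
  qed
  have TL2: "(\<lambda>x. T n (g x)) \<in> L2 \<mu>" if [measurable]: "g \<in> borel_measurable \<mu>" for n g
  proof -
    have "(T n (g x))\<^sup>2 \<le> (real n)\<^sup>2" for x
      using T(1)[of n "g x"] by (simp add: abs_le_square_iff[symmetric])
    then have "integrable \<mu> (\<lambda>x. (T n (g x))\<^sup>2)"
      unfolding T_def by (intro integrable_const_bound[of _ "(real n)\<^sup>2"] AE_I2) (auto simp: T_def)
    then show ?thesis unfolding L2_def by (simp add: T_def)
  qed
  have "(\<lambda>n. LINT x|\<mu>. (f x - T n (f x))\<^sup>2) \<longlonglongrightarrow> (LINT x|\<mu>. 0)"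
  proof (rule integral_dominated_convergence[where w = "\<lambda>x. (f x)\<^sup>2"])
    show "integrable \<mu> (\<lambda>x. (f x)\<^sup>2)" using f by (simp add: L2_def)
    show "AE x in \<mu>. norm ((f x - T n (f x))\<^sup>2) \<le> (f x)\<^sup>2" for n
      using T(2) by (simp add: abs_le_square_iff[symmetric])
  qed (use T_lim in \<open>auto simp: T_def\<close>)
  then have "\<forall>\<^sub>F n in sequentially. (LINT x|\<mu>. (f x - T n (f x))\<^sup>2) < \<epsilon> / 4"
    using \<epsilon> by (intro order_tendstoD(2)) auto
  then obtain n where n: "(LINT x|\<mu>. (f x - T n (f x))\<^sup>2) < \<epsilon> / 4" by (auto simp: eventually_sequentially)
  have int: "integrable \<mu> (\<lambda>x. T n (f x))"
    using T(1) by (intro integrable_const_bound[of _ "real n"] AE_I2) (auto simp: T_def)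
  have "0 < \<epsilon> / (4 * (2 * real n + 1))" using \<epsilon> by (simp add: add_nonneg_pos)
  then obtain g where g: "continuous_on fractal g"
    "(LINT x|\<mu>. \<bar>T n (f x) - g x\<bar>) < \<epsilon> / (4 * (2 * real n + 1))"
    using integrable_approx_continuous[OF int] by blast
  have gT: "continuous_on fractal (\<lambda>x. T n (g x))"
    unfolding T_def by (intro continuous_intros g)
  have TT: "T n (T n y) = T n y" for y by (auto simp: T_def)
  have "(LINT x|\<mu>. (T n (f x) - T n (g x))\<^sup>2) \<le> (LINT x|\<mu>. 2 * real n * \<bar>T n (f x) - g x\<bar>)"
  proof (rule integral_mono)
    show "integrable \<mu> (\<lambda>x. (T n (f x) - T n (g x))\<^sup>2)"
      using L2_diff[OF TL2 L2_of_continuous[OF gT]] by (simp add: L2_def)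
    show "integrable \<mu> (\<lambda>x. 2 * real n * \<bar>T n (f x) - g x\<bar>)"
      using int integrable_of_continuous[OF g(1)] by simp
    show "(T n (f x) - T n (g x))\<^sup>2 \<le> 2 * real n * \<bar>T n (f x) - g x\<bar>" for x
    proof -
      have "\<bar>T n (f x) - T n (g x)\<bar> \<le> 2 * real n" using T(1)[of n "f x"] T(1)[of n "g x"] by linarith
      moreover have "\<bar>T n (f x) - T n (g x)\<bar> \<le> \<bar>T n (f x) - g x\<bar>"
        using T(3)[of n "T n (f x)" "g x"] by (simp add: TT)
      ultimately have "\<bar>T n (f x) - T n (g x)\<bar> * \<bar>T n (f x) - T n (g x)\<bar> \<le> 2 * real n * \<bar>T n (f x) - g x\<bar>"
        by (intro mult_mono) auto
      then show ?thesis by (simp add: power2_eq_square)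
    qed
  qed
  also have "\<dots> \<le> (2 * real n + 1) * (LINT x|\<mu>. \<bar>T n (f x) - g x\<bar>)"
    by (simp add: mult_right_mono)
  also have "\<dots> < \<epsilon> / 4"
    using g(2) by (simp add: pos_less_divide_eq add_nonneg_pos algebra_simps)
  finally have "(LINT x|\<mu>. (f x - T n (g x))\<^sup>2) < \<epsilon>"
    using integral_sq_add_le[OF f TL2[of f n] L2_of_continuous[OF gT]] n by simp
  then show ?thesis using gT by auto
qed

section \<open>The standard form\<close>

text \<open>
  Since the oscillation of \<open>g\<close> is controlled by its energy, \<open>g x\<close> may be compared with every value
  of \<open>g\<close>, and the resulting inequality is averaged over these values.
\<close>

lemma sq_le_form_norm_sq:
  assumes "g \<in> finite_energy" "x \<in> fractal"
  shows "(g x)\<^sup>2 \<le> (2 + 8 * osc_const\<^sup>2) * form_norm_sq \<mu> limit_energy g"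
proof -
  let ?E = "limit_energy g g"
  have E: "0 \<le> ?E" using assms(1) by (rule limit_energy_nonneg)
  have ptw: "(g x)\<^sup>2 \<le> 2 * (g y)\<^sup>2 + 8 * osc_const\<^sup>2 * ?E" if "y \<in> fractal" for y
  proof -
    define B where "B = osc_const * sqrt ?E"
    have B2: "B\<^sup>2 = osc_const\<^sup>2 * ?E" using E by (simp add: B_def power_mult_distrib)
    have "\<bar>g x\<bar> \<le> \<bar>g y\<bar> + 2 * B"
      using apex_oscillation[OF assms] apex_oscillation[OF assms(1) that] unfolding B_def by linarith
    then have "(g x)\<^sup>2 \<le> (\<bar>g y\<bar> + 2 * B)\<^sup>2" by (metis abs_ge_zero power2_abs power_mono)
    also have "\<dots> \<le> 2 * (g y)\<^sup>2 + 8 * B\<^sup>2"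
      using zero_le_power2[of "\<bar>g y\<bar> - 2 * B"] by (simp add: power2_sum power2_diff)
    finally show ?thesis by (simp add: B2)
  qed
  have int: "integrable \<mu> (\<lambda>y. (g y)\<^sup>2)"
    using L2_of_continuous[OF finite_energy_continuous[OF assms(1)]] by (simp add: L2_def)
  have "(LINT y|\<mu>. (g x)\<^sup>2) \<le> (LINT y|\<mu>. 2 * (g y)\<^sup>2 + 8 * osc_const\<^sup>2 * ?E)"
    using int ptw by (intro integral_mono) auto
  then have "(g x)\<^sup>2 \<le> 2 * (LINT y|\<mu>. (g y)\<^sup>2) + 8 * osc_const\<^sup>2 * ?E" using int by simp
  moreover have "0 \<le> 2 * ?E" "0 \<le> 8 * osc_const\<^sup>2 * (LINT y|\<mu>. (g y)\<^sup>2)"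
    using E integral_sq_nonneg by auto
  moreover have "(2 + 8 * osc_const\<^sup>2) * (?E + (LINT y|\<mu>. (g y)\<^sup>2)) =
      2 * (LINT y|\<mu>. (g y)\<^sup>2) + 8 * osc_const\<^sup>2 * ?E + 2 * ?E + 8 * osc_const\<^sup>2 * (LINT y|\<mu>. (g y)\<^sup>2)"
    by (simp add: algebra_simps)
  ultimately show ?thesis unfolding form_norm_sq_def by linarith
qed

text \<open>
  A Cauchy sequence in the form norm is uniformly Cauchy, since the form norm controls the supremum
  norm; and the discrete energies, hence also their supremum, are lower semicontinuous under
  pointwise convergence.
\<close>

lemma finite_energy_complete:
  assumes v: "\<And>n::nat. v n \<in> finite_energy"
    and cauchy: "\<And>\<epsilon>. \<epsilon> > 0 \<Longrightarrow>
      \<exists>N. \<forall>m\<ge>N. \<forall>n\<ge>N. form_norm_sq \<mu> limit_energy (\<lambda>x. v m x - v n x) < \<epsilon>"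
  shows "\<exists>l\<in>finite_energy. (\<lambda>n. form_norm_sq \<mu> limit_energy (\<lambda>x. v n x - l x)) \<longlonglongrightarrow> 0"
proof -
  define C where "C = 2 + 8 * osc_const\<^sup>2"
  have C: "0 < C" by (simp add: C_def add_pos_nonneg)
  have sup: "(v m x - v n x)\<^sup>2 \<le> C * form_norm_sq \<mu> limit_energy (\<lambda>x. v m x - v n x)"
    if "x \<in> fractal" for m n x
    unfolding C_def using sq_le_form_norm_sq[OF finite_energy_diff[OF v v] that] .
  have en: "limit_energy (\<lambda>x. v m x - v n x) (\<lambda>x. v m x - v n x) \<le>
      form_norm_sq \<mu> limit_energy (\<lambda>x. v m x - v n x)" for m n
    unfolding form_norm_sq_def using integral_sq_nonneg[of "\<lambda>x. v m x - v n x"] by simp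
  have "\<forall>e>0. \<exists>N. \<forall>m n x. N \<le> m \<and> N \<le> n \<and> x \<in> fractal \<longrightarrow> dist (v m x) (v n x) < e"
  proof (intro allI impI)
    fix e :: real assume e: "0 < e"
    then have "0 < e\<^sup>2 / C" using C by simp
    from cauchy[OF this] obtain N where
      N: "\<And>m n. m \<ge> N \<Longrightarrow> n \<ge> N \<Longrightarrow> form_norm_sq \<mu> limit_energy (\<lambda>x. v m x - v n x) < e\<^sup>2 / C" by blast
    have "dist (v m x) (v n x) < e" if "N \<le> m" "N \<le> n" "x \<in> fractal" for m n x
    proof -
      have "(v m x - v n x)\<^sup>2 < e\<^sup>2"
        using sup[OF that(3), of m n] N[OF that(1,2)] C by (simp add: field_simps)
      then have "\<bar>v m x - v n x\<bar> < e"
        using e by (metis abs_of_pos power2_abs power2_less_imp_less abs_ge_zero)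
      then show ?thesis by (simp add: dist_real_def)
    qed
    then show "\<exists>N. \<forall>m n x. N \<le> m \<and> N \<le> n \<and> x \<in> fractal \<longrightarrow> dist (v m x) (v n x) < e" by blast
  qed
  then obtain l where l: "\<forall>e>0. \<exists>N. \<forall>n x. N \<le> n \<and> x \<in> fractal \<longrightarrow> dist (v n x) (l x) < e"
    using uniformly_convergent_eq_cauchy[of "\<lambda>x. x \<in> fractal" v] by auto
  have ul: "uniform_limit fractal v l sequentially"
  proof (rule uniform_limitI)
    fix e :: real assume "0 < e"
    then show "\<forall>\<^sub>F n in sequentially. \<forall>x\<in>fractal. dist (v n x) (l x) < e"
      using l unfolding eventually_sequentially by blast
  qed
  have cl: "continuous_on fractal l"
    by (rule uniform_limit_theorem[OF _ ul]) (use finite_energy_continuous[OF v] in auto)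
  have lim: "(\<lambda>n. v n x) \<longlonglongrightarrow> l x" if "x \<in> fractal" for x
    using ul that by (rule tendsto_uniform_limitI)
  have close: "(\<lambda>x. v n x - l x) \<in> finite_energy \<and>
      form_norm_sq \<mu> limit_energy (\<lambda>x. v n x - l x) \<le> (1 + C) * \<epsilon>"
    if "\<epsilon> > 0" "\<And>m. m \<ge> n \<Longrightarrow> form_norm_sq \<mu> limit_energy (\<lambda>x. v n x - v m x) < \<epsilon>" for n \<epsilon>
  proof -
    have le: "level_energy k (\<lambda>x. v n x - l x) (\<lambda>x. v n x - l x) \<le> \<epsilon>" for k
    proof (rule LIMSEQ_le_const2)
      show "(\<lambda>m. level_energy k (\<lambda>x. v n x - v m x) (\<lambda>x. v n x - v m x)) \<longlonglongrightarrow>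
          level_energy k (\<lambda>x. v n x - l x) (\<lambda>x. v n x - l x)"
        by (intro tendsto_level_energy tendsto_intros lim)
      show "\<exists>N. \<forall>m\<ge>N. level_energy k (\<lambda>x. v n x - v m x) (\<lambda>x. v n x - v m x) \<le> \<epsilon>"
        using level_energy_le_limit[OF finite_energy_diff[OF v v], of k n] en[of n] that(2)
        by (meson less_imp_le order_trans)
    qed
    have fe: "(\<lambda>x. v n x - l x) \<in> finite_energy"
      using finite_energy_continuous[OF v] cl le by (intro finite_energyI continuous_intros)
    moreover have "(LINT x|\<mu>. (v n x - l x)\<^sup>2) \<le> (sqrt (C * \<epsilon>))\<^sup>2"
    proof (rule integral_sq_le)
      fix x assume x: "x \<in> fractal"
      have "(v n x - l x)\<^sup>2 \<le> C * \<epsilon>"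
      proof (rule LIMSEQ_le_const2)
        show "(\<lambda>m. (v n x - v m x)\<^sup>2) \<longlonglongrightarrow> (v n x - l x)\<^sup>2" by (intro tendsto_intros lim x)
        show "\<exists>N. \<forall>m\<ge>N. (v n x - v m x)\<^sup>2 \<le> C * \<epsilon>"
          using sup[OF x, of n] mult_left_mono[OF less_imp_le[OF that(2)] less_imp_le[OF C]]
          by (meson order_trans)
      qed
      then show "\<bar>v n x - l x\<bar> \<le> sqrt (C * \<epsilon>)" using real_sqrt_le_mono real_sqrt_abs by metis
    qed
    ultimately show ?thesis
      using limit_energy_le[OF fe le] C that(1) unfolding form_norm_sq_def by (simp add: algebra_simps)
  qed
  have "(\<lambda>n. form_norm_sq \<mu> limit_energy (\<lambda>x. v n x - l x)) \<longlonglongrightarrow> 0"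
  proof (rule LIMSEQ_I)
    fix e :: real assume e: "0 < e"
    define \<epsilon> where "\<epsilon> = e / (2 * (1 + C))"
    have "a * (e / (2 * a)) = e / 2" if "0 < a" for a using that by simp
    from this[of "1 + C"] have "(1 + C) * \<epsilon> = e / 2" unfolding \<epsilon>_def using C by linarith
    then have \<epsilon>: "0 < \<epsilon>" "(1 + C) * \<epsilon> < e" using e C by (simp_all add: \<epsilon>_def)
    from cauchy[OF \<epsilon>(1)] obtain N where
      N: "\<And>m n. m \<ge> N \<Longrightarrow> n \<ge> N \<Longrightarrow> form_norm_sq \<mu> limit_energy (\<lambda>x. v m x - v n x) < \<epsilon>" by blast
    have "norm (form_norm_sq \<mu> limit_energy (\<lambda>x. v n x - l x) - 0) < e" if "n \<ge> N" for n
    proof -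
      have c: "(\<lambda>x. v n x - l x) \<in> finite_energy"
        "form_norm_sq \<mu> limit_energy (\<lambda>x. v n x - l x) \<le> (1 + C) * \<epsilon>"
        using close[OF \<epsilon>(1), of n] N that by auto
      have "0 \<le> form_norm_sq \<mu> limit_energy (\<lambda>x. v n x - l x)"
        unfolding form_norm_sq_def using limit_energy_nonneg[OF c(1)] integral_sq_nonneg
        by (intro add_nonneg_nonneg) auto
      then show ?thesis using c(2) \<epsilon>(2) by simp
    qed
    then show "\<exists>N. \<forall>n\<ge>N. norm (form_norm_sq \<mu> limit_energy (\<lambda>x. v n x - l x) - 0) < e" by blast
  qed
  moreover have "l \<in> finite_energy"
  proof -
    from cauchy[of 1] obtain N where
      "\<And>m n. m \<ge> N \<Longrightarrow> n \<ge> N \<Longrightarrow> form_norm_sq \<mu> limit_energy (\<lambda>x. v m x - v n x) < 1" by auto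
    then have "(\<lambda>x. v N x - l x) \<in> finite_energy" using close[of 1 N] by simp
    from finite_energy_diff[OF v[of N] this] show ?thesis by simp
  qed
  ultimately show ?thesis by blast
qed

definition tree_domain :: "(real \<times> real \<Rightarrow> real) set" where
  "tree_domain = {u \<in> borel_measurable \<mu>. \<exists>v\<in>finite_energy. AE x in \<mu>. u x = v x}"

text \<open>
  Because the measure charges every cell, continuous versions are unique on the fractal, and the
  choice concerns only the values elsewhere.
\<close>

definition version :: "(real \<times> real \<Rightarrow> real) \<Rightarrow> real \<times> real \<Rightarrow> real" where
  "version u = (SOME v. v \<in> finite_energy \<and> (AE x in \<mu>. u x = v x))"

definition tree_form :: "(real \<times> real \<Rightarrow> real) \<Rightarrow> (real \<times> real \<Rightarrow> real) \<Rightarrow> real" where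
  "tree_form u v = limit_energy (version u) (version v)"

lemma version:
  assumes "u \<in> tree_domain"
  shows "version u \<in> finite_energy" "AE x in \<mu>. u x = version u x"
proof -
  have "\<exists>v. v \<in> finite_energy \<and> (AE x in \<mu>. u x = v x)" using assms by (auto simp: tree_domain_def)
  from someI_ex[OF this] show "version u \<in> finite_energy" "AE x in \<mu>. u x = version u x"
    by (auto simp: version_def)
qed

lemma tree_domainI:
  assumes "v \<in> finite_energy" "u \<in> borel_measurable \<mu>" "AE x in \<mu>. u x = v x"
  shows "u \<in> tree_domain"
  using assms by (auto simp: tree_domain_def)

lemma version_unique:
  assumes "v \<in> finite_energy" "u \<in> borel_measurable \<mu>" "AE x in \<mu>. u x = v x" "x \<in> fractal"
  shows "version u x = v x"
proof (rule continuous_eq_if_AE_eq[OF _ _ _ assms(4)])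
  note ver = version[OF tree_domainI[OF assms(1-3)]]
  show "continuous_on fractal (version u)" "continuous_on fractal v"
    using ver(1) assms(1) by (auto intro: finite_energy_continuous)
  show "AE x in \<mu>. version u x = v x" using ver(2) assms(3) by eventually_elim simp
qed

lemma tree_form_eq:
  assumes "v \<in> finite_energy" "u \<in> borel_measurable \<mu>" "AE x in \<mu>. u x = v x"
    and "v' \<in> finite_energy" "u' \<in> borel_measurable \<mu>" "AE x in \<mu>. u' x = v' x"
  shows "tree_form u u' = limit_energy v v'"
  unfolding tree_form_def by (intro limit_energy_cong version_unique assms)

lemma finite_energy_measurable: "v \<in> finite_energy \<Longrightarrow> v \<in> borel_measurable \<mu>"
  by (intro measurable_of_continuous finite_energy_continuous)

lemma finite_energy_subset_tree_domain: "v \<in> finite_energy \<Longrightarrow> v \<in> tree_domain"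
  by (rule tree_domainI) (auto intro: finite_energy_measurable)

lemma continuous_in_tree_domain:
  assumes "u \<in> tree_domain" "continuous_on fractal u"
  shows "u \<in> finite_energy"
proof (rule finite_energy_cong[OF version(1)[OF assms(1)]])
  note ver = version[OF assms(1)]
  have "AE x in \<mu>. version u x = u x" using ver(2) by eventually_elim simp
  then show "version u x = u x" if "x \<in> fractal" for x
    using that by (intro continuous_eq_if_AE_eq finite_energy_continuous ver(1) assms(2))
qed

lemma tree_form_finite_energy:
  "u \<in> finite_energy \<Longrightarrow> v \<in> finite_energy \<Longrightarrow> tree_form u v = limit_energy u v"
  by (rule tree_form_eq) (auto intro: finite_energy_measurable)

lemma form_norm_sq_tree_form:
  assumes "v \<in> finite_energy" "u \<in> borel_measurable \<mu>" "AE x in \<mu>. u x = v x"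
  shows "form_norm_sq \<mu> tree_form u = form_norm_sq \<mu> limit_energy v"
proof -
  have [measurable]: "v \<in> borel_measurable \<mu>" "u \<in> borel_measurable \<mu>"
    using assms by (auto intro: finite_energy_measurable)
  have "(LINT x|\<mu>. (u x)\<^sup>2) = (LINT x|\<mu>. (v x)\<^sup>2)"
    using assms(3) by (intro integral_cong_AE) auto
  then show ?thesis using tree_form_eq[OF assms assms] by (simp add: form_norm_sq_def)
qed

lemma tree_domain_measurable: "u \<in> tree_domain \<Longrightarrow> u \<in> borel_measurable \<mu>"
  by (simp add: tree_domain_def)

lemma symmetric_form_tree: "symmetric_form \<mu> tree_form tree_domain"
  unfolding symmetric_form_def
proof (intro conjI ballI allI impI)
  show "tree_domain \<subseteq> L2 \<mu>"
  proof
    fix u assume u: "u \<in> tree_domain"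
    have "AE x in \<mu>. version u x = u x" using version(2)[OF u] by eventually_elim simp
    then show "u \<in> L2 \<mu>"
      by (rule L2_AE_eq[OF L2_of_continuous[OF finite_energy_continuous[OF version(1)[OF u]]]
            tree_domain_measurable[OF u]])
  qed
  show "(\<lambda>x. 0) \<in> tree_domain" by (intro finite_energy_subset_tree_domain finite_energy_const)
  fix u v assume u: "u \<in> tree_domain"
  note um = tree_domain_measurable[OF u] note uv = version[OF u]
  show "0 \<le> tree_form u u" unfolding tree_form_def using uv(1) by (rule limit_energy_nonneg)
  show "(\<lambda>x. c * u x) \<in> tree_domain" for c
    using uv(2) um by (intro tree_domainI[OF finite_energy_scale[OF uv(1)]]) (auto elim!: eventually_mono)
  show "tree_form (\<lambda>x. c * u x) f = c * tree_form u f" if f: "f \<in> tree_domain" for f c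
  proof -
    have "tree_form (\<lambda>x. c * u x) f = limit_energy (\<lambda>x. c * version u x) (version f)"
      using uv(2) um tree_domain_measurable[OF f] version[OF f]
      by (intro tree_form_eq finite_energy_scale uv(1)) (auto elim!: eventually_mono)
    then show ?thesis
      unfolding tree_form_def[of u f] using limit_energy_scale_left uv(1) version(1)[OF f] by simp
  qed
  {
    fix v assume v: "v \<in> borel_measurable \<mu>" and AE: "AE x in \<mu>. u x = v x"
    have AE': "AE x in \<mu>. v x = version u x" using uv(2) AE by eventually_elim simp
    show "v \<in> tree_domain" by (rule tree_domainI[OF uv(1) v AE'])
    show "tree_form u f = tree_form v f" if f: "f \<in> tree_domain" for f
      using tree_form_eq[OF uv(1) um uv(2) version(1)[OF f] tree_domain_measurable[OF f] version(2)[OF f]]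
        tree_form_eq[OF uv(1) v AE' version(1)[OF f] tree_domain_measurable[OF f] version(2)[OF f]] by simp
  }
  {
    fix v assume v: "v \<in> tree_domain"
    note vm = tree_domain_measurable[OF v] note vv = version[OF v]
    have AE: "AE x in \<mu>. u x + v x = version u x + version v x" using uv(2) vv(2) by eventually_elim simp
    show "(\<lambda>x. u x + v x) \<in> tree_domain"
      using um vm AE by (intro tree_domainI[OF finite_energy_add[OF uv(1) vv(1)]]) auto
    show "tree_form u v = tree_form v u" unfolding tree_form_def by (rule limit_energy_commute)
    show "tree_form (\<lambda>x. u x + v x) f = tree_form u f + tree_form v f" if f: "f \<in> tree_domain" for f
    proof -
      have "tree_form (\<lambda>x. u x + v x) f = limit_energy (\<lambda>x. version u x + version v x) (version f)"
        using um vm AE tree_domain_measurable[OF f] version[OF f]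
        by (intro tree_form_eq finite_energy_add uv(1) vv(1)) auto
      then show ?thesis unfolding tree_form_def[of u f] tree_form_def[of v f]
        using limit_energy_add_left uv(1) vv(1) version(1)[OF f] by simp
    qed
  }
qed

lemma markov_tree:
  assumes "u \<in> tree_domain"
  shows "(\<lambda>x. min (max (u x) 0) 1) \<in> tree_domain"
    and "tree_form (\<lambda>x. min (max (u x) 0) 1) (\<lambda>x. min (max (u x) 0) 1) \<le> tree_form u u"
proof -
  note ver = version[OF assms]
  let ?v = "\<lambda>x. min (max (version u x) 0) 1"
  have "continuous_on fractal ?v" by (intro continuous_intros finite_energy_continuous ver)
  then have v: "?v \<in> finite_energy" "limit_energy ?v ?v \<le> limit_energy (version u) (version u)"
    by (rule limit_energy_contraction[OF ver(1)]; simp)+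
  have m: "(\<lambda>x. min (max (u x) 0) 1) \<in> borel_measurable \<mu>"
    using tree_domain_measurable[OF assms] by simp
  have AE: "AE x in \<mu>. min (max (u x) 0) 1 = ?v x" using ver(2) by eventually_elim simp
  show "(\<lambda>x. min (max (u x) 0) 1) \<in> tree_domain" by (rule tree_domainI[OF v(1) m AE])
  show "tree_form (\<lambda>x. min (max (u x) 0) 1) (\<lambda>x. min (max (u x) 0) 1) \<le> tree_form u u"
    using v(2) tree_form_eq[OF v(1) m AE v(1) m AE] by (simp add: tree_form_def)
qed

lemma self_similar_tree: "self_similar_form s \<mu> tree_form tree_domain"
proof -
  let ?sum = "\<lambda>u. \<Sum>i<4. ennreal (1 / s i) * energy tree_form tree_domain (u \<circ> ifs i)"
  have dom: "energy tree_form tree_domain u = ?sum u" if u: "u \<in> tree_domain" for u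
  proof -
    note ver = version[OF u] and um = tree_domain_measurable[OF u]
    note vm = finite_energy_measurable[OF ver(1)]
    have cell: "(\<lambda>x. u (ifs i x)) \<in> tree_domain"
      "tree_form (\<lambda>x. u (ifs i x)) (\<lambda>x. u (ifs i x)) =
        limit_energy (\<lambda>x. version u (ifs i x)) (\<lambda>x. version u (ifs i x))" if i: "i < 4" for i
    proof -
      note facts = finite_energy_comp_ifs[OF ver(1) i] measurable_comp_ifs[OF um i]
        AE_eq_comp_ifs[OF um vm ver(2) i]
      show "(\<lambda>x. u (ifs i x)) \<in> tree_domain" by (rule tree_domainI[OF facts])
      show "tree_form (\<lambda>x. u (ifs i x)) (\<lambda>x. u (ifs i x)) =
        limit_energy (\<lambda>x. version u (ifs i x)) (\<lambda>x. version u (ifs i x))"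
        by (rule tree_form_eq[OF facts facts])
    qed
    have "?sum u = (\<Sum>i<4. ennreal (1 / s i *
        limit_energy (\<lambda>x. version u (ifs i x)) (\<lambda>x. version u (ifs i x))))"
      using cell s_pos limit_energy_nonneg[OF finite_energy_comp_ifs[OF ver(1)]]
      by (intro sum.cong refl) (simp add: energy_def comp_def ennreal_mult[symmetric] less_imp_le)
    also have "\<dots> = ennreal (\<Sum>i<4. 1 / s i *
        limit_energy (\<lambda>x. version u (ifs i x)) (\<lambda>x. version u (ifs i x)))"
      using s_pos limit_energy_nonneg[OF finite_energy_comp_ifs[OF ver(1)]]
      by (intro sum_ennreal) (simp add: less_imp_le)
    also have "\<dots> = energy tree_form tree_domain u"
      using u limit_energy_self_similar[OF ver(1) ver(1)] by (simp add: energy_def tree_form_def)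
    finally show ?thesis by simp
  qed
  have "energy tree_form tree_domain u = ?sum u" if u: "u \<notin> tree_domain" "continuous_on fractal u" for u
  proof -
    have "\<not> (\<forall>i<4. (\<lambda>x. u (ifs i x)) \<in> tree_domain)"
    proof
      assume H: "\<forall>i<4. (\<lambda>x. u (ifs i x)) \<in> tree_domain"
      have "u \<in> finite_energy"
      proof (rule finite_energy_if_comp_ifs[OF u(2)])
        show "(\<lambda>x. u (ifs i x)) \<in> finite_energy" if "i < 4" for i
          using H that continuous_on_comp_ifs[OF u(2) that]
          by (intro continuous_in_tree_domain) (auto simp: comp_def)
      qed
      then show False using u(1) finite_energy_subset_tree_domain by blast
    qed
    then obtain i where i: "i < 4" "(\<lambda>x. u (ifs i x)) \<notin> tree_domain" by blast
    have "ennreal (1 / s i) * energy tree_form tree_domain (u \<circ> ifs i) = \<infinity>"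
      using i s_pos[OF i(1)] by (simp add: energy_def comp_def ennreal_mult_eq_top_iff ennreal_eq_0_iff)
    then have "?sum u = \<infinity>" using i(1) by (auto simp: ennreal_sum_eq_top)
    moreover have "energy tree_form tree_domain u = \<infinity>" using u(1) by (simp add: energy_def)
    ultimately show ?thesis by (rule trans[OF _ sym, rotated])
  qed
  with dom show ?thesis unfolding self_similar_form_def by auto
qed

text \<open>
  The arm function attains the resistance, since any other admissible function has at least the same
  energy already at level \<open>0\<close>.
\<close>

lemma resistance_tree:
  assumes "k < 2"
  shows "effective_resistance \<mu> tree_form tree_domain q1 (arm_tip k) = 1"
proof -
  let ?A = "{u \<in> tree_domain. continuous_on (space \<mu>) u \<and> u q1 = 0 \<and> u (arm_tip k) = 1}"
  obtain h where h: "continuous_on fractal h" "h q1 = 0" "h (arm_tip k) = 1"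
    "\<And>n. level_energy n h h = 1" using arm_function_exists[OF assms] by blast
  have hf: "h \<in> finite_energy" using h(1,4) by (intro finite_energyI[of h 1]) auto
  have "limit_energy h h \<le> 1" using hf h(4) by (intro limit_energy_le) auto
  then have "energy tree_form tree_domain h \<le> 1"
    using finite_energy_subset_tree_domain[OF hf] tree_form_finite_energy[OF hf hf]
    by (simp add: energy_def)
  then have "(INF u\<in>?A. energy tree_form tree_domain u) \<le> 1"
    using h finite_energy_subset_tree_domain[OF hf] by (intro INF_lower2[of h]) auto
  moreover have "1 \<le> (INF u\<in>?A. energy tree_form tree_domain u)"
  proof (rule INF_greatest)
    fix u assume u: "u \<in> ?A"
    have uf: "u \<in> finite_energy" using u by (intro continuous_in_tree_domain) auto
    have "1 \<le> level_energy 0 u u" using u by (auto simp: arm_tip_def split: if_splits)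
    also have "\<dots> \<le> tree_form u u"
      unfolding tree_form_finite_energy[OF uf uf] by (rule level_energy_le_limit[OF uf])
    finally show "1 \<le> energy tree_form tree_domain u"
      using u by (simp add: energy_def)
  qed
  ultimately have "(INF u\<in>?A. energy tree_form tree_domain u) = 1" by (rule antisym)
  then show ?thesis unfolding effective_resistance_def by simp
qed

text \<open>
  This makes the interpolation lemma available for the standard form, which yields the density of its
  domain.
\<close>

sublocale tree: self_similar_markov_form s w \<mu> tree_form tree_domain
  by unfold_locales
     (use symmetric_form_tree markov_tree self_similar_tree resistance_tree
        finite_energy_subset_tree_domain[OF finite_energy_const] in auto)

lemma tree_domain_approx_continuous:
  assumes "continuous_on fractal f" "0 < \<epsilon>"
  shows "\<exists>v\<in>tree_domain. continuous_on fractal v \<and> (\<forall>x\<in>fractal. \<bar>f x - v x\<bar> \<le> \<epsilon>)"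
proof -
  obtain n where "cell_osc_le n \<epsilon> f"
    using eventually_cell_osc_le[OF assms] by (auto simp: eventually_sequentially)
  from tree.interpolation[OF assms(1) _ this, of 1] show ?thesis
    by (auto simp: abs_minus_commute)
qed

lemma tree_domain_dense:
  assumes "f \<in> L2 \<mu>" "0 < \<epsilon>"
  shows "\<exists>u\<in>tree_domain. (LINT x|\<mu>. (f x - u x)\<^sup>2) < \<epsilon>"
proof -
  obtain g where g: "continuous_on fractal g" "(LINT x|\<mu>. (f x - g x)\<^sup>2) < \<epsilon> / 4"
    using L2_approx_continuous[OF assms(1), of "\<epsilon> / 4"] assms(2) by auto
  have "0 < sqrt (\<epsilon> / 4)" using assms(2) by simp
  then obtain v where v: "v \<in> tree_domain" "\<And>x. x \<in> fractal \<Longrightarrow> \<bar>g x - v x\<bar> \<le> sqrt (\<epsilon> / 4)"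
    using tree_domain_approx_continuous[OF g(1)] by blast
  have "(LINT x|\<mu>. (g x - v x)\<^sup>2) \<le> (sqrt (\<epsilon> / 4))\<^sup>2" using v(2) by (rule integral_sq_le)
  then have "(LINT x|\<mu>. (f x - v x)\<^sup>2) < \<epsilon>"
    using integral_sq_add_le[OF assms(1) L2_of_continuous[OF g(1)] tree.domain_L2[OF v(1)]] g(2) assms(2)
    by simp
  then show ?thesis using v(1) by blast
qed

text \<open>
  Only the continuous versions matter for the form norm, so completeness carries over from the
  continuous functions of finite energy.
\<close>

lemma tree_complete:
  assumes u: "\<And>n::nat. u n \<in> tree_domain"
    and cauchy: "\<And>\<epsilon>. \<epsilon> > 0 \<Longrightarrow>
      \<exists>N. \<forall>m\<ge>N. \<forall>n\<ge>N. form_norm_sq \<mu> tree_form (\<lambda>x. u m x - u n x) < \<epsilon>"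
  shows "\<exists>v\<in>finite_energy. (\<lambda>n. form_norm_sq \<mu> tree_form (\<lambda>x. u n x - v x)) \<longlonglongrightarrow> 0"
proof -
  define v where "v n = version (u n)" for n
  have v: "v n \<in> finite_energy" "AE x in \<mu>. u n x = v n x" for n
    unfolding v_def using version[OF u] by auto
  have norm: "form_norm_sq \<mu> tree_form (\<lambda>x. u n x - l x) = form_norm_sq \<mu> limit_energy (\<lambda>x. v n x - k x)"
    if "k \<in> finite_energy" "l \<in> borel_measurable \<mu>" "AE x in \<mu>. l x = k x" for n l k
  proof (rule form_norm_sq_tree_form[OF finite_energy_diff[OF v(1) that(1)]])
    show "(\<lambda>x. u n x - l x) \<in> borel_measurable \<mu>" using that(2) tree_domain_measurable[OF u] by simp
    show "AE x in \<mu>. u n x - l x = v n x - k x" using v(2)[of n] that(3) by eventually_elim simp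
  qed
  have "\<exists>l\<in>finite_energy. (\<lambda>n. form_norm_sq \<mu> limit_energy (\<lambda>x. v n x - l x)) \<longlonglongrightarrow> 0"
  proof (rule finite_energy_complete[OF v(1)])
    fix \<epsilon> :: real assume "\<epsilon> > 0"
    then show "\<exists>N. \<forall>m\<ge>N. \<forall>n\<ge>N. form_norm_sq \<mu> limit_energy (\<lambda>x. v m x - v n x) < \<epsilon>"
      using cauchy norm[OF v(1) tree_domain_measurable[OF u] v(2)] by simp
  qed
  then obtain l where l: "l \<in> finite_energy"
    "(\<lambda>n. form_norm_sq \<mu> limit_energy (\<lambda>x. v n x - l x)) \<longlonglongrightarrow> 0" by blast
  show ?thesis
    using l(2) norm[OF l(1) finite_energy_measurable[OF l(1)]] by (intro bexI[OF _ l(1)]) simp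
qed

lemma dirichlet_form_tree: "dirichlet_form \<mu> tree_form tree_domain"
  unfolding dirichlet_form_def
proof (intro conjI allI ballI impI)
  fix u :: "nat \<Rightarrow> real \<times> real \<Rightarrow> real"
  assume "\<forall>n. u n \<in> tree_domain"
    "\<forall>\<epsilon>>0. \<exists>N. \<forall>m\<ge>N. \<forall>n\<ge>N. form_norm_sq \<mu> tree_form (\<lambda>x. u m x - u n x) < \<epsilon>"
  then show "\<exists>v\<in>tree_domain. (\<lambda>n. form_norm_sq \<mu> tree_form (\<lambda>x. u n x - v x)) \<longlonglongrightarrow> 0"
    using tree_complete[of u] finite_energy_subset_tree_domain by blast
qed (use symmetric_form_tree tree_domain_dense markov_tree in auto)

lemma regular_form_tree: "regular_form \<mu> tree_form tree_domain"
  unfolding regular_form_def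
proof (intro conjI allI ballI impI)
  fix u and \<epsilon> :: real assume u: "u \<in> tree_domain" and \<epsilon>: "0 < \<epsilon>"
  note ver = version[OF u]
  have "form_norm_sq \<mu> tree_form (\<lambda>x. u x - version u x) = form_norm_sq \<mu> limit_energy (\<lambda>x. 0)"
    using ver tree_domain_measurable[OF u] finite_energy_measurable[OF ver(1)]
    by (intro form_norm_sq_tree_form finite_energy_const) (auto elim!: eventually_mono)
  also have "\<dots> = 0" by (simp add: form_norm_sq_def limit_energy_def)
  finally show "\<exists>v\<in>tree_domain. continuous_on (space \<mu>) v \<and> form_norm_sq \<mu> tree_form (\<lambda>x. u x - v x) < \<epsilon>"
    using \<epsilon> finite_energy_subset_tree_domain[OF ver(1)] finite_energy_continuous[OF ver(1)]
    by (intro bexI[of _ "version u"]) auto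
next
  fix f :: "real \<times> real \<Rightarrow> real" and \<epsilon> :: real
  assume "continuous_on (space \<mu>) f" "0 < \<epsilon>"
  then show "\<exists>v\<in>tree_domain. continuous_on (space \<mu>) v \<and> (\<forall>x\<in>space \<mu>. \<bar>f x - v x\<bar> < \<epsilon>)"
    using tree_domain_approx_continuous[of f "\<epsilon> / 2"] by fastforce
qed

section \<open>Uniqueness\<close>

text \<open>
  Truncation at height \<open>1\<close> turns a function that is uniformly close to \<open>2\<close> into the constant \<open>1\<close>.
\<close>

lemma one_in_regular_domain:
  assumes "dirichlet_form \<mu> \<E> F" "regular_form \<mu> \<E> F"
  shows "(\<lambda>x. 1) \<in> F"
proof -
  have c: "continuous_on (space \<mu>) (\<lambda>x. 2 :: real)" by simp
  from assms(2)[unfolded regular_form_def, THEN conjunct2, rule_format, OF c zero_less_one]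
  obtain v where v: "v \<in> F" "\<And>x. x \<in> fractal \<Longrightarrow> \<bar>2 - v x\<bar> < 1" by auto
  have dom: "u \<in> F \<Longrightarrow> f \<in> borel_measurable \<mu> \<Longrightarrow> AE x in \<mu>. u x = f x \<Longrightarrow> f \<in> F" for u f
    using assms(1) unfolding dirichlet_form_def symmetric_form_def by blast
  show ?thesis
  proof (rule dom)
    show "(\<lambda>x. min (max (v x) 0) 1) \<in> F" using assms(1) v(1) unfolding dirichlet_form_def by blast
    show "AE x in \<mu>. min (max (v x) 0) 1 = 1"
      using v(2) by (intro AE_I2) (force simp: abs_less_iff)
  qed simp
qed

text \<open>
  Any solution has the same continuous part as the standard form.  By regularity an element \<open>u\<close> of its
  domain is the limit of a sequence in this part, which is Cauchy also for the standard form; its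
  limit there can only be \<open>u\<close>, as both limits are limits in \<open>L\<^sup>2\<close>.
\<close>

theorem tree_form_unique:
  assumes D: "dirichlet_form \<mu> \<E> F" and R: "regular_form \<mu> \<E> F" and S: "self_similar_form s \<mu> \<E> F"
    and res: "effective_resistance \<mu> \<E> F q1 q2 = 1" "effective_resistance \<mu> \<E> F q1 q3 = 1"
  shows "F = tree_domain" and "\<And>u v. u \<in> F \<Longrightarrow> v \<in> F \<Longrightarrow> \<E> u v = tree_form u v"
proof -
  interpret self_similar_markov_form s w \<mu> \<E> F
  proof unfold_locales
    show "symmetric_form \<mu> \<E> F" using D by (simp add: dirichlet_form_def)
    show "(\<lambda>x. min (max (u x) 0) 1) \<in> F \<and>
        \<E> (\<lambda>x. min (max (u x) 0) 1) (\<lambda>x. min (max (u x) 0) 1) \<le> \<E> u u" if "u \<in> F" for u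
      using D that unfolding dirichlet_form_def by blast
    show "(\<lambda>x. 1) \<in> F" by (rule one_in_regular_domain[OF D R])
    show "effective_resistance \<mu> \<E> F q1 (arm_tip k) = 1" if "k < 2" for k
      using res by (simp add: arm_tip_def)
  qed (rule S)
  have complete: "\<exists>v\<in>F. (\<lambda>n. form_norm_sq \<mu> \<E> (\<lambda>x. u n x - v x)) \<longlonglongrightarrow> 0"
    if "\<And>n::nat. u n \<in> F"
      "\<And>\<epsilon>. \<epsilon> > 0 \<Longrightarrow> \<exists>N. \<forall>m\<ge>N. \<forall>n\<ge>N. form_norm_sq \<mu> \<E> (\<lambda>x. u m x - u n x) < \<epsilon>" for u
    using D that unfolding dirichlet_form_def by blast
  have fe: "v \<in> F" "\<E> v v = limit_energy v v" if "v \<in> finite_energy" for v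
    using finite_energy_in_domain[OF complete that] by blast+
  have diag: "u \<in> F \<and> \<E> u u = tree_form u u" if u: "u \<in> tree_domain" for u
  proof -
    note ver = version[OF u]
    have "AE x in \<mu>. version u x = u x" using ver(2) by eventually_elim simp
    from form_diag_AE[OF fe(1)[OF ver(1)] tree_domain_measurable[OF u] this]
    show ?thesis using fe(2)[OF ver(1)] by (simp add: tree_form_def)
  qed
  have sub: "u \<in> tree_domain" if u: "u \<in> F" for u
  proof -
    have "\<exists>v. v \<in> F \<and> continuous_on fractal v \<and> form_norm_sq \<mu> \<E> (\<lambda>x. u x - v x) < 1 / Suc n" for n :: nat
      using R[unfolded regular_form_def, THEN conjunct1, rule_format, OF u, of "1 / Suc n"] by auto
    then obtain v where v: "\<And>n. v n \<in> F" "\<And>n. continuous_on fractal (v n)"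
      "\<And>n. form_norm_sq \<mu> \<E> (\<lambda>x. u x - v n x) < 1 / Suc n" by metis
    have vf: "v n \<in> finite_energy" for n by (rule finite_energy_of_domain[OF v(1,2)])
    have norm_eq: "form_norm_sq \<mu> \<E> g = form_norm_sq \<mu> limit_energy g" if "g \<in> finite_energy" for g
      using fe(2)[OF that] by (simp add: form_norm_sq_def)
    have inv0: "(\<lambda>N. 1 / real (Suc N)) \<longlonglongrightarrow> 0" by (rule LIMSEQ_Suc[OF lim_1_over_n])
    have "\<exists>l\<in>finite_energy. (\<lambda>n. form_norm_sq \<mu> limit_energy (\<lambda>x. v n x - l x)) \<longlonglongrightarrow> 0"
    proof (rule finite_energy_complete[OF vf])
      fix \<epsilon> :: real assume "\<epsilon> > 0"
      then obtain N where N: "\<And>n. n \<ge> N \<Longrightarrow> 1 / real (Suc n) < \<epsilon> / 4"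
        using order_tendstoD(2)[OF inv0, of "\<epsilon> / 4"] by (auto simp: eventually_sequentially)
      have "form_norm_sq \<mu> limit_energy (\<lambda>x. v m x - v n x) < \<epsilon>" if "m \<ge> N" "n \<ge> N" for m n
        using form_norm_sq_diff_le[OF v(1)[of m] u v(1)[of n]] v(3)[of m] v(3)[of n] N[OF that(1)] N[OF that(2)]
        unfolding norm_eq[OF finite_energy_diff[OF vf vf]] by linarith
      then show "\<exists>N. \<forall>m\<ge>N. \<forall>n\<ge>N. form_norm_sq \<mu> limit_energy (\<lambda>x. v m x - v n x) < \<epsilon>" by blast
    qed
    then obtain l where l: "l \<in> finite_energy"
      "(\<lambda>n. form_norm_sq \<mu> limit_energy (\<lambda>x. v n x - l x)) \<longlonglongrightarrow> 0" by blast
    have lF: "l \<in> F" by (rule fe(1)[OF l(1)])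
    have "(LINT x|\<mu>. (u x - l x)\<^sup>2) \<le>
        2 * (1 / real (Suc n)) + 2 * form_norm_sq \<mu> limit_energy (\<lambda>x. v n x - l x)" for n
    proof -
      have "(LINT x|\<mu>. (u x - v n x)\<^sup>2) \<le> 1 / Suc n"
        using v(3)[of n] form_nonneg[OF domain_diff[OF u v(1)[of n]]] unfolding form_norm_sq_def by linarith
      moreover have "(LINT x|\<mu>. (v n x - l x)\<^sup>2) \<le> form_norm_sq \<mu> limit_energy (\<lambda>x. v n x - l x)"
        using limit_energy_nonneg[OF finite_energy_diff[OF vf[of n] l(1)]] unfolding form_norm_sq_def by linarith
      ultimately show ?thesis
        using integral_sq_add_le[OF domain_L2[OF u] domain_L2[OF v(1)[of n]] domain_L2[OF lF]] by linarith
    qed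
    moreover have "(\<lambda>n. 2 * (1 / real (Suc n)) + 2 * form_norm_sq \<mu> limit_energy (\<lambda>x. v n x - l x))
        \<longlonglongrightarrow> 2 * 0 + 2 * 0"
      by (intro tendsto_intros inv0 l(2))
    ultimately have "(LINT x|\<mu>. (u x - l x)\<^sup>2) \<le> 2 * 0 + 2 * 0"
      by (intro LIMSEQ_le_const) auto
    then have "(LINT x|\<mu>. (u x - l x)\<^sup>2) = 0" using integral_sq_nonneg[of "\<lambda>x. u x - l x"] by simp
    then have "AE x in \<mu>. u x = l x" by (rule AE_eq_if_integral_sq_eq_0[OF domain_L2[OF u] domain_L2[OF lF]])
    then show ?thesis by (rule tree_domainI[OF l(1) domain_measurable[OF u]])
  qed
  show eq: "F = tree_domain" using diag sub by blast
  show "\<E> u v = tree_form u v" if "u \<in> F" "v \<in> F" for u v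
  proof -
    note uv = that that[unfolded eq]
    have "2 * \<E> u v = \<E> (\<lambda>x. u x + v x) (\<lambda>x. u x + v x) - \<E> u u - \<E> v v"
      using form_diag_add[OF uv(1,2)] by simp
    also have "\<dots> = tree_form (\<lambda>x. u x + v x) (\<lambda>x. u x + v x) - tree_form u u - tree_form v v"
      using diag[OF tree.domain_add[OF uv(3,4)]] diag[OF uv(3)] diag[OF uv(4)] by simp
    also have "\<dots> = 2 * tree_form u v"
      using tree.form_diag_add[OF uv(3,4)] by simp
    finally show ?thesis by simp
  qed
qed

end

theorem proposition2p1:
  fixes s w :: "nat \<Rightarrow> real" and \<mu> :: "(real \<times> real) measure"
  assumes "0 < s 0" and "s 0 < 1"
    and "s 1 = s 0" and "s 2 = 1 - s 0" and "s 3 = 1 - s 0"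
    and "\<And>i. i < 4 \<Longrightarrow> 0 < w i \<and> w i < 1" and "(\<Sum>i<4. w i) = 1"
    and "self_similar_measure w \<mu>"
  shows "let solution = (\<lambda>\<E> F.
           dirichlet_form \<mu> \<E> F \<and> regular_form \<mu> \<E> F \<and> self_similar_form s \<mu> \<E> F \<and>
           effective_resistance \<mu> \<E> F q1 q2 = 1 \<and> effective_resistance \<mu> \<E> F q1 q3 = 1)
         in \<exists>\<E> F. solution \<E> F \<and>
              (\<forall>\<E>' F'. solution \<E>' F' \<longrightarrow> F' = F \<and> (\<forall>u\<in>F. \<forall>v\<in>F. \<E>' u v = \<E> u v))"
proof -
  interpret tree_measure s w \<mu>
    by unfold_locales (use assms in auto)
  have "effective_resistance \<mu> tree_form tree_domain q1 q2 = 1"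
    "effective_resistance \<mu> tree_form tree_domain q1 q3 = 1"
    using resistance_tree[of 0] resistance_tree[of 1] by (auto simp: arm_tip_def)
  note solution = dirichlet_form_tree regular_form_tree self_similar_tree this
  show ?thesis
    unfolding Let_def
  proof (intro exI[of _ tree_form] exI[of _ tree_domain] conjI allI impI solution)
    fix \<E>' F'
    assume "dirichlet_form \<mu> \<E>' F' \<and> regular_form \<mu> \<E>' F' \<and> self_similar_form s \<mu> \<E>' F' \<and>
      effective_resistance \<mu> \<E>' F' q1 q2 = 1 \<and> effective_resistance \<mu> \<E>' F' q1 q3 = 1"
    then have *: "dirichlet_form \<mu> \<E>' F'" "regular_form \<mu> \<E>' F'" "self_similar_form s \<mu> \<E>' F'"
      "effective_resistance \<mu> \<E>' F' q1 q2 = 1" "effective_resistance \<mu> \<E>' F' q1 q3 = 1" by auto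
    show "F' = tree_domain" by (rule tree_form_unique(1)[OF *])
    then show "\<forall>u\<in>tree_domain. \<forall>v\<in>tree_domain. \<E>' u v = tree_form u v"
      using tree_form_unique(2)[OF *] by blast
  qed
qed

end
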